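(* Let $T\in(0,+\infty)$, let $A$, $F$, $Q$, $W$ satisfy the assumptions (A), (F), (Q), (W) of the context, let $\mathbf{s}$ be an admissible parameter, let $u_0\in\mathcal{H}^{\mathbf{s}_0}$ with $\mathbf{s}_0\ge\mathbf{s}$, and let $\Phi:\mathcal{C}_{\mathbf{s},T}\to\mathbb{R}$ be an admissible test function, i.e. $\Phi$ is bounded and of class $\mathcal{C}^2$ with bounded first and second order Fréchet derivatives with respect to the norm $\|\cdot\|_{\infty,\mathbf{s},T}$. Let $u$ be the mild solution of $du(t)=Au(t)\,dt+F(u(t))\,dt+dW^Q(t)$, $u(0)=u_0$, and for $N\in\mathbb{N}^*$ let $u_N$ be its spectral Galerkin approximation. Then for any $\epsilon\in(0,\mathbf{s}_Q-\mathbf{s})$ there exists a constant $C_{\epsilon,\mathbf{s}}(\Phi)\in(0,+\infty)$ such that for any $N\in\mathbb{N}^*$ $$\big|\mathbb{E}[\Phi(u)]-\mathbb{E}[\Phi(u_N)]\big|\le C_{\epsilon,\mathbf{s}}(\Phi)\Bigl(\frac{1}{\lambda_{N+1}^{(\mathbf{s}_0-\mathbf{s})/2}}|u_0|_{\mathbf{s}_0}+\frac{1}{\lambda_{N+1}^{1-(\mathbf{s}_F+\mathbf{s}+\epsilon)/2}}+\frac{1}{\lambda_{N+1}^{\mathbf{s}_Q-\mathbf{s}-\epsilon}}\Bigr).$$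
   Context: $H$ is a separable infinite-dimensional real Hilbert space with scalar product $\langle\cdot,\cdot\rangle$; $\mathbb{N}^*=\{1,2,\ldots\}$. (A) $A$ is an unbounded self-adjoint linear operator on $H$ with dense domain $D(A)$ and compact resolvent; there are a non-decreasing sequence $(\lambda_k)_{k\in\mathbb{N}^*}$ of strictly positive reals and an orthonormal basis $(e_k)_{k\in\mathbb{N}^*}$ of $H$ with $Ae_k=-\lambda_ke_k$. Then $e^{tA}x=\sum_k e^{-t\lambda_k}\langle x,e_k\rangle e_k$. For $\mathbf{r}\in\mathbb{R}$, $\mathcal{H}^{\mathbf{r}}$ is the Hilbert space obtained by completing the linear span of the $e_k$ under the norm $|x|_{\mathbf{r}}^2=\sum_k\lambda_k^{\mathbf{r}}\langle x,e_k\rangle^2$; all pairings $\langle\cdot,e_k\rangle$, $e^{tA}$ and $P_N$ (below) extend to these spaces. (F) For some $\mathbf{s}_F\in[0,1)$, $F:\mathcal{H}^{\mathbf{s}_F}\to\mathcal{H}^{-\mathbf{s}_F}$ is of class $\mathcal{C}^2$ with bounded first and second order Fréchet derivatives. (Q) $Q:H\to H$ is self-adjoint and bounded, with $Qe_k=q_ke_k$ for a bounded sequence $(q_k)$ of nonnegative reals. (W) $W(t)=\sum_{k}\beta_k(t)e_k$ is a cylindrical Wiener process on $H$, where $(\beta_k)$ are independent standard real Wiener processes on a filtered probability space satisfying the usual conditions, and $W^Q(t)=\sum_k\sqrt{q_k}\,\beta_k(t)e_k$. It is assumed that $\mathrm{Tr}((-A)^{-1}Q)<+\infty$. Set $\mathbf{s}_Q^0=\sup\{\mathbf{r}\in\mathbb{R}^+:\mathrm{Tr}((-A)^{\mathbf{r}-1}Q)<+\infty\}$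 and $\mathbf{s}_Q=\min(\mathbf{s}_Q^0,1)$. It is assumed that $\mathbf{s}_F<\mathbf{s}_Q$. A parameter $\mathbf{s}\in\mathbb{R}^+$ is admissible if $\mathbf{s}_F\le\mathbf{s}<1$ and $\mathbf{s}<\mathbf{s}_Q$. $\mathcal{C}_{\mathbf{s},T}=\mathcal{C}([0,T],\mathcal{H}^{\mathbf{s}})$ with norm $\|Y\|_{\infty,\mathbf{s},T}=\sup_{0\le t\le T}|Y(t)|_{\mathbf{s}}$. The mild solution $u$ is the unique process with (a version with) paths in $\mathcal{C}_{\mathbf{s},T}$ satisfying $u(t)=e^{tA}u_0+\int_0^te^{(t-r)A}F(u(r))\,dr+W^{A,Q}(t)$, where $W^{A,Q}(t)=\int_0^te^{(t-r)A}dW^Q(r)$ is the stochastic convolution (with its version in $\mathcal{C}_{\mathbf{s},T}$). $P_N$ is the orthogonal projection onto $H_N=\mathrm{span}\{e_1,\ldots,e_N\}$. The spectral Galerkin approximation $u_N$ is the unique $H_N$-valued mild solution of $du_N(t)=Au_N(t)\,dt+P_NF(u_N(t))\,dt+P_N\,dW^Q(t)$, $u_N(0)=P_Nu_0$, i.e. $u_N(t)=P_Ne^{tA}u_0+P_N\int_0^te^{(t-r)A}F(u_N(r))\,dr+P_NW^{A,Q}(t)$. *)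

theory Defs
  imports "HOL-Probability.Probability"
begin

text \<open>
  The basis and all sequences attached to it are indexed by \<open>{1..}\<close>; the value of
  such a sequence at \<open>0\<close> is never used.
\<close>

section \<open>The operators on the Hilbert space\<close>

definition orthonormal_basis :: "(nat \<Rightarrow> 'h::real_inner) \<Rightarrow> bool" where
  "orthonormal_basis e \<longleftrightarrow>
     (\<forall>i\<ge>1. \<forall>j\<ge>1. e i \<bullet> e j = (if i = j then 1 else 0)) \<and>
     closure (span (e ` {1..})) = UNIV"

text \<open>
  An unbounded operator is a function together with its domain. The last conjunct says that
  \<open>A\<close> and its adjoint have the same graph, in particular the same domain.
\<close>

definition self_adjoint_operator :: "'h::real_inner set \<Rightarrow> ('h \<Rightarrow> 'h) \<Rightarrow> bool" where
  "self_adjoint_operator D A \<longleftrightarrow>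
     subspace D \<and> closure D = UNIV \<and>
     (\<forall>x\<in>D. \<forall>y\<in>D. A (x + y) = A x + A y) \<and>
     (\<forall>c. \<forall>x\<in>D. A (c *\<^sub>R x) = c *\<^sub>R A x) \<and>
     (\<forall>y z. (y \<in> D \<and> z = A y) \<longleftrightarrow> (\<forall>x\<in>D. A x \<bullet> y = x \<bullet> z))"

definition compact_resolvent :: "'h::real_normed_vector set \<Rightarrow> ('h \<Rightarrow> 'h) \<Rightarrow> bool" where
  "compact_resolvent D A \<longleftrightarrow>
     (\<exists>\<mu>::real. \<exists>R. bounded_linear R \<and>
        (\<forall>x. R x \<in> D \<and> \<mu> *\<^sub>R R x - A (R x) = x) \<and>
        (\<forall>x\<in>D. R (\<mu> *\<^sub>R x - A x) = x) \<and>
        compact (closure (R ` cball 0 1)))"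

definition assumption_A ::
    "'h::real_inner set \<Rightarrow> ('h \<Rightarrow> 'h) \<Rightarrow> (nat \<Rightarrow> real) \<Rightarrow> (nat \<Rightarrow> 'h) \<Rightarrow> bool" where
  "assumption_A D A lam e \<longleftrightarrow>
     self_adjoint_operator D A \<and> compact_resolvent D A \<and>
     (\<forall>k\<ge>1. 0 < lam k) \<and> mono_on {1..} lam \<and>
     orthonormal_basis e \<and>
     (\<forall>k\<ge>1. e k \<in> D \<and> A (e k) = - lam k *\<^sub>R e k)"

definition assumption_Q ::
    "('h::real_inner \<Rightarrow> 'h) \<Rightarrow> (nat \<Rightarrow> real) \<Rightarrow> (nat \<Rightarrow> 'h) \<Rightarrow> bool" where
  "assumption_Q Q q e \<longleftrightarrow>
     bounded_linear Q \<and> (\<forall>x y. Q x \<bullet> y = x \<bullet> Q y) \<and>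
     (\<forall>k\<ge>1. Q (e k) = q k *\<^sub>R e k \<and> 0 \<le> q k) \<and> bounded (q ` {1..})"

definition neg_A_power ::
    "(nat \<Rightarrow> real) \<Rightarrow> (nat \<Rightarrow> 'h::real_inner) \<Rightarrow> real \<Rightarrow> 'h \<Rightarrow> 'h" where
  "neg_A_power lam e a x = (\<Sum>\<^sub>\<infinity>k\<in>{1..}. (lam k powr a * (x \<bullet> e k)) *\<^sub>R e k)"

text \<open>Finiteness of the trace of an operator \<open>B\<close> that is nonnegative on the basis.\<close>

definition finite_trace :: "(nat \<Rightarrow> 'h::real_inner) \<Rightarrow> ('h \<Rightarrow> 'h) \<Rightarrow> bool" where
  "finite_trace e B \<longleftrightarrow> (\<lambda>k. B (e k) \<bullet> e k) summable_on {1..}"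

text \<open>The supremum may be infinite, hence the extended reals.\<close>

definition s_Q0 ::
    "(nat \<Rightarrow> real) \<Rightarrow> (nat \<Rightarrow> 'h::real_inner) \<Rightarrow> ('h \<Rightarrow> 'h) \<Rightarrow> ereal" where
  "s_Q0 lam e Q =
     Sup (ereal ` {r. 0 \<le> r \<and> finite_trace e (neg_A_power lam e (r - 1) \<circ> Q)})"

definition s_Q ::
    "(nat \<Rightarrow> real) \<Rightarrow> (nat \<Rightarrow> 'h::real_inner) \<Rightarrow> ('h \<Rightarrow> 'h) \<Rightarrow> real" where
  "s_Q lam e Q = real_of_ereal (min (s_Q0 lam e Q) 1)"


section \<open>The scale of Hilbert spaces\<close>

text \<open>
  A type cannot depend on the exponent \<open>r\<close>, so the completion of the linear span of the basis
  under the norm \<open>|x|\<^sub>r\<close> is a Hilbert space type \<open>'a\<close> with an isometric embedding \<open>J\<close> of the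
  span onto a dense subspace, which determines it up to isometric isomorphism. For \<open>r = 0\<close>
  the space itself, with \<open>J = id\<close>, is such a completion.
\<close>

definition is_scale_space ::
    "(nat \<Rightarrow> real) \<Rightarrow> (nat \<Rightarrow> 'h::real_inner) \<Rightarrow> real \<Rightarrow> ('h \<Rightarrow> 'a::{real_inner,banach}) \<Rightarrow> bool" where
  "is_scale_space lam e r J \<longleftrightarrow>
     (\<forall>x\<in>span (e ` {1..}). \<forall>y\<in>span (e ` {1..}). J (x + y) = J x + J y) \<and>
     (\<forall>c. \<forall>x\<in>span (e ` {1..}). J (c *\<^sub>R x) = c *\<^sub>R J x) \<and>
     (\<forall>x\<in>span (e ` {1..}). (norm (J x))\<^sup>2 = (\<Sum>\<^sub>\<infinity>k\<in>{1..}. lam k powr r * (x \<bullet> e k)\<^sup>2)) \<and>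
     closure (J ` span (e ` {1..})) = UNIV"

text \<open>
  The extension of \<open>\<lambda>x. x \<bullet> e k\<close> to the completion. The images \<open>J (e k)\<close> are orthogonal in \<open>'a\<close>,
  of squared norm \<open>lam k powr r\<close>, which is divided out; see \<open>pairing_extends_inner\<close>.
\<close>

definition pairing ::
    "(nat \<Rightarrow> 'h) \<Rightarrow> ('h \<Rightarrow> 'a::real_inner) \<Rightarrow> nat \<Rightarrow> 'a \<Rightarrow> real" where
  "pairing e J k x = (x \<bullet> J (e k)) / (J (e k) \<bullet> J (e k))"

text \<open>
  The extension of \<open>x \<mapsto> (\<Sum>k. m k \<langle>x, e\<^sub>k\<rangle> e\<^sub>k)\<close> to a map from the completion \<open>J\<close> to the completion \<open>K\<close>.
\<close>

definition diagonal_map ::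
    "(nat \<Rightarrow> 'h) \<Rightarrow> ('h \<Rightarrow> 'a::real_inner) \<Rightarrow> ('h \<Rightarrow> 'b::real_inner) \<Rightarrow> (nat \<Rightarrow> real) \<Rightarrow> 'a \<Rightarrow> 'b" where
  "diagonal_map e J K m x = (\<Sum>\<^sub>\<infinity>k\<in>{1..}. (m k * pairing e J k x) *\<^sub>R K (e k))"

definition inclusion ::
    "(nat \<Rightarrow> 'h) \<Rightarrow> ('h \<Rightarrow> 'a::real_inner) \<Rightarrow> ('h \<Rightarrow> 'b::real_inner) \<Rightarrow> 'a \<Rightarrow> 'b" where
  "inclusion e J K = diagonal_map e J K (\<lambda>_. 1)"

definition semigroup ::
    "(nat \<Rightarrow> real) \<Rightarrow> (nat \<Rightarrow> 'h) \<Rightarrow> ('h \<Rightarrow> 'a::real_inner) \<Rightarrow> ('h \<Rightarrow> 'b::real_inner) \<Rightarrow> real \<Rightarrow> 'a \<Rightarrow> 'b" where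
  "semigroup lam e J K t = diagonal_map e J K (\<lambda>k. exp (- t * lam k))"

definition galerkin_space :: "(nat \<Rightarrow> 'h::real_vector) \<Rightarrow> nat \<Rightarrow> 'h set" where
  "galerkin_space e N = span (e ` {1..N})"

definition galerkin_proj ::
    "(nat \<Rightarrow> 'h) \<Rightarrow> ('h \<Rightarrow> 'a::real_inner) \<Rightarrow> nat \<Rightarrow> 'a \<Rightarrow> 'a" where
  "galerkin_proj e J N x = (\<Sum>k\<in>{1..N}. pairing e J k x *\<^sub>R J (e k))"

lemma pairing_extends_inner:
  assumes e: "orthonormal_basis e" and lam: "\<forall>k\<ge>1. 0 < lam k"
    and J: "is_scale_space lam e r J" and x: "x \<in> span (e ` {1..})" and k: "k \<ge> 1"
  shows "pairing e J k (J x) = x \<bullet> e k"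
proof -
  let ?S = "span (e ` {1..})"
  have orth: "e i \<bullet> e j = (if i = j then 1 else 0)" if "i \<ge> 1" "j \<ge> 1" for i j
    using e that by (auto simp: orthonormal_basis_def)
  have add: "J (y + z) = J y + J z" and scale: "J (c *\<^sub>R y) = c *\<^sub>R J y"
    and nrm: "(norm (J y))\<^sup>2 = (\<Sum>\<^sub>\<infinity>k\<in>{1..}. lam k powr r * (y \<bullet> e k)\<^sup>2)"
    if "y \<in> ?S" "z \<in> ?S" for y z c
    using J that by (auto simp: is_scale_space_def)
  have inS: "e j \<in> ?S" if "j \<ge> 1" for j
    using that by (auto intro: span_base)
  have n1: "J (e j) \<bullet> J (e j) = lam j powr r" if j: "j \<ge> 1" for j
  proof -
    have "(norm (J (e j)))\<^sup>2 = (\<Sum>\<^sub>\<infinity>k\<in>{j}. lam k powr r * (e j \<bullet> e k)\<^sup>2)"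
      unfolding nrm[OF inS[OF j] inS[OF j]]
      by (rule infsum_cong_neutral) (use j orth in auto)
    then show ?thesis
      using j by (simp add: orth power2_norm_eq_inner)
  qed
  have J_orth: "J (e j) \<bullet> J (e k) = 0" if j: "j \<ge> 1" and jk: "j \<noteq> k" for j
  proof -
    have sum_in: "e j + e k \<in> ?S"
      using inS[OF j] inS[OF k] by (rule span_add)
    have "(norm (J (e j + e k)))\<^sup>2 = (\<Sum>\<^sub>\<infinity>i\<in>{j, k}. lam i powr r * ((e j + e k) \<bullet> e i)\<^sup>2)"
      unfolding nrm[OF sum_in sum_in]
      by (rule infsum_cong_neutral) (use j k orth in \<open>auto simp: inner_add_left\<close>)
    also have "\<dots> = lam j powr r + lam k powr r"
      using j k jk by (simp add: orth inner_add_left)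
    finally have "(J (e j) + J (e k)) \<bullet> (J (e j) + J (e k)) = lam j powr r + lam k powr r"
      using add[OF inS[OF j] inS[OF k]] by (simp add: power2_norm_eq_inner)
    then show ?thesis
      using n1[OF j] n1[OF k] by (simp add: inner_add_left inner_add_right inner_commute)
  qed
  have J0: "J 0 = 0"
    using scale[of 0 0 0] by (simp add: span_zero)
  have "x \<in> ?S \<and> J x \<bullet> J (e k) = lam k powr r * (x \<bullet> e k)"
    using x
  proof (induction rule: span_induct_alt)
    case base
    then show ?case by (simp add: J0 span_zero)
  next
    case (step c y z)
    then obtain j where j: "j \<ge> 1" "y = e j" by auto
    have z: "z \<in> ?S" using step by simp
    moreover have "c *\<^sub>R y + z \<in> ?S"
      using inS[OF j(1)] j(2) z by (simp add: span_add span_scale)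
    moreover have "J (c *\<^sub>R y + z) = c *\<^sub>R J y + J z"
      using add[of "c *\<^sub>R y" z] scale[of y z c] inS[OF j(1)] z j(2) by (simp add: span_scale)
    moreover have "J y \<bullet> J (e k) = lam k powr r * (y \<bullet> e k)"
      using j k n1[of k] J_orth[of j] orth[of j k] by (cases "j = k") auto
    ultimately show ?case
      using step by (simp add: inner_add_left algebra_simps)
  qed
  then have "J x \<bullet> J (e k) = lam k powr r * (x \<bullet> e k)" by simp
  moreover have "lam k powr r \<noteq> 0"
    using lam k by (metis less_irrefl powr_eq_0_iff)
  ultimately show ?thesis
    by (simp add: pairing_def n1[OF k])
qed


section \<open>Functions of class C2 and the path space\<close>

definition C2_bounded_derivs :: "('a::real_normed_vector \<Rightarrow> 'b::real_normed_vector) \<Rightarrow> bool" where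
  "C2_bounded_derivs f \<longleftrightarrow>
     (\<exists>(f' :: 'a \<Rightarrow> 'a \<Rightarrow>\<^sub>L 'b) (f'' :: 'a \<Rightarrow> 'a \<Rightarrow>\<^sub>L 'a \<Rightarrow>\<^sub>L 'b).
        (\<forall>x. (f has_derivative blinfun_apply (f' x)) (at x)) \<and>
        (\<forall>x. (f' has_derivative blinfun_apply (f'' x)) (at x)) \<and>
        continuous_on UNIV f'' \<and>
        bounded (range f') \<and> bounded (range f''))"

definition admissible_test_function :: "('p::real_normed_vector \<Rightarrow> real) \<Rightarrow> bool" where
  "admissible_test_function \<Phi> \<longleftrightarrow> bounded (range \<Phi>) \<and> C2_bounded_derivs \<Phi>"

text \<open>
  A type cannot depend on \<open>T\<close>, so the space of continuous functions \<open>[0,T] \<rightarrow> 'a\<close>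
  with the supremum norm is a normed space type \<open>'p\<close> with a linear isometric bijection \<open>path_at\<close> onto it:
  \<open>path_at y t\<close> is the value of the path \<open>y\<close> at time \<open>t \<in> [0,T]\<close>.
\<close>

definition is_path_space ::
    "real \<Rightarrow> ('p::real_normed_vector \<Rightarrow> real \<Rightarrow> 'a::real_normed_vector) \<Rightarrow> bool" where
  "is_path_space T path_at \<longleftrightarrow>
     (\<forall>x y. \<forall>t\<in>{0..T}. path_at (x + y) t = path_at x t + path_at y t) \<and>
     (\<forall>c x. \<forall>t\<in>{0..T}. path_at (c *\<^sub>R x) t = c *\<^sub>R path_at x t) \<and>
     (\<forall>x. continuous_on {0..T} (path_at x)) \<and>
     (\<forall>f. continuous_on {0..T} f \<longrightarrow> (\<exists>x. \<forall>t\<in>{0..T}. path_at x t = f t)) \<and>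
     (\<forall>x. norm x = (SUP t\<in>{0..T}. norm (path_at x t)))"


section \<open>The noise\<close>

text \<open>Filtrations and processes are indexed by \<open>t \<ge> 0\<close>; their values at negative times are not used.\<close>

definition usual_filtration :: "'w measure \<Rightarrow> (real \<Rightarrow> 'w measure) \<Rightarrow> bool" where
  "usual_filtration M G \<longleftrightarrow>
     (\<forall>t\<ge>0. subalgebra M (G t)) \<and>
     (\<forall>t\<ge>0. \<forall>t'\<ge>t. sets (G t) \<subseteq> sets (G t')) \<and>
     (\<forall>A\<in>null_sets M. \<forall>B\<subseteq>A. B \<in> sets (G 0)) \<and>
     (\<forall>t\<ge>0. sets (G t) = (\<Inter>t'\<in>{t<..}. sets (G t')))"

definition standard_wiener_process ::
    "'w measure \<Rightarrow> (real \<Rightarrow> 'w measure) \<Rightarrow> (real \<Rightarrow> 'w \<Rightarrow> real) \<Rightarrow> bool" where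
  "standard_wiener_process M G b \<longleftrightarrow>
     (\<forall>t\<ge>0. b t \<in> borel_measurable (G t)) \<and>
     (AE \<omega> in M. b 0 \<omega> = 0) \<and>
     (AE \<omega> in M. continuous_on {0..} (\<lambda>t. b t \<omega>)) \<and>
     (\<forall>t\<ge>0. \<forall>t'>t.
        distributed M lborel (\<lambda>\<omega>. b t' \<omega> - b t \<omega>) (normal_density 0 (sqrt (t' - t))) \<and>
        prob_space.indep_set M (sets (G t))
          (sets (vimage_algebra (space M) (\<lambda>\<omega>. b t' \<omega> - b t \<omega>) borel)))"

text \<open>
  The last conjunct is the mutual independence of the processes, as random elements of
  \<open>\<real>\<^bsup>[0,\<infinity>)\<^esup>\<close> with the product sigma-algebra.
\<close>

definition assumption_W ::
    "'w measure \<Rightarrow> (real \<Rightarrow> 'w measure) \<Rightarrow> (nat \<Rightarrow> real \<Rightarrow> 'w \<Rightarrow> real) \<Rightarrow> bool" where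
  "assumption_W M G \<beta> \<longleftrightarrow>
     prob_space M \<and> usual_filtration M G \<and>
     (\<forall>k\<ge>1. standard_wiener_process M G (\<beta> k)) \<and>
     prob_space.indep_vars M (\<lambda>k. PiM {0..} (\<lambda>t. borel))
       (\<lambda>k \<omega>. \<lambda>t\<in>{0..}. \<beta> k t \<omega>) {1..}"

text \<open>
  The Wiener integral of a deterministic square integrable \<open>f : [0,t] \<rightarrow> 'h\<close>. A list of triples
  \<open>(a, b, c)\<close> encodes the step function \<open>\<Sum> 1\<^bsub>(a,b]\<^esub> c\<close>, whose integral is \<open>\<Sum> (\<beta>(b) - \<beta>(a)) c\<close>;
  by the isometry property the limit \<open>X\<close> does not depend on the approximating step functions
  and is unique up to almost sure equality.
\<close>

definition step_fun :: "(real \<times> real \<times> 'h::real_normed_vector) list \<Rightarrow> real \<Rightarrow> 'h" where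
  "step_fun xs r = (\<Sum>(a, b, c)\<leftarrow>xs. indicator {a<..b} r *\<^sub>R c)"

definition step_integral ::
    "(real \<Rightarrow> 'w \<Rightarrow> real) \<Rightarrow> (real \<times> real \<times> 'h::real_normed_vector) list \<Rightarrow> 'w \<Rightarrow> 'h" where
  "step_integral b xs \<omega> = (\<Sum>(a, a', c)\<leftarrow>xs. (b a' \<omega> - b a \<omega>) *\<^sub>R c)"

definition is_wiener_integral ::
    "'w measure \<Rightarrow> (real \<Rightarrow> 'w \<Rightarrow> real) \<Rightarrow> real \<Rightarrow> (real \<Rightarrow> 'h::real_normed_vector) \<Rightarrow> ('w \<Rightarrow> 'h) \<Rightarrow> bool" where
  "is_wiener_integral M b t f X \<longleftrightarrow>
     X \<in> borel_measurable M \<and>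
     (\<exists>xs :: nat \<Rightarrow> (real \<times> real \<times> 'h) list.
        (\<forall>n. \<forall>(a, a', c)\<in>set (xs n). 0 \<le> a \<and> a \<le> a' \<and> a' \<le> t) \<and>
        (\<lambda>n. \<integral>\<^sup>+r\<in>{0..t}. ennreal ((norm (f r - step_fun (xs n) r))\<^sup>2) \<partial>lborel) \<longlonglongrightarrow> 0 \<and>
        (\<lambda>n. \<integral>\<^sup>+\<omega>. ennreal ((norm (X \<omega> - step_integral b (xs n) \<omega>))\<^sup>2) \<partial>M) \<longlonglongrightarrow> 0)"

text \<open>
  \<open>Z\<close> is the version with continuous paths in the space of exponent \<open>s\<close> (completion \<open>J\<close>)
  of the stochastic convolution
  \<open>\<integral>\<^sub>0\<^sup>t e\<^bsup>(t-r)A\<^esup> dW\<^sup>Q(r) = (\<Sum>k. \<integral>\<^sub>0\<^sup>t e\<^bsup>(t-r)A\<^esup> (\<surd>q\<^sub>k e\<^sub>k) d\<beta>\<^sub>k(r))\<close>,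
  the series converging in \<open>L\<^sup>2\<close> with values in the original Hilbert space.
\<close>

definition is_stochastic_convolution ::
    "(nat \<Rightarrow> real) \<Rightarrow> (nat \<Rightarrow> 'h::real_inner) \<Rightarrow> (nat \<Rightarrow> real) \<Rightarrow> 'w measure \<Rightarrow>
     (nat \<Rightarrow> real \<Rightarrow> 'w \<Rightarrow> real) \<Rightarrow> real \<Rightarrow> ('h \<Rightarrow> 'a::real_inner) \<Rightarrow>
     ('p \<Rightarrow> real \<Rightarrow> 'a) \<Rightarrow> ('w \<Rightarrow> 'p) \<Rightarrow> bool" where
  "is_stochastic_convolution lam e q M \<beta> T J path_at Z \<longleftrightarrow>
     (\<forall>t\<in>{0..T}.
        (\<lambda>\<omega>. path_at (Z \<omega>) t) \<in> borel_measurable M \<and>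
        (\<exists>I :: nat \<Rightarrow> 'w \<Rightarrow> 'h.
           (\<forall>k\<ge>1. is_wiener_integral M (\<beta> k) t
              (\<lambda>r. semigroup lam e id id (t - r) (sqrt (q k) *\<^sub>R e k)) (I k)) \<and>
           (\<lambda>n. \<integral>\<^sup>+\<omega>. ennreal ((norm (inclusion e J id (path_at (Z \<omega>) t) - (\<Sum>k=1..n. I k \<omega>)))\<^sup>2) \<partial>M)
             \<longlonglongrightarrow> 0))"


section \<open>Mild solutions\<close>

text \<open>
  The embeddings \<open>J0\<close>, \<open>J\<close>, \<open>Jp\<close>, \<open>Jm\<close> belong to the exponents \<open>s\<^sub>0\<close>, \<open>s\<close>, \<open>s\<^sub>F\<close>, \<open>-s\<^sub>F\<close>. A process with
  paths in the path space is a function from the sample space to that space.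
\<close>

definition drift_convolution ::
    "(nat \<Rightarrow> real) \<Rightarrow> (nat \<Rightarrow> 'h) \<Rightarrow> ('h \<Rightarrow> 'a::{real_inner,banach,second_countable_topology}) \<Rightarrow>
     ('h \<Rightarrow> 'f::real_inner) \<Rightarrow> ('h \<Rightarrow> 'm::real_inner) \<Rightarrow> ('f \<Rightarrow> 'm) \<Rightarrow> (real \<Rightarrow> 'a) \<Rightarrow> real \<Rightarrow> 'a" where
  "drift_convolution lam e J Jp Jm F y t =
     (LBINT r:{0..t}. semigroup lam e Jm J (t - r) (F (inclusion e J Jp (y r))))"

definition is_mild_solution ::
    "(nat \<Rightarrow> real) \<Rightarrow> (nat \<Rightarrow> 'h) \<Rightarrow> 'w measure \<Rightarrow> real \<Rightarrow>
     ('h \<Rightarrow> 'z::real_inner) \<Rightarrow> ('h \<Rightarrow> 'a::{real_inner,banach,second_countable_topology}) \<Rightarrow>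
     ('h \<Rightarrow> 'f::real_inner) \<Rightarrow> ('h \<Rightarrow> 'm::real_inner) \<Rightarrow>
     ('p \<Rightarrow> real \<Rightarrow> 'a) \<Rightarrow> ('f \<Rightarrow> 'm) \<Rightarrow> ('w \<Rightarrow> 'p) \<Rightarrow> 'z \<Rightarrow> ('w \<Rightarrow> 'p) \<Rightarrow> bool" where
  "is_mild_solution lam e M T J0 J Jp Jm path_at F Z u0 u \<longleftrightarrow>
     (\<forall>t\<in>{0..T}.
        (\<lambda>\<omega>. path_at (u \<omega>) t) \<in> borel_measurable M \<and>
        (AE \<omega> in M. path_at (u \<omega>) t =
           semigroup lam e J0 J t u0
           + drift_convolution lam e J Jp Jm F (path_at (u \<omega>)) t
           + path_at (Z \<omega>) t))"

definition is_galerkin_solution ::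
    "(nat \<Rightarrow> real) \<Rightarrow> (nat \<Rightarrow> 'h::real_vector) \<Rightarrow> 'w measure \<Rightarrow> real \<Rightarrow>
     ('h \<Rightarrow> 'z::real_inner) \<Rightarrow> ('h \<Rightarrow> 'a::{real_inner,banach,second_countable_topology}) \<Rightarrow>
     ('h \<Rightarrow> 'f::real_inner) \<Rightarrow> ('h \<Rightarrow> 'm::real_inner) \<Rightarrow>
     ('p \<Rightarrow> real \<Rightarrow> 'a) \<Rightarrow> ('f \<Rightarrow> 'm) \<Rightarrow> ('w \<Rightarrow> 'p) \<Rightarrow> 'z \<Rightarrow> nat \<Rightarrow> ('w \<Rightarrow> 'p) \<Rightarrow> bool" where
  "is_galerkin_solution lam e M T J0 J Jp Jm path_at F Z u0 N v \<longleftrightarrow>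
     (\<forall>t\<in>{0..T}.
        (\<lambda>\<omega>. path_at (v \<omega>) t) \<in> borel_measurable M \<and>
        (AE \<omega> in M. path_at (v \<omega>) t \<in> J ` galerkin_space e N \<and>
           path_at (v \<omega>) t =
             galerkin_proj e J N (semigroup lam e J0 J t u0)
             + galerkin_proj e J N (drift_convolution lam e J Jp Jm F (path_at (v \<omega>)) t)
             + galerkin_proj e J N (path_at (Z \<omega>) t)))"

end

theory Submission
  imports Defs
begin

text \<open>The weak error is of second order in the high modes of the noise, because their law is symmetric.
Pathwise, the mild equation is a deterministic Volterra
equation \<open>y(t) = w(t) + \<integral>\<^sub>0\<^sup>t e\<^bsup>(t-r)A\<^esup> F(y(r)) dr\<close> driven by \<open>w = e\<^bsup>tA\<^esup>u\<^sub>0 + Z\<close>, where \<open>Z\<close> is the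
stochastic convolution. Its solution map \<open>\<Theta>\<close> is defined on all continuous \<open>w\<close>, so
\<open>\<Phi>(u) = \<Psi>(Z)\<close> with \<open>\<Psi>(x) = \<Phi>(\<Theta>(e\<^bsup>tA\<^esup>u\<^sub>0 + x))\<close>. Split \<open>Z = P + X\<close> into its first \<open>N\<close> modes \<open>P\<close> and the high
modes \<open>X\<close>. Changing the sign of the Wiener processes \<open>\<beta>\<^sub>k\<close>, \<open>k > N\<close>, does not change their joint law,
hence \<open>E \<Psi>(P + X) = E \<Psi>(P - X)\<close> and
\<open>2 (E \<Psi>(Z) - E \<Psi>(P)) = E (\<Psi>(P + X) + \<Psi>(P - X) - 2 \<Psi>(P))\<close>. The right side is a second difference,
bounded by a multiple of \<open>E \<parallel>X\<parallel>\<^sup>2\<close>: the first order term has disappeared. Three facts carry this part.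

\<^item> Second differences (\<open>C2_bounded_derivs_estimates\<close>, \<open>solution_estimates\<close>, \<open>\<Psi>_second_diff\<close>). A function
  with two bounded derivatives has second differences of quadratic size; this property passes through
  the Volterra equation by Gronwall's inequality and through \<open>\<Phi>\<close>. Second differences avoid
  differentiating the solution map.
\<^item> Symmetry (\<open>path_law_symmetric\<close>, \<open>sign_flip_law\<close>, \<open>reflection\<close>). The law of a Wiener process is symmetric and
  the \<open>\<beta>\<^sub>k\<close> are independent. The symmetry is transported to \<open>Z\<close> by approximating \<open>Z\<close> by interpolation in
  time, truncation to finitely many modes, and Riemann sums for each Wiener integral.
\<^item> Size of the high modes (\<open>wiener_ou_sup\<close>, \<open>noise_tail\<close>). The \<open>k\<close>-th coefficient of \<open>Z\<close> is \<open>\<surd>q\<^sub>k\<close> times an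
  Ornstein-Uhlenbeck process of rate \<open>\<lambda>\<^sub>k\<close>. Summation by parts bounds the supremum of its square by
  \<open>\<lambda>\<^sub>k\<^bsup>-2\<alpha>\<^esup>\<close> times the squared \<open>\<alpha>\<close>-Hoelder constant of \<open>\<beta>\<^sub>k\<close>, for every \<open>\<alpha> < 1/2\<close>. With \<open>2\<alpha> = 1 - \<epsilon>/2\<close> the sum over
  \<open>k > N\<close> is controlled by the trace condition, which gives the third term of the estimate.

It remains to compare \<open>\<Psi>(P)\<close> with \<open>\<Phi>(u\<^sub>N)\<close>, which is a pathwise matter. Both solve Volterra equations; they
differ by the high modes of \<open>e\<^bsup>tA\<^esup>u\<^sub>0\<close> (first term of the estimate) and by the high modes of the drift,
which are small because \<open>e\<^bsup>rA\<^esup>\<close> is smoothing: on modes beyond \<open>N\<close> it is bounded from the space of exponent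
\<open>-s\<^sub>F\<close> to that of exponent \<open>s\<close> by \<open>\<lambda>\<^bsub>N+1\<^esub>\<^bsup>-(\<theta>-a)\<^esup> r\<^bsup>-\<theta>\<^esup>\<close>, \<open>a = (s + s\<^sub>F)/2\<close>, and \<open>\<theta> = 1 - \<epsilon>/2\<close> keeps the singularity
integrable (\<open>galerkin_conv_bound\<close>; second term).\<close>

section \<open>Orthogonal expansions and the scale of Hilbert spaces\<close>

text \<open>Every completion in the scale, with \<open>b k = J (e k)\<close> and \<open>w k = \<lambda>\<^sub>k\<^sup>r\<close>, is a Hilbert space with a total
orthogonal system, that is, a weighted sequence space. All operators of the problem are diagonal, so
only the coefficients matter.\<close>

locale orthogonal_system =
  fixes b :: "nat \<Rightarrow> 'a::{real_inner,banach}" and w :: "nat \<Rightarrow> real"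
  assumes orth: "\<And>i j. i \<ge> 1 \<Longrightarrow> j \<ge> 1 \<Longrightarrow> b i \<bullet> b j = (if i = j then w i else 0)"
    and wpos: "\<And>i. i \<ge> 1 \<Longrightarrow> 0 < w i"
    and total: "closure (span (b ` {1..})) = UNIV"
begin

definition coef :: "nat \<Rightarrow> 'a \<Rightarrow> real" where "coef k x = (x \<bullet> b k) / (b k \<bullet> b k)"

definition part :: "nat set \<Rightarrow> 'a \<Rightarrow> 'a" where "part F x = (\<Sum>k\<in>F. coef k x *\<^sub>R b k)"

lemma inner_b: "k \<ge> 1 \<Longrightarrow> x \<bullet> b k = w k * coef k x"
  using orth[of k k] wpos[of k] by (simp add: coef_def)

lemma coef_add: "coef k (x + y) = coef k x + coef k y"
  and coef_diff: "coef k (x - y) = coef k x - coef k y"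
  and coef_scale: "coef k (c *\<^sub>R x) = c * coef k x"
  and coef_zero: "coef k 0 = 0"
  by (simp_all add: coef_def inner_add_left inner_diff_left add_divide_distrib diff_divide_distrib)

lemma bounded_linear_coef: "bounded_linear (coef k)"
  unfolding coef_def by (rule bounded_linear_divide[THEN bounded_linear_compose, OF bounded_linear_inner_left])

lemma coef_sum_basis:
  assumes "finite F" "F \<subseteq> {1..}" "k \<ge> 1"
  shows "coef k (\<Sum>i\<in>F. c i *\<^sub>R b i) = (if k \<in> F then c k else 0)"
proof -
  have "(\<Sum>i\<in>F. c i *\<^sub>R b i) \<bullet> b k = (\<Sum>i\<in>F. if i = k then c k * w k else 0)"
    unfolding inner_sum_left
    by (rule sum.cong) (use assms orth in \<open>auto simp: subset_iff\<close>)
  also have "\<dots> = (if k \<in> F then c k * w k else 0)"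
    using assms by simp
  finally show ?thesis
    using wpos[OF assms(3)] orth[OF assms(3) assms(3)] by (simp add: coef_def)
qed

lemma norm_sum_basis:
  assumes "finite F" "F \<subseteq> {1..}"
  shows "(norm (\<Sum>i\<in>F. c i *\<^sub>R b i))\<^sup>2 = (\<Sum>i\<in>F. w i * (c i)\<^sup>2)"
proof -
  have "(norm (\<Sum>i\<in>F. c i *\<^sub>R b i))\<^sup>2 = (\<Sum>k\<in>F. c k * ((\<Sum>i\<in>F. c i *\<^sub>R b i) \<bullet> b k))"
    by (simp add: power2_norm_eq_inner inner_sum_right)
  also have "\<dots> = (\<Sum>k\<in>F. w k * (c k)\<^sup>2)"
    by (rule sum.cong) (use assms in \<open>auto simp: inner_b coef_sum_basis subset_iff power2_eq_square\<close>)
  finally show ?thesis .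
qed

lemma norm_diff_part:
  assumes "finite F" "F \<subseteq> {1..}"
  shows "(norm (x - part F x))\<^sup>2 = (norm x)\<^sup>2 - (\<Sum>k\<in>F. w k * (coef k x)\<^sup>2)"
proof -
  have "x \<bullet> part F x = (\<Sum>k\<in>F. w k * (coef k x)\<^sup>2)"
    unfolding part_def inner_sum_right
    by (rule sum.cong) (use assms in \<open>auto simp: inner_b subset_iff power2_eq_square\<close>)
  moreover have "part F x \<bullet> part F x = (\<Sum>k\<in>F. w k * (coef k x)\<^sup>2)"
    using norm_sum_basis[OF assms, of "\<lambda>k. coef k x"] by (simp add: part_def power2_norm_eq_inner)
  ultimately show ?thesis
    by (simp add: power2_norm_eq_inner inner_diff_left inner_diff_right inner_commute)
qed

lemma bessel: "finite F \<Longrightarrow> F \<subseteq> {1..} \<Longrightarrow> (\<Sum>k\<in>F. w k * (coef k x)\<^sup>2) \<le> (norm x)\<^sup>2"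
  using norm_diff_part[of F x] by (smt (verit) zero_le_power2)

lemma norm_part_le: "finite F \<Longrightarrow> F \<subseteq> {1..} \<Longrightarrow> norm (part F x) \<le> norm x"
  using bessel[of F x] norm_sum_basis[of F "\<lambda>k. coef k x"]
  by (simp add: part_def power2_le_imp_le)

lemma part_diff: "part F (x - y) = part F x - part F y"
  by (simp add: part_def coef_diff scaleR_diff_left sum_subtractf)

text \<open>Enlarging the index set improves the approximation. This monotonicity over all finite sets, not only
initial segments, is what makes the expansion converge unconditionally.\<close>

lemma norm_diff_part_mono:
  assumes "finite G" "G \<subseteq> {1..}" "F \<subseteq> G"
  shows "norm (x - part G x) \<le> norm (x - part F x)"
proof (rule power2_le_imp_le)
  have "(\<Sum>k\<in>F. w k * (coef k x)\<^sup>2) \<le> (\<Sum>k\<in>G. w k * (coef k x)\<^sup>2)"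
    using assms wpos by (intro sum_mono2) (auto simp: subset_iff less_imp_le)
  then show "(norm (x - part G x))\<^sup>2 \<le> (norm (x - part F x))\<^sup>2"
    using assms finite_subset[of F G] by (subst (1 2) norm_diff_part) auto
qed simp

lemma span_part: 
  assumes "y \<in> span (b ` {1..})" shows "\<exists>n. part {1..n} y = y"
  using assms
proof (induction rule: span_induct_alt)
  case base
  then show ?case by (simp add: part_def coef_zero)
next
  case (step c x y)
  then obtain j where j: "j \<ge> 1" "x = b j" by auto
  obtain n where n: "part {1..n} y = y" using step by blast
  define N where "N = max n j"
  have y: "part {1..N} y = y"
  proof -
    have "norm (y - part {1..N} y) \<le> norm (y - part {1..n} y)"
      by (rule norm_diff_part_mono) (auto simp: N_def)
    then show ?thesis using n by simp
  qed
  have "part {1..N} x = (\<Sum>k\<in>{1..N}. if k = j then x else 0)"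
    unfolding part_def
  proof (rule sum.cong)
    fix k assume "k \<in> {1..N}"
    then show "coef k x *\<^sub>R b k = (if k = j then x else 0)"
      using j coef_sum_basis[of "{j}" k "\<lambda>_. 1"] by auto
  qed simp
  also have "\<dots> = x" using j by (simp add: N_def)
  finally have "part {1..N} (c *\<^sub>R x + y) = c *\<^sub>R x + y"
    using y by (simp add: part_def coef_add coef_scale scaleR_add_left sum.distrib
        scaleR_scaleR[symmetric] scaleR_sum_right[symmetric] del: scaleR_scaleR)
  then show ?case by blast
qed

lemma part_approx:
  assumes "0 < (\<epsilon>::real)"
  shows "\<exists>n. \<forall>F. finite F \<longrightarrow> {1..n} \<subseteq> F \<longrightarrow> F \<subseteq> {1..} \<longrightarrow> norm (x - part F x) < \<epsilon>"
proof -
  have "x \<in> closure (span (b ` {1..}))" unfolding total by simp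
  then obtain y where y: "y \<in> span (b ` {1..})" "dist y x < \<epsilon>"
    using assms closure_approachable by blast
  obtain n where n: "part {1..n} y = y" using span_part[OF y(1)] by blast
  have fin: "finite {1..n}" "{1..n} \<subseteq> {1..}" by auto
  have 1: "norm (x - part {1..n} x) \<le> norm (x - y)"
  proof (rule power2_le_imp_le)
    have "part {1..n} (x - y) = part {1..n} x - y"
      using n by (simp add: part_diff)
    then have eq: "x - part {1..n} x = (x - y) - part {1..n} (x - y)" by simp
    have "0 \<le> (\<Sum>k\<in>{1..n}. w k * (coef k (x - y))\<^sup>2)"
      using wpos by (intro sum_nonneg) (auto simp: less_imp_le)
    then show "(norm (x - part {1..n} x))\<^sup>2 \<le> (norm (x - y))\<^sup>2"
      unfolding eq norm_diff_part[OF fin, of "x - y"] by linarith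
  qed simp
  show ?thesis
  proof (intro exI allI impI)
    fix F assume "finite F" "{1..n} \<subseteq> F" "F \<subseteq> {1..}"
    then have "norm (x - part F x) \<le> norm (x - part {1..n} x)"
      by (intro norm_diff_part_mono)
    with 1 y(2) show "norm (x - part F x) < \<epsilon>"
      by (simp add: dist_norm norm_minus_commute)
  qed
qed

lemma has_sum_expansion: "((\<lambda>k. coef k x *\<^sub>R b k) has_sum x) {1..}"
  unfolding has_sum_def tendsto_iff eventually_finite_subsets_at_top
proof (intro allI impI)
  fix \<epsilon> :: real assume "0 < \<epsilon>"
  then obtain n where n: "\<And>F. finite F \<Longrightarrow> {1..n} \<subseteq> F \<Longrightarrow> F \<subseteq> {1..} \<Longrightarrow> norm (x - part F x) < \<epsilon>"
    using part_approx by blast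
  show "\<exists>X. finite X \<and> X \<subseteq> {1..} \<and>
      (\<forall>Y. finite Y \<and> X \<subseteq> Y \<and> Y \<subseteq> {1..} \<longrightarrow> dist (\<Sum>k\<in>Y. coef k x *\<^sub>R b k) x < \<epsilon>)"
    by (rule exI[of _ "{1..n}"]) (use n in \<open>auto simp: dist_norm norm_minus_commute part_def\<close>)
qed

lemma expansion_tendsto: "(\<lambda>n. part {1..n} x) \<longlonglongrightarrow> x"
proof (rule LIMSEQ_I)
  fix r :: real assume "0 < r"
  then obtain n where n: "\<And>F. finite F \<Longrightarrow> {1..n} \<subseteq> F \<Longrightarrow> F \<subseteq> {1..} \<Longrightarrow> norm (x - part F x) < r"
    using part_approx by blast
  show "\<exists>no. \<forall>n\<ge>no. norm (part {1..n} x - x) < r"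
    by (rule exI[of _ n]) (use n in \<open>auto simp: norm_minus_commute\<close>)
qed

lemma coef_eqI:
  assumes "\<And>k. k \<ge> 1 \<Longrightarrow> coef k x = coef k y" shows "x = y"
proof -
  have "part {1..n} x = part {1..n} y" for n
    unfolding part_def by (rule sum.cong) (use assms in auto)
  then show ?thesis
    using expansion_tendsto[of x] expansion_tendsto[of y] LIMSEQ_unique by auto
qed

lemma norm_le_coefI:
  assumes "\<And>n. (\<Sum>k\<in>{1..n}. w k * (coef k x)\<^sup>2) \<le> R"
  shows "(norm x)\<^sup>2 \<le> R"
proof (rule LIMSEQ_le_const2)
  show "(\<lambda>n. (norm (part {1..n} x))\<^sup>2) \<longlonglongrightarrow> (norm x)\<^sup>2"
    by (intro tendsto_intros expansion_tendsto)
  have "(norm (part {1..n} x))\<^sup>2 = (\<Sum>k\<in>{1..n}. w k * (coef k x)\<^sup>2)" for n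
    unfolding part_def by (rule norm_sum_basis) auto
  then show "\<exists>N. \<forall>n\<ge>N. (norm (part {1..n} x))\<^sup>2 \<le> R" using assms by simp
qed

lemma parseval: "((\<lambda>k. w k * (coef k x)\<^sup>2) has_sum (norm x)\<^sup>2) {1..}"
proof -
  have "((\<lambda>k. (coef k x *\<^sub>R b k) \<bullet> x) has_sum (x \<bullet> x)) {1..}"
    by (rule has_sum_bounded_linear[OF bounded_linear_inner_left has_sum_expansion])
  also have "?this \<longleftrightarrow> ?thesis"
    unfolding power2_norm_eq_inner
    by (rule has_sum_cong) (use inner_b[of _ x] in \<open>auto simp: power2_eq_square inner_commute\<close>)
  finally show ?thesis .
qed

text \<open>Riesz and Fischer: partial sums of a square summable sequence are Cauchy, since the squared distance
of two of them is a difference of partial sums of the weighted squares.\<close>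

lemma exists_coef:
  assumes "\<And>n. (\<Sum>k\<in>{1..n}. w k * (c k)\<^sup>2) \<le> R"
  shows "\<exists>y. \<forall>k\<ge>1. coef k y = c k"
proof -
  define S where "S n = (\<Sum>k\<in>{1..n}. c k *\<^sub>R b k)" for n
  define t where "t n = (\<Sum>k\<in>{1..n}. w k * (c k)\<^sup>2)" for n
  have mono: "incseq t"
    unfolding t_def by (intro monoI sum_mono2) (use wpos in \<open>auto simp: less_imp_le\<close>)
  have "convergent t"
    by (rule incseq_convergent[OF mono, of R]) (use assms in \<open>auto simp: t_def convergent_def\<close>)
  then have Ct: "Cauchy t" by (rule convergent_Cauchy)
  have dS: "(norm (S n - S m))\<^sup>2 = t n - t m" if "m \<le> n" for m n
  proof -
    have "S n - S m = (\<Sum>k\<in>{1..n} - {1..m}. c k *\<^sub>R b k)"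
      unfolding S_def using that by (subst sum_diff) auto
    then have "(norm (S n - S m))\<^sup>2 = (\<Sum>k\<in>{1..n} - {1..m}. w k * (c k)\<^sup>2)"
      by (simp add: norm_sum_basis subset_iff)
    also have "\<dots> = t n - t m" unfolding t_def using that by (subst sum_diff) auto
    finally show ?thesis .
  qed
  have "Cauchy S"
  proof (rule metric_CauchyI)
    fix \<epsilon> :: real assume "0 < \<epsilon>"
    then obtain N where N: "\<And>m n. m \<ge> N \<Longrightarrow> n \<ge> N \<Longrightarrow> dist (t m) (t n) < \<epsilon>\<^sup>2"
      using Ct unfolding Cauchy_def by (metis zero_less_power)
    have *: "norm (S n - S m) < \<epsilon>" if "m \<ge> N" "m \<le> n" for m n
    proof (rule power2_less_imp_less)
      show "(norm (S n - S m))\<^sup>2 < \<epsilon>\<^sup>2"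
        using dS[OF that(2)] N[of n m] that by (simp add: dist_real_def)
    qed (use \<open>0 < \<epsilon>\<close> in simp)
    show "\<exists>M. \<forall>m\<ge>M. \<forall>n\<ge>M. dist (S m) (S n) < \<epsilon>"
    proof (intro exI allI impI)
      fix m n assume "m \<ge> N" "n \<ge> N"
      then show "dist (S m) (S n) < \<epsilon>"
        using *[of m n] *[of n m] by (cases "m \<le> n") (auto simp: dist_norm norm_minus_commute)
    qed
  qed
  then obtain y where y: "S \<longlonglongrightarrow> y" using Cauchy_convergent convergent_def by blast
  have "coef k y = c k" if "k \<ge> 1" for k
  proof -
    have "(\<lambda>n. coef k (S n)) \<longlonglongrightarrow> coef k y"
      by (rule bounded_linear.tendsto[OF bounded_linear_coef y])
    moreover have "eventually (\<lambda>n. coef k (S n) = c k) sequentially"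
      using eventually_ge_at_top[of k]
      by eventually_elim (use that in \<open>auto simp: S_def coef_sum_basis subset_iff\<close>)
    then have "(\<lambda>n. coef k (S n)) \<longlonglongrightarrow> c k" by (rule tendsto_eventually)
    ultimately show ?thesis using LIMSEQ_unique by blast
  qed
  then show ?thesis by blast
qed

lemma infsum_expansion:
  assumes "\<And>n. (\<Sum>k\<in>{1..n}. w k * (c k)\<^sup>2) \<le> R" "k \<ge> 1"
  shows "coef k (\<Sum>\<^sub>\<infinity>k\<in>{1..}. c k *\<^sub>R b k) = c k"
proof -
  obtain y where y: "\<And>k. k \<ge> 1 \<Longrightarrow> coef k y = c k"
    using exists_coef[OF assms(1)] by blast
  have "(\<Sum>\<^sub>\<infinity>k\<in>{1..}. c k *\<^sub>R b k) = (\<Sum>\<^sub>\<infinity>k\<in>{1..}. coef k y *\<^sub>R b k)"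
    by (rule infsum_cong) (use y in auto)
  also have "\<dots> = y" by (rule infsumI[OF has_sum_expansion])
  finally show ?thesis using y assms by simp
qed

end

locale spectral =
  fixes lam :: "nat \<Rightarrow> real" and e :: "nat \<Rightarrow> 'h::real_inner"
  assumes onb: "orthonormal_basis e"
    and lam_pos: "\<And>k. k \<ge> 1 \<Longrightarrow> 0 < lam k"
    and lam_mono: "\<And>j k. 1 \<le> j \<Longrightarrow> j \<le> k \<Longrightarrow> lam j \<le> lam k"

locale scale = spectral lam e for lam e +
  fixes r :: real and J :: "'h::real_inner \<Rightarrow> 'a::{real_inner,banach}"
  assumes J: "is_scale_space lam e r J"
begin

lemma J_add: "x \<in> span (e ` {1..}) \<Longrightarrow> y \<in> span (e ` {1..}) \<Longrightarrow> J (x + y) = J x + J y"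
  and J_scale: "x \<in> span (e ` {1..}) \<Longrightarrow> J (c *\<^sub>R x) = c *\<^sub>R J x"
  and J_norm: "x \<in> span (e ` {1..}) \<Longrightarrow> (norm (J x))\<^sup>2 = (\<Sum>\<^sub>\<infinity>k\<in>{1..}. lam k powr r * (x \<bullet> e k)\<^sup>2)"
  and J_dense: "closure (J ` span (e ` {1..})) = UNIV"
  using J by (auto simp: is_scale_space_def)

lemma e_orth: "i \<ge> 1 \<Longrightarrow> j \<ge> 1 \<Longrightarrow> e i \<bullet> e j = (if i = j then 1 else 0)"
  using onb by (simp add: orthonormal_basis_def)

lemma e_span: "k \<ge> 1 \<Longrightarrow> e k \<in> span (e ` {1..})"
  by (auto intro: span_base)

lemma norm_J_e: assumes k: "k \<ge> 1" shows "J (e k) \<bullet> J (e k) = lam k powr r"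
proof -
  have "(norm (J (e k)))\<^sup>2 = (\<Sum>\<^sub>\<infinity>j\<in>{k}. lam j powr r * (e k \<bullet> e j)\<^sup>2)"
    unfolding J_norm[OF e_span[OF k]]
    by (rule infsum_cong_neutral) (use k e_orth in auto)
  then show ?thesis using k by (simp add: e_orth power2_norm_eq_inner)
qed

lemma J_zero: "J 0 = 0"
  using J_scale[of 0 0] by (simp add: span_zero)

lemma pairing_J: "x \<in> span (e ` {1..}) \<Longrightarrow> k \<ge> 1 \<Longrightarrow> pairing e J k (J x) = x \<bullet> e k"
  using pairing_extends_inner[OF onb _ J] lam_pos by auto

sublocale orthogonal_system "\<lambda>k. J (e k)" "\<lambda>k. lam k powr r"
  rewrites "orthogonal_system.coef (\<lambda>k. J (e k)) = pairing e J"
proof -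
  show *: "orthogonal_system (\<lambda>k. J (e k)) (\<lambda>k. lam k powr r)"
  proof
    fix i j :: nat assume ij: "i \<ge> 1" "j \<ge> 1"
    have "J (e i) \<bullet> J (e j) = pairing e J j (J (e i)) * (J (e j) \<bullet> J (e j))"
      using norm_J_e[OF ij(2)] lam_pos[OF ij(2)] by (simp add: pairing_def)
    then show "J (e i) \<bullet> J (e j) = (if i = j then lam i powr r else 0)"
      using pairing_J[OF e_span[OF ij(1)] ij(2)] norm_J_e[OF ij(2)] e_orth[OF ij] by simp
  next
    fix i :: nat assume "i \<ge> 1" then show "0 < lam i powr r" using lam_pos[of i] by simp
  next
    have "J x \<in> span ((\<lambda>k. J (e k)) ` {1..}) \<and> x \<in> span (e ` {1..})" if "x \<in> span (e ` {1..})" for x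
      using that
    proof (induction rule: span_induct_alt)
      case base
      then show ?case by (simp add: J_zero span_zero)
    next
      case (step c x y)
      then obtain j where j: "j \<ge> 1" "x = e j" by auto
      then have "J (c *\<^sub>R x + y) = c *\<^sub>R J (e j) + J y"
        using step e_span[OF j(1)] by (simp add: J_add J_scale span_scale)
      moreover have "J (e j) \<in> span ((\<lambda>k. J (e k)) ` {1..})"
        using j by (intro span_base) auto
      ultimately show ?case
        using step j e_span[OF j(1)] by (simp add: span_add span_scale)
    qed
    then have "J ` span (e ` {1..}) \<subseteq> span ((\<lambda>k. J (e k)) ` {1..})" by auto
    then have "UNIV \<subseteq> closure (span ((\<lambda>k. J (e k)) ` {1..}))"
      using J_dense closure_mono by metis
    then show "closure (span ((\<lambda>k. J (e k)) ` {1..})) = UNIV" by blast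
  qed
  show "orthogonal_system.coef (\<lambda>k. J (e k)) = pairing e J"
    by (intro ext) (simp add: orthogonal_system.coef_def[OF *] pairing_def)
qed

lemma galerkin_proj_part: "galerkin_proj e J N x = part {1..N} x"
  by (simp add: galerkin_proj_def part_def)

lemma pairing_galerkin: "k \<ge> 1 \<Longrightarrow> pairing e J k (galerkin_proj e J N x) = (if k \<le> N then pairing e J k x else 0)"
  unfolding galerkin_proj_def by (subst coef_sum_basis) auto

lemma norm_galerkin_le: "norm (galerkin_proj e J N x) \<le> norm x"
  unfolding galerkin_proj_part by (rule norm_part_le) auto

lemma bounded_linear_galerkin: "bounded_linear (galerkin_proj e J N)"
proof (rule bounded_linear_intro[where K = 1])
  show "norm (galerkin_proj e J N x) \<le> norm x * 1" for x
    using norm_galerkin_le by simp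
qed (auto simp: galerkin_proj_def coef_add coef_scale scaleR_add_left sum.distrib scaleR_sum_right)

end

text \<open>A diagonal operator between two spaces of the scale is bounded as soon as its multipliers, corrected by
the change of weight, are. The semigroup, the inclusions and the projections are all instances.\<close>

lemma
  assumes J: "scale lam e r J" and K: "scale lam e r' K" and C: "0 \<le> C"
    and m: "\<And>k. k \<ge> 1 \<Longrightarrow> \<bar>m k\<bar> * lam k powr ((r' - r) / 2) \<le> C"
  shows pairing_diagonal_map: "\<And>k. k \<ge> 1 \<Longrightarrow> pairing e K k (diagonal_map e J K m x) = m k * pairing e J k x"
    and norm_diagonal_map: "norm (diagonal_map e J K m x) \<le> C * norm x"
    and bounded_linear_diagonal_map: "bounded_linear (diagonal_map e J K m)"
proof -
  interpret J: scale lam e r J by fact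
  interpret K: scale lam e r' K by fact
  have le: "lam k powr r' * (m k * pairing e J k x)\<^sup>2 \<le> C\<^sup>2 * (lam k powr r * (pairing e J k x)\<^sup>2)"
    if "k \<ge> 1" for k x
  proof -
    have p: "lam k powr r' = (lam k powr ((r' - r) / 2))\<^sup>2 * lam k powr r"
      by (simp add: power2_eq_square powr_add[symmetric])
    have "(\<bar>m k\<bar> * lam k powr ((r' - r) / 2))\<^sup>2 \<le> C\<^sup>2"
      using m[OF that] by (intro power_mono) auto
    then have "(\<bar>m k\<bar> * lam k powr ((r' - r) / 2))\<^sup>2 * (lam k powr r * (pairing e J k x)\<^sup>2)
        \<le> C\<^sup>2 * (lam k powr r * (pairing e J k x)\<^sup>2)"
      by (intro mult_right_mono) auto
    then show ?thesis unfolding p by (simp add: power_mult_distrib algebra_simps)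
  qed
  have R: "(\<Sum>k\<in>{1..n}. lam k powr r' * (m k * pairing e J k x)\<^sup>2) \<le> C\<^sup>2 * (norm x)\<^sup>2" for n x
  proof -
    have "(\<Sum>k\<in>{1..n}. lam k powr r' * (m k * pairing e J k x)\<^sup>2)
        \<le> (\<Sum>k\<in>{1..n}. C\<^sup>2 * (lam k powr r * (pairing e J k x)\<^sup>2))"
      by (rule sum_mono) (use le in auto)
    also have "\<dots> \<le> C\<^sup>2 * (norm x)\<^sup>2"
      unfolding sum_distrib_left[symmetric] by (intro mult_left_mono J.bessel) auto
    finally show ?thesis .
  qed
  show *: "pairing e K k (diagonal_map e J K m x) = m k * pairing e J k x" if "k \<ge> 1" for k x
    unfolding diagonal_map_def by (rule K.infsum_expansion[OF R that])
  show n: "norm (diagonal_map e J K m x) \<le> C * norm x" for x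
  proof (rule power2_le_imp_le)
    have "(norm (diagonal_map e J K m x))\<^sup>2 \<le> C\<^sup>2 * (norm x)\<^sup>2"
    proof (rule K.norm_le_coefI)
      show "(\<Sum>k\<in>{1..n}. lam k powr r' * (pairing e K k (diagonal_map e J K m x))\<^sup>2) \<le> C\<^sup>2 * (norm x)\<^sup>2" for n
        using R[where x=x and n=n] by (simp add: *)
    qed
    then show "(norm (diagonal_map e J K m x))\<^sup>2 \<le> (C * norm x)\<^sup>2" by (simp add: power_mult_distrib)
  qed (use C in auto)
  show "bounded_linear (diagonal_map e J K m)"
  proof (rule bounded_linear_intro[where K = C])
    show "diagonal_map e J K m (x + y) = diagonal_map e J K m x + diagonal_map e J K m y" for x y
      by (rule K.coef_eqI) (simp add: * K.coef_add J.coef_add algebra_simps)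
    show "diagonal_map e J K m (c *\<^sub>R x) = c *\<^sub>R diagonal_map e J K m x" for c x
      by (rule K.coef_eqI) (simp add: * K.coef_scale J.coef_scale algebra_simps)
    show "norm (diagonal_map e J K m x) \<le> norm x * C" for x
      using n[of x] by (simp add: mult.commute)
  qed
qed

lemma scale_id:
  fixes e :: "nat \<Rightarrow> 'h::{real_inner,banach}"
  assumes "spectral lam e" shows "scale lam e 0 (id :: 'h \<Rightarrow> 'h)"
proof -
  interpret spectral lam e by fact
  have o: "e i \<bullet> e j = (if i = j then 1 else 0)" if "i \<ge> 1" "j \<ge> 1" for i j
    using onb that by (simp add: orthonormal_basis_def)
  interpret E: orthogonal_system e "\<lambda>_. 1"
    by unfold_locales (use onb o in \<open>auto simp: orthonormal_basis_def\<close>)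
  have c: "E.coef k x = x \<bullet> e k" if "k \<ge> 1" for k x using o[OF that that] by (simp add: E.coef_def)
  show ?thesis
  proof
    have "(norm x)\<^sup>2 = (\<Sum>\<^sub>\<infinity>k\<in>{1..}. lam k powr 0 * (x \<bullet> e k)\<^sup>2)" for x
    proof -
      have "(norm x)\<^sup>2 = (\<Sum>\<^sub>\<infinity>k\<in>{1..}. 1 * (E.coef k x)\<^sup>2)"
        by (rule infsumI[OF E.parseval, symmetric])
      also have "\<dots> = (\<Sum>\<^sub>\<infinity>k\<in>{1..}. lam k powr 0 * (x \<bullet> e k)\<^sup>2)"
        by (rule infsum_cong) (use c lam_pos in \<open>auto simp: less_imp_neq[symmetric] dest!: lam_pos\<close>)
      finally show ?thesis .
    qed
    then show "is_scale_space lam e 0 (id :: 'h \<Rightarrow> 'h)"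
      using onb by (auto simp: is_scale_space_def orthonormal_basis_def)
  qed
qed

text \<open>The smoothing of the semigroup: \<open>l\<^sup>\<theta> e\<^bsup>-tl\<^esup> \<le> t\<^bsup>-\<theta>\<^esup>\<close> uniformly in \<open>l\<close>. For \<open>\<theta> \<le> 1\<close> no constant is needed, because
\<open>x\<^sup>\<theta> \<le> 1 + x \<le> e\<^sup>x\<close>.\<close>

lemma powr_le_exp: assumes "0 \<le> (\<theta>::real)" "\<theta> \<le> 1" "0 < x" shows "x powr \<theta> * exp (- x) \<le> 1"
proof -
  have "x powr \<theta> \<le> 1 + x"
  proof (cases "x \<le> 1")
    case True
    then have "x powr \<theta> \<le> 1" using assms powr_mono2[of \<theta> x 1] by simp
    then show ?thesis using assms by simp
  next
    case False
    then have "x powr \<theta> \<le> x powr 1" using assms by (intro powr_mono) auto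
    then show ?thesis using assms by simp
  qed
  also have "\<dots> \<le> exp x" by (rule exp_ge_add_one_self)
  finally show ?thesis by (simp add: exp_minus field_simps)
qed

lemma powr_exp_le: assumes "0 \<le> (\<theta>::real)" "\<theta> \<le> 1" "0 < l" "0 < t"
  shows "exp (- t * l) * l powr \<theta> \<le> t powr (- \<theta>)"
  using powr_le_exp[OF assms(1,2), of "t * l"] assms
  by (simp add: powr_mult powr_minus field_simps)

section \<open>Second differences of functions of class C2\<close>

lemma taylor_remainder:
  fixes f :: "'a::real_normed_vector \<Rightarrow> 'b::real_normed_vector"
  assumes f': "\<And>x. (f has_derivative blinfun_apply (f' x)) (at x)"
    and lip: "\<And>x y. norm (f' x - f' y) \<le> K * norm (x - y)" and K: "0 \<le> K"
  shows "norm (f a - f c - f' c (a - c)) \<le> K * (norm (a - c))\<^sup>2"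
proof -
  define g where "g x = f x - f' c x" for x
  have "norm (g (c + (a - c)) - g c) \<le> norm (a - c) * (K * norm (a - c))"
  proof (rule differentiable_bound_segment[where G = "closed_segment c a" and f' = "\<lambda>x h. f' x h - f' c h"])
    show "c + t *\<^sub>R (a - c) \<in> closed_segment c a" if "t \<in> {0..1}" for t
      using that by (auto simp: in_segment algebra_simps intro!: exI[of _ t])
    show "(g has_derivative (\<lambda>h. f' x h - f' c h)) (at x within closed_segment c a)" for x
      unfolding g_def
      by (intro derivative_intros has_derivative_at_withinI[OF f'] blinfun.bounded_linear_right[THEN bounded_linear_imp_has_derivative])
    fix t :: real assume t: "t \<in> {0..1}"
    let ?x = "c + t *\<^sub>R (a - c)"
    have "(\<lambda>h. f' ?x h - f' c h) = blinfun_apply (f' ?x - f' c)"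
      by (simp add: fun_eq_iff blinfun.diff_left)
    then have "onorm (\<lambda>h. f' ?x h - f' c h) = norm (f' ?x - f' c)"
      by (simp add: norm_blinfun.rep_eq)
    also have "\<dots> \<le> K * norm (t *\<^sub>R (a - c))" using lip[of ?x c] by simp
    also have "\<dots> \<le> K * norm (a - c)"
      using t K by (intro mult_left_mono) (auto intro: mult_left_le_one_le)
    finally show "onorm (\<lambda>h. f' ?x h - f' c h) \<le> K * norm (a - c)" .
  qed
  then show ?thesis by (simp add: g_def blinfun.diff_right power2_eq_square algebra_simps)
qed

text \<open>Bounds on derivatives become bounds on differences. The second difference is written
for three arbitrary points, so that it can be iterated: composing two such estimates gives another one.\<close>

lemma C2_bounded_derivs_estimates:
  fixes f :: "'a::real_normed_vector \<Rightarrow> 'b::real_normed_vector"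
  assumes "C2_bounded_derivs f"
  obtains L where "L > 0"
    "\<And>x y. norm (f x - f y) \<le> L * norm (x - y)"
    "\<And>a b c. norm (f a + f b - 2 *\<^sub>R f c) \<le> L * (norm (a + b - 2 *\<^sub>R c) + (norm (a - c))\<^sup>2 + (norm (b - c))\<^sup>2)"
proof -
  obtain f' :: "'a \<Rightarrow> 'a \<Rightarrow>\<^sub>L 'b" and f'' :: "'a \<Rightarrow> 'a \<Rightarrow>\<^sub>L 'a \<Rightarrow>\<^sub>L 'b" where
    f': "\<And>x. (f has_derivative blinfun_apply (f' x)) (at x)" and
    f'': "\<And>x. (f' has_derivative blinfun_apply (f'' x)) (at x)" and
    bd: "bounded (range f')" "bounded (range f'')"
    using assms unfolding C2_bounded_derivs_def by blast
  obtain B1 where B1: "0 < B1" "\<And>x. norm (f' x) \<le> B1"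
    using bd(1) unfolding bounded_pos by auto
  obtain B2 where B2: "0 < B2" "\<And>x. norm (f'' x) \<le> B2"
    using bd(2) unfolding bounded_pos by auto
  have lip: "norm (f x - f y) \<le> B1 * norm (x - y)" for x y
    by (rule differentiable_bound[where S = UNIV and f' = "\<lambda>x. blinfun_apply (f' x)"])
       (use f' B1 in \<open>auto simp: norm_blinfun.rep_eq[symmetric]\<close>)
  have lip': "norm (f' x - f' y) \<le> B2 * norm (x - y)" for x y
    by (rule differentiable_bound[where S = UNIV and f' = "\<lambda>x. blinfun_apply (f'' x)"])
       (use f'' B2 in \<open>auto simp: norm_blinfun.rep_eq[symmetric]\<close>)
  define L where "L = max B1 B2"
  have L: "B1 \<le> L" "B2 \<le> L" "0 < L" using B1 by (auto simp: L_def)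
  show ?thesis
  proof
    show "L > 0" by (rule L)
    show "norm (f x - f y) \<le> L * norm (x - y)" for x y
      using lip[of x y] mult_right_mono[OF L(1), of "norm (x - y)"] by simp
    fix a b c
    let ?ra = "f a - f c - f' c (a - c)" and ?rb = "f b - f c - f' c (b - c)"
    have eq: "f a + f b - 2 *\<^sub>R f c = f' c (a + b - 2 *\<^sub>R c) + ?ra + ?rb"
      by (simp add: blinfun.diff_right blinfun.add_right blinfun.scaleR_right scaleR_2)
    have "norm (f a + f b - 2 *\<^sub>R f c) \<le> norm (f' c (a + b - 2 *\<^sub>R c)) + norm ?ra + norm ?rb"
      unfolding eq using norm_triangle_ineq[of "f' c (a + b - 2 *\<^sub>R c) + ?ra" ?rb]
        norm_triangle_ineq[of "f' c (a + b - 2 *\<^sub>R c)" ?ra] by linarith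
    also have "norm (f' c (a + b - 2 *\<^sub>R c)) \<le> L * norm (a + b - 2 *\<^sub>R c)"
      using norm_blinfun[of "f' c" "a + b - 2 *\<^sub>R c"] B1(2)[of c] L(1)
      by (meson order_trans mult_right_mono norm_ge_zero)
    also have "norm ?ra \<le> L * (norm (a - c))\<^sup>2"
      using taylor_remainder[OF f' lip', of a c] B2(1) mult_right_mono[OF L(2), of "(norm (a - c))\<^sup>2"] by simp
    also have "norm ?rb \<le> L * (norm (b - c))\<^sup>2"
      using taylor_remainder[OF f' lip', of b c] B2(1) mult_right_mono[OF L(2), of "(norm (b - c))\<^sup>2"] by simp
    finally show "norm (f a + f b - 2 *\<^sub>R f c) \<le> L * (norm (a + b - 2 *\<^sub>R c) + (norm (a - c))\<^sup>2 + (norm (b - c))\<^sup>2)"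
      by (simp add: algebra_simps)
  qed
qed

section \<open>Volterra equations with a weakly singular kernel\<close>

lemma
  fixes \<theta> c :: real
  assumes "\<theta> < 1" "0 \<le> c"
  shows powr_minus_integrable: "set_integrable lborel {0..c} (\<lambda>r. r powr (- \<theta>))"
    and powr_minus_integral: "(LBINT r:{0..c}. r powr (- \<theta>)) = c powr (1 - \<theta>) / (1 - \<theta>)"
proof -
  have hi: "((\<lambda>r. r powr (- \<theta>)) has_integral (c powr (- \<theta> + 1) / (- \<theta> + 1))) {0..c}"
    using assms by (intro has_integral_powr_from_0) auto
  have "(\<lambda>r. r powr (- \<theta>)) absolutely_integrable_on {0..c}"
    using hi by (intro nonnegative_absolutely_integrable_1) auto
  then have li: "set_integrable lebesgue {0..c} (\<lambda>r. r powr (- \<theta>))" .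
  have m: "(\<lambda>r. indicator {0..c} r *\<^sub>R r powr (- \<theta>)) \<in> borel_measurable lborel"
    by measurable
  show "set_integrable lborel {0..c} (\<lambda>r. r powr (- \<theta>))"
    using li m unfolding set_integrable_def by (simp add: integrable_completion)
  have "(LBINT r:{0..c}. r powr (- \<theta>)) = (LINT r:{0..c}|lebesgue. r powr (- \<theta>))"
    unfolding set_lebesgue_integral_def by (rule integral_completion[symmetric, OF m])
  also have "\<dots> = integral {0..c} (\<lambda>r. r powr (- \<theta>))"
    using li by (rule set_lebesgue_integral_eq_integral)
  also have "\<dots> = c powr (1 - \<theta>) / (1 - \<theta>)"
    using hi by (simp add: integral_unique add.commute)
  finally show "(LBINT r:{0..c}. r powr (- \<theta>)) = c powr (1 - \<theta>) / (1 - \<theta>)" .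
qed

text \<open>The kernel stands for \<open>S r = e\<^bsup>rA\<^esup>\<close>, which maps into a smoother space with an integrable singularity at
\<open>r = 0\<close>. All conditions concern \<open>r > 0\<close>, since \<open>S 0\<close>, the identity, does not map into the smoother
space.\<close>

locale singular_kernel =
  fixes S :: "real \<Rightarrow> 'm::real_normed_vector \<Rightarrow> 'a::{banach, second_countable_topology}"
    and T a :: real
  assumes T: "0 < T" and a: "0 \<le> a" "a < 1"
    and S_linear: "\<And>r. 0 < r \<Longrightarrow> bounded_linear (S r)"
    and S_bound: "\<And>r x. 0 < r \<Longrightarrow> norm (S r x) \<le> r powr (- a) * norm x"
    and S_measurable: "\<And>f. continuous_on UNIV f \<Longrightarrow>
          (\<lambda>r. indicator {0<..} r *\<^sub>R S r (f r)) \<in> borel_measurable borel"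
begin

definition conv :: "(real \<Rightarrow> 'm) \<Rightarrow> real \<Rightarrow> 'a" where
  "conv f t = (LBINT r:{0..t}. S (t - r) (f r))"

text \<open>Composition with the projection of the line onto \<open>[0,T]\<close> extends continuous functions on \<open>[0,T]\<close> to the
whole line.\<close>

definition clampT :: "real \<Rightarrow> real" where "clampT r = max 0 (min T r)"

lemma clampT_in: "clampT r \<in> {0..T}" using T by (auto simp: clampT_def)
lemma clampT_id: "r \<in> {0..T} \<Longrightarrow> clampT r = r" by (auto simp: clampT_def)
lemma continuous_clampT: "continuous_on A clampT"
  unfolding clampT_def by (intro continuous_intros)

lemma continuous_on_clampT: "continuous_on {0..T} f \<Longrightarrow> continuous_on A (\<lambda>r. f (clampT r))"
  by (rule continuous_on_compose2[of "{0..T}" f, OF _ continuous_clampT]) (use clampT_in in auto)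

text \<open>After the substitution \<open>r \<mapsto> t - r\<close> the singularity stays at \<open>r = 0\<close> and the time \<open>t\<close> enters only through the
indicator and through \<open>f\<close>. One integrable function then dominates the integrand for all \<open>t\<close>.\<close>

definition integrand :: "(real \<Rightarrow> 'm) \<Rightarrow> real \<Rightarrow> real \<Rightarrow> 'a" where
  "integrand f t r = indicator {0<..<t} r *\<^sub>R S r (f (clampT (t - r)))"

lemma conv_eq:
  assumes "t \<in> {0..T}" shows "conv f t = (LINT r|lborel. integrand f t r)"
proof -
  have "conv f t = (LINT x|lborel. indicator {0..t} (t + (-1) * x) *\<^sub>R S (t - (t + (-1) * x)) (f (t + (-1) * x)))"
    unfolding conv_def set_lebesgue_integral_def
    by (subst lborel_integral_real_affine[of "-1" _ t]) simp_all
  also have "\<dots> = (LINT r|lborel. integrand f t r)"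
  proof (rule integral_discrete_difference[of "{0, t}"])
    fix x assume "x \<notin> {0, t}"
    then show "indicator {0..t} (t + (-1) * x) *\<^sub>R S (t - (t + (-1) * x)) (f (t + (-1) * x)) = integrand f t x"
      using assms clampT_id[of "t - x"] by (auto simp: integrand_def indicator_def)
  qed auto
  finally show ?thesis .
qed

lemma bounded_of_continuous:
  assumes "continuous_on {0..T} (f :: real \<Rightarrow> 'n::real_normed_vector)"
  obtains B where "0 \<le> B" "\<And>r. norm (f (clampT r)) \<le> B"
proof -
  have "bounded (f ` {0..T})"
    using assms by (intro compact_imp_bounded compact_continuous_image) auto
  then obtain B where "0 < B" "\<And>x. x \<in> {0..T} \<Longrightarrow> norm (f x) \<le> B"
    unfolding bounded_pos by auto
  then show ?thesis using clampT_in by (intro that[of B]) auto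
qed

lemma integrand_measurable:
  assumes "continuous_on {0..T} f" shows "integrand f t \<in> borel_measurable lborel"
proof -
  have "continuous_on UNIV (\<lambda>r. f (clampT (t - r)))"
    by (rule continuous_on_compose2[OF continuous_on_clampT[OF assms, of UNIV]]) (auto intro!: continuous_intros)
  from S_measurable[OF this]
  have "(\<lambda>r. indicator {..<t} r *\<^sub>R (indicator {0<..} r *\<^sub>R S r (f (clampT (t - r))))) \<in> borel_measurable borel"
    by measurable
  also have "(\<lambda>r. indicator {..<t} r *\<^sub>R (indicator {0<..} r *\<^sub>R S r (f (clampT (t - r))))) = integrand f t"
    by (auto simp: integrand_def indicator_def fun_eq_iff)
  finally show ?thesis by simp
qed

lemma integrand_bound:
  assumes "t \<le> T" "0 \<le> B" "\<And>r. norm (f (clampT r)) \<le> B"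
  shows "norm (integrand f t r) \<le> indicator {0..T} r *\<^sub>R (r powr (- a) * B)"
proof (cases "0 < r \<and> r < t")
  case True
  have "norm (S r (f (clampT (t - r)))) \<le> r powr (- a) * norm (f (clampT (t - r)))"
    using True by (intro S_bound) auto
  also have "\<dots> \<le> r powr (- a) * B" by (intro mult_left_mono assms) auto
  finally show ?thesis using True assms by (simp add: integrand_def)
qed (use assms in \<open>auto simp: integrand_def indicator_def\<close>)

lemma dominating_integrable: "integrable lborel (\<lambda>r. indicator {0..T} r *\<^sub>R (r powr (- a) * B))"
  using set_integrable_mult_left[OF powr_minus_integrable[of a T]] a T
  unfolding set_integrable_def by simp

lemma integrand_integrable:
  assumes "continuous_on {0..T} f" "t \<in> {0..T}"
  shows "integrable lborel (integrand f t)"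
proof -
  obtain B where B: "0 \<le> B" "\<And>r. norm (f (clampT r)) \<le> B"
    using bounded_of_continuous[OF assms(1)] by blast
  show ?thesis
  proof (rule Bochner_Integration.integrable_bound[OF dominating_integrable[of B] integrand_measurable[OF assms(1)]])
    show "AE r in lborel. norm (integrand f t r) \<le> norm (indicator {0..T} r *\<^sub>R (r powr (- a) * B))"
      using integrand_bound[of t B f] B assms by (auto intro!: AE_I2 order_trans[OF _ abs_ge_self])
  qed
qed

lemma conv_diff:
  assumes "continuous_on {0..T} f" "continuous_on {0..T} g" "t \<in> {0..T}"
  shows "conv (\<lambda>r. f r - g r) t = conv f t - conv g t"
proof -
  have "integrand (\<lambda>r. f r - g r) t r = integrand f t r - integrand g t r" for r
    using linear_diff[OF bounded_linear.linear[OF S_linear], of r]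
    by (cases "0 < r") (auto simp: integrand_def indicator_def)
  then show ?thesis
    using assms by (simp add: conv_eq integrand_integrable)
qed

lemma conv_add:
  assumes "continuous_on {0..T} f" "continuous_on {0..T} g" "t \<in> {0..T}"
  shows "conv (\<lambda>r. f r + g r) t = conv f t + conv g t"
proof -
  have "conv (\<lambda>r. (f r + g r) - g r) t = conv (\<lambda>r. f r + g r) t - conv g t"
    using assms by (intro conv_diff continuous_intros) auto
  then show ?thesis by simp
qed

lemma continuous_conv:
  assumes "continuous_on {0..T} f" shows "continuous_on {0..T} (conv f)"
proof (rule continuous_on_sequentiallyI)
  fix u t assume u: "\<forall>n. u n \<in> {0..T}" and t: "t \<in> {0..T}" and lim: "u \<longlonglongrightarrow> t"
  obtain B where B: "0 \<le> B" "\<And>r. norm (f (clampT r)) \<le> B"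
    using bounded_of_continuous[OF assms] by blast
  have "(\<lambda>n. LINT r|lborel. integrand f (u n) r) \<longlonglongrightarrow> (LINT r|lborel. integrand f t r)"
  proof (rule integral_dominated_convergence[where w = "\<lambda>r. indicator {0..T} r *\<^sub>R (r powr (- a) * B)"])
    show "AE r in lborel. norm (integrand f (u n) r) \<le> indicator {0..T} r *\<^sub>R (r powr (- a) * B)" for n
      using integrand_bound[of "u n" B f] B u by auto
    show "AE r in lborel. (\<lambda>n. integrand f (u n) r) \<longlonglongrightarrow> integrand f t r"
      using AE_lborel_singleton[of t]
    proof eventually_elim
      fix r assume r: "r \<noteq> t"
      consider "r \<le> 0" | "t < r" | "0 < r" "r < t" using r by linarith
      then show "(\<lambda>n. integrand f (u n) r) \<longlonglongrightarrow> integrand f t r"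
      proof cases
        case 1 then show ?thesis by (simp add: integrand_def)
      next
        case 2
        have "eventually (\<lambda>n. u n < r) sequentially" by (rule order_tendstoD(2)[OF lim 2])
        then have "eventually (\<lambda>n. integrand f (u n) r = integrand f t r) sequentially"
          by eventually_elim (use 2 in \<open>auto simp: integrand_def\<close>)
        then show ?thesis by (rule tendsto_eventually)
      next
        case 3
        have "isCont (\<lambda>s. f (clampT s)) (t - r)"
          using continuous_on_clampT[OF assms, of UNIV] by (simp add: continuous_on_eq_continuous_at)
        then have "(\<lambda>n. f (clampT (u n - r))) \<longlonglongrightarrow> f (clampT (t - r))"
          by (rule isCont_tendsto_compose) (intro tendsto_intros lim)
        then have *: "(\<lambda>n. S r (f (clampT (u n - r)))) \<longlonglongrightarrow> S r (f (clampT (t - r)))"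
          by (rule bounded_linear.tendsto[OF S_linear[OF 3(1)]])
        have "eventually (\<lambda>n. r < u n) sequentially" by (rule order_tendstoD(1)[OF lim 3(2)])
        then have "eventually (\<lambda>n. integrand f (u n) r = S r (f (clampT (u n - r)))) sequentially"
          by eventually_elim (use 3 in \<open>auto simp: integrand_def\<close>)
        moreover have "integrand f t r = S r (f (clampT (t - r)))"
          using 3 by (auto simp: integrand_def)
        ultimately show ?thesis using * by (simp add: filterlim_cong)
      qed
    qed
  qed (use dominating_integrable integrand_measurable[OF assms] in auto)
  then show "(\<lambda>n. conv f (u n)) \<longlonglongrightarrow> conv f t"
    using u t by (simp add: conv_eq)
qed

lemma integral_singular_bound:
  fixes h :: "real \<Rightarrow> 'b::{banach, second_countable_topology}"
  assumes "\<theta> < 1" "0 \<le> t" "0 \<le> C" "\<And>r. 0 < r \<Longrightarrow> r < t \<Longrightarrow> norm (h r) \<le> C * r powr (- \<theta>)"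
    "\<And>r. \<not> (0 < r \<and> r < t) \<Longrightarrow> h r = 0"
  shows "norm (LINT r|lborel. h r) \<le> C * (t powr (1 - \<theta>) / (1 - \<theta>))"
proof -
  have "norm (LINT r|lborel. h r) \<le> (LINT r|lborel. norm (h r))" by (rule integral_norm_bound)
  also have "\<dots> \<le> (LINT r|lborel. indicator {0..t} r *\<^sub>R (C * r powr (- \<theta>)))"
  proof (rule integral_mono')
    show "integrable lborel (\<lambda>r. indicator {0..t} r *\<^sub>R (C * r powr (- \<theta>)))"
      using set_integrable_mult_right[OF powr_minus_integrable[OF assms(1,2)]] assms
      unfolding set_integrable_def by simp
    show "norm (h r) \<le> indicator {0..t} r *\<^sub>R (C * r powr (- \<theta>))" for r
      using assms(4,5)[of r] assms(3) by (cases "0 < r \<and> r < t") (auto simp: indicator_def)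
  qed (use assms in auto)
  also have "\<dots> = C * (LBINT r:{0..t}. r powr (- \<theta>))"
    unfolding set_lebesgue_integral_def by (subst integral_mult_right_zero[symmetric]) (simp add: algebra_simps)
  finally show ?thesis using assms by (simp add: powr_minus_integral)
qed

text \<open>In the weighted norm \<open>sup\<^sub>t e\<^bsup>-\<kappa>t\<^esup> \<parallel>f(t)\<parallel>\<close> the convolution operator has norm at most
\<open>\<integral>\<^sub>0\<^sup>T e\<^bsup>-\<kappa>r\<^esup> r\<^bsup>-a\<^esup> dr\<close>, which is as small as desired for large \<open>\<kappa>\<close>. This replaces iteration of the singular kernel
both in Gronwall's inequality and in the fixed point argument.\<close>

lemma weighted_bound:
  assumes "0 < \<delta>"
  obtains \<kappa> where "0 < \<kappa>"
    "\<And>f c t. t \<in> {0..T} \<Longrightarrow> 0 \<le> c \<Longrightarrow> (\<And>r. r \<in> {0..T} \<Longrightarrow> norm (f r) \<le> c * exp (\<kappa> * r)) \<Longrightarrow>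
       norm (conv f t) \<le> \<delta> * (c * exp (\<kappa> * t))"
proof -
  \<comment> \<open>Half of the room below the critical exponent 1 is spent on the factor \<open>e\<^bsup>-\<kappa>r\<^esup> \<le> (\<kappa>r)\<^bsup>-b\<^esup>\<close>; then \<open>a + b < 1\<close>.\<close>
  define b where "b = (1 - a) / 2"
  have b: "0 < b" "b \<le> 1" "a + b < 1" "1 - (a + b) = b" using a by (auto simp: b_def field_simps)
  define \<kappa> where "\<kappa> = (T powr b / (b * \<delta>)) powr (1 / b)"
  have \<kappa>: "0 < \<kappa>" using T b assms by (simp add: \<kappa>_def)
  have "\<kappa> powr b = T powr b / (b * \<delta>)" using T b assms by (simp add: \<kappa>_def powr_powr)
  then have \<kappa>b: "\<kappa> powr (- b) * (T powr b / b) = \<delta>"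
    using T b(1) assms by (simp add: powr_minus powr_gt_zero[of T b] del: powr_gt_zero)
  show ?thesis
  proof (rule that[OF \<kappa>])
    fix f :: "real \<Rightarrow> 'm" and c t
    assume t: "t \<in> {0..T}" and c: "0 \<le> (c::real)" and f: "\<And>r. r \<in> {0..T} \<Longrightarrow> norm (f r) \<le> c * exp (\<kappa> * r)"
    have "norm (LINT r|lborel. integrand f t r) \<le> (c * exp (\<kappa> * t) * \<kappa> powr (- b)) * (t powr (1 - (a + b)) / (1 - (a + b)))"
    proof (rule integral_singular_bound)
      fix r assume r: "0 < r" "r < t"
      have "exp (- r * \<kappa>) * \<kappa> powr b * \<kappa> powr (- b) \<le> r powr (- b) * \<kappa> powr (- b)"
        by (intro mult_right_mono powr_exp_le) (use b \<kappa> r in auto)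
      moreover have "\<kappa> powr b * \<kappa> powr (- b) = 1" using \<kappa> by (simp add: powr_add[symmetric])
      ultimately have "exp (- r * \<kappa>) \<le> \<kappa> powr (- b) * r powr (- b)"
        by (simp only: mult.assoc mult.commute[of "r powr (- b)"] mult_1_right)
      then have "exp (\<kappa> * t) * exp (- r * \<kappa>) \<le> exp (\<kappa> * t) * (\<kappa> powr (- b) * r powr (- b))"
        by (intro mult_left_mono) auto
      moreover have "exp (\<kappa> * (t - r)) = exp (\<kappa> * t) * exp (- r * \<kappa>)"
        by (simp add: exp_add[symmetric] algebra_simps)
      ultimately have "exp (\<kappa> * (t - r)) \<le> exp (\<kappa> * t) * (\<kappa> powr (- b) * r powr (- b))"
        by simp
      have "norm (integrand f t r) \<le> r powr (- a) * norm (f (t - r))"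
        using S_bound[of r "f (t - r)"] r t clampT_id[of "t - r"] by (simp add: integrand_def)
      also have "\<dots> \<le> r powr (- a) * (c * exp (\<kappa> * (t - r)))"
        using r t by (intro mult_left_mono f) auto
      also have "\<dots> \<le> r powr (- a) * (c * (exp (\<kappa> * t) * (\<kappa> powr (- b) * r powr (- b))))"
        by (intro mult_left_mono c) (use \<open>exp (\<kappa> * (t - r)) \<le> _\<close> in auto)
      also have "\<dots> = (c * exp (\<kappa> * t) * \<kappa> powr (- b)) * r powr (- (a + b))"
        using powr_add[of r "- a" "- b"] by simp
      finally show "norm (integrand f t r) \<le> (c * exp (\<kappa> * t) * \<kappa> powr (- b)) * r powr (- (a + b))" .
    qed (use b t c in \<open>auto simp: integrand_def indicator_def\<close>)
    also have "\<dots> \<le> (c * exp (\<kappa> * t) * \<kappa> powr (- b)) * (T powr b / b)"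
      unfolding b(4) using b t c by (intro mult_left_mono divide_right_mono powr_mono2) auto
    also have "\<dots> = \<delta> * (c * exp (\<kappa> * t))" using \<kappa>b by (simp add: algebra_simps)
    finally show "norm (conv f t) \<le> \<delta> * (c * exp (\<kappa> * t))" using t by (simp add: conv_eq)
  qed
qed

text \<open>Gronwall's inequality for \<open>\<parallel>y\<parallel> \<le> m + \<parallel>S * f\<parallel>\<close> with \<open>\<parallel>f\<parallel> \<le> L \<parallel>y\<parallel> + g\<close>. The constant is the same for all \<open>y\<close> and \<open>f\<close>,
which matters because the inequality is applied on every path of the noise with the same constant.\<close>

definition gronwall_constant :: "real \<Rightarrow> real \<Rightarrow> bool" where
  "gronwall_constant L K \<longleftrightarrow> 1 \<le> K \<and> (\<forall>(y :: real \<Rightarrow> 'a) f m g. continuous_on {0..T} y \<longrightarrow> 0 \<le> g \<longrightarrow> 0 \<le> m \<longrightarrow>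
     (\<forall>t\<in>{0..T}. norm (f t) \<le> L * norm (y t) + g) \<longrightarrow>
     (\<forall>t\<in>{0..T}. norm (y t) \<le> m + norm (conv f t)) \<longrightarrow> (\<forall>t\<in>{0..T}. norm (y t) \<le> K * (m + g)))"

lemma gronwallD:
  fixes y :: "real \<Rightarrow> 'a"
  assumes "gronwall_constant L K" "continuous_on {0..T} y" "0 \<le> g" "0 \<le> m" "t \<in> {0..T}"
    "\<And>t. t \<in> {0..T} \<Longrightarrow> norm (f t) \<le> L * norm (y t) + g"
    "\<And>t. t \<in> {0..T} \<Longrightarrow> norm (y t) \<le> m + norm (conv f t)"
  shows "norm (y t) \<le> K * (m + g)"
  by (rule assms(1)[unfolded gronwall_constant_def, THEN conjunct2, rule_format]) (use assms in auto)

lemma volterra_gronwall: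
  assumes L: "0 \<le> (L::real)"
  shows "\<exists>K. gronwall_constant L K"
proof -
  define \<delta> where "\<delta> = 1 / (2 * (L + 1))"
  have \<delta>: "0 < \<delta>" "\<delta> * L \<le> 1 / 2" "\<delta> \<le> 1" using L by (auto simp: \<delta>_def field_simps)
  obtain \<kappa> where \<kappa>: "0 < \<kappa>" and wb: "\<And>f c t. t \<in> {0..T} \<Longrightarrow> 0 \<le> c \<Longrightarrow> (\<And>r. r \<in> {0..T} \<Longrightarrow> norm (f r) \<le> c * exp (\<kappa> * r)) \<Longrightarrow>
       norm (conv f t) \<le> \<delta> * (c * exp (\<kappa> * t))"
    using weighted_bound[OF \<delta>(1)] by blast
  show ?thesis
    unfolding gronwall_constant_def
  proof (intro exI[of _ "2 * exp (\<kappa> * T)"] conjI allI impI ballI)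
    have "1 \<le> exp (\<kappa> * T)" using \<kappa> T by simp
    then show "1 \<le> 2 * exp (\<kappa> * T)" by linarith
    fix y :: "real \<Rightarrow> 'a" and f m g t
    assume y: "continuous_on {0..T} y" and g: "0 \<le> g" and m: "0 \<le> m" and t: "t \<in> {0..T}"
      and f': "\<forall>t\<in>{0..T}. norm (f t) \<le> L * norm (y t) + g"
      and le': "\<forall>t\<in>{0..T}. norm (y t) \<le> m + norm (conv f t)"
    note f = f'[rule_format] and le = le'[rule_format]
    have "continuous_on {0..T} (\<lambda>t. exp (- \<kappa> * t) * norm (y t))"
      by (intro continuous_intros y)
    then obtain t1 where t1: "t1 \<in> {0..T}" and
      max: "\<And>t. t \<in> {0..T} \<Longrightarrow> exp (- \<kappa> * t) * norm (y t) \<le> exp (- \<kappa> * t1) * norm (y t1)"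
      using continuous_attains_sup[of "{0..T}" "\<lambda>t. exp (- \<kappa> * t) * norm (y t)"] T by auto
    define c where "c = exp (- \<kappa> * t1) * norm (y t1)"
    have c0: "0 \<le> c" by (simp add: c_def)
    have yc: "norm (y t) \<le> c * exp (\<kappa> * t)" if "t \<in> {0..T}" for t
      using max[OF that] unfolding c_def[symmetric] by (simp add: exp_minus field_simps)
    have "norm (f r) \<le> (L * c + g) * exp (\<kappa> * r)" if r: "r \<in> {0..T}" for r
    proof -
      have "norm (f r) \<le> L * (c * exp (\<kappa> * r)) + g * exp (\<kappa> * r)"
        using f[OF r] mult_left_mono[OF yc[OF r] L] mult_left_mono[OF _ g, of 1 "exp (\<kappa> * r)"] r \<kappa> by auto
      then show ?thesis by (simp add: algebra_simps)
    qed
    then have "norm (conv f t1) \<le> \<delta> * ((L * c + g) * exp (\<kappa> * t1))"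
      using L c0 g by (intro wb t1) auto
    then have "norm (y t1) \<le> m + \<delta> * ((L * c + g) * exp (\<kappa> * t1))"
      using le[OF t1] by linarith
    then have "c \<le> exp (- \<kappa> * t1) * (m + \<delta> * ((L * c + g) * exp (\<kappa> * t1)))"
      unfolding c_def by (intro mult_left_mono) auto
    also have "\<dots> = exp (- \<kappa> * t1) * m + (\<delta> * L) * c + \<delta> * g"
      by (simp add: exp_minus field_simps)
    also have "\<dots> \<le> 1 * m + (1/2) * c + 1 * g"
      using \<delta> m g c0 t1 \<kappa> by (intro add_mono mult_right_mono) auto
    finally have "c \<le> 2 * (m + g)" by simp
    then have "norm (y t) \<le> 2 * (m + g) * exp (\<kappa> * t)"
      using yc[OF t] by (meson mult_right_mono exp_ge_zero order_trans)
    also have "\<dots> \<le> 2 * (m + g) * exp (\<kappa> * T)"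
      using m g t \<kappa> by (intro mult_left_mono) auto
    finally show "norm (y t) \<le> 2 * exp (\<kappa> * T) * (m + g)" by (simp add: algebra_simps)
  qed
qed

text \<open>Contraction in the weighted norm. The unknown is the rescaled function \<open>z(t) = e\<^bsup>-\<kappa>t\<^esup> y(t)\<close>, for which the
weighted norm becomes the supremum norm of the complete space of bounded continuous functions.\<close>

lemma volterra_solution:
  fixes B :: "'a \<Rightarrow> 'm"
  assumes L: "0 \<le> (L::real)" and B: "\<And>x y. norm (B x - B y) \<le> L * norm (x - y)"
    and w: "continuous_on {0..T} w"
  shows "\<exists>y. continuous_on {0..T} y \<and> (\<forall>t\<in>{0..T}. y t = w t + conv (\<lambda>r. B (y r)) t)"
proof -
  define \<delta> where "\<delta> = 1 / (2 * (L + 1))"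
  have \<delta>: "0 < \<delta>" "\<delta> * L \<le> 1 / 2" using L by (auto simp: \<delta>_def field_simps)
  obtain \<kappa> where \<kappa>: "0 < \<kappa>" and wb: "\<And>f c t. t \<in> {0..T} \<Longrightarrow> 0 \<le> c \<Longrightarrow> (\<And>r. r \<in> {0..T} \<Longrightarrow> norm (f r) \<le> c * exp (\<kappa> * r)) \<Longrightarrow>
       norm (conv f t) \<le> \<delta> * (c * exp (\<kappa> * t))"
    using weighted_bound[OF \<delta>(1)] by blast
  have contB: "continuous_on UNIV B"
    by (rule lipschitz_on_continuous_on[of L]) (use B L in \<open>auto simp: lipschitz_on_def dist_norm\<close>)
  define G where "G z r = B (exp (\<kappa> * r) *\<^sub>R apply_bcontfun z r)" for z :: "real \<Rightarrow>\<^sub>C 'a" and r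
  have contG: "continuous_on {0..T} (G z)" for z
    unfolding G_def by (rule continuous_on_compose2[OF contB]) (auto intro!: continuous_intros)
  define H where "H z t = exp (- \<kappa> * t) *\<^sub>R (w t + conv (G z) t)" for z t
  have contH: "continuous_on {0..T} (H z)" for z
    unfolding H_def by (intro continuous_intros w continuous_conv contG)
  have H_in: "(\<lambda>t. H z (clampT t)) \<in> bcontfun" for z
  proof -
    obtain C where "\<And>r. norm (H z (clampT r)) \<le> C" using bounded_of_continuous[OF contH[of z]] by blast
    then show ?thesis by (intro bcontfun_normI continuous_on_clampT contH)
  qed
  define P where "P z = Bcontfun (\<lambda>t. H z (clampT t))" for z
  have P: "apply_bcontfun (P z) t = H z (clampT t)" for z t
    unfolding P_def using H_in by (simp add: Bcontfun_inverse)
  have contr: "dist (P x) (P z) \<le> (1/2) * dist x z" for x z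
  proof (rule dist_bound)
    fix t
    let ?t = "clampT t"
    have "norm (conv (\<lambda>r. G x r - G z r) ?t) \<le> \<delta> * ((L * dist x z) * exp (\<kappa> * ?t))"
    proof (rule wb[OF clampT_in])
      fix r assume r: "r \<in> {0..T}"
      have "norm (G x r - G z r) \<le> L * norm (exp (\<kappa> * r) *\<^sub>R apply_bcontfun x r - exp (\<kappa> * r) *\<^sub>R apply_bcontfun z r)"
        unfolding G_def by (rule B)
      also have "\<dots> = L * (exp (\<kappa> * r) * dist (apply_bcontfun x r) (apply_bcontfun z r))"
        by (simp add: scaleR_diff_right[symmetric] dist_norm)
      also have "\<dots> \<le> L * (exp (\<kappa> * r) * dist x z)"
        by (intro mult_left_mono dist_bounded L) auto
      finally show "norm (G x r - G z r) \<le> (L * dist x z) * exp (\<kappa> * r)" by (simp add: algebra_simps)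
    qed (use L in auto)
    then have "norm (conv (G x) ?t - conv (G z) ?t) \<le> (\<delta> * L) * dist x z * exp (\<kappa> * ?t)"
      using conv_diff[OF contG contG clampT_in] by (simp add: algebra_simps)
    also have "\<dots> \<le> (1/2) * dist x z * exp (\<kappa> * ?t)"
      using \<delta> by (intro mult_right_mono) auto
    finally have "exp (- \<kappa> * ?t) * norm (conv (G x) ?t - conv (G z) ?t) \<le> (1/2) * dist x z"
      by (simp add: exp_minus field_simps)
    then show "dist (apply_bcontfun (P x) t) (apply_bcontfun (P z) t) \<le> (1/2) * dist x z"
      by (simp add: P H_def dist_norm scaleR_diff_right[symmetric])
  qed
  have "\<exists>!z. P z = z" by (rule banach_fix_type[of "1/2"]) (use contr in auto)
  then obtain z where z: "P z = z" by blast
  define y where "y t = exp (\<kappa> * t) *\<^sub>R apply_bcontfun z t" for t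
  have "y t = w t + conv (\<lambda>r. B (y r)) t" if t: "t \<in> {0..T}" for t
  proof -
    have "apply_bcontfun z t = exp (- \<kappa> * t) *\<^sub>R (w t + conv (G z) t)"
      using P[of z t] z clampT_id[OF t] by (simp add: H_def)
    moreover have "G z = (\<lambda>r. B (y r))" by (simp add: G_def y_def fun_eq_iff)
    ultimately show ?thesis by (simp add: y_def exp_minus)
  qed
  moreover have "continuous_on {0..T} y" unfolding y_def by (auto intro!: continuous_intros)
  ultimately show ?thesis by blast
qed

end

locale volterra = singular_kernel S T a for S :: "real \<Rightarrow> 'm::real_normed_vector \<Rightarrow> 'a::{banach, second_countable_topology}" and T a +
  fixes B :: "'a \<Rightarrow> 'm" and L :: real
  assumes L: "0 \<le> L"
    and B_lipschitz: "\<And>x y. norm (B x - B y) \<le> L * norm (x - y)"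
    and B_second_diff: "\<And>x y z. norm (B x + B y - 2 *\<^sub>R B z)
          \<le> L * (norm (x + y - 2 *\<^sub>R z) + (norm (x - z))\<^sup>2 + (norm (y - z))\<^sup>2)"
begin

definition solves :: "(real \<Rightarrow> 'a) \<Rightarrow> (real \<Rightarrow> 'a) \<Rightarrow> bool" where
  "solves w y \<longleftrightarrow> continuous_on {0..T} y \<and> (\<forall>t\<in>{0..T}. y t = w t + conv (\<lambda>r. B (y r)) t)"

definition Sol :: "(real \<Rightarrow> 'a) \<Rightarrow> real \<Rightarrow> 'a" where
  "Sol w = (SOME y. solves w y)"

lemma solves_Sol:
  assumes "continuous_on {0..T} w" shows "solves w (Sol w)"
proof -
  have "\<exists>y. solves w y"
    unfolding solves_def by (rule volterra_solution[OF L B_lipschitz assms])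
  then show ?thesis unfolding Sol_def by (rule someI_ex)
qed

lemma continuous_B: "continuous_on {0..T} y \<Longrightarrow> continuous_on {0..T} (\<lambda>r. B (y r))"
proof -
  have "continuous_on UNIV B"
    by (rule lipschitz_on_continuous_on[of L]) (use B_lipschitz L in \<open>auto simp: lipschitz_on_def dist_norm\<close>)
  then show "continuous_on {0..T} y \<Longrightarrow> continuous_on {0..T} (\<lambda>r. B (y r))"
    by (rule continuous_on_compose2) auto
qed

text \<open>Lipschitz continuity of the solution map and the quadratic bound for its second differences about
\<open>w = (w\<^sub>p + w\<^sub>m) / 2\<close>, with one constant for all forcing terms.\<close>

definition stability_constant :: "real \<Rightarrow> bool" where
  "stability_constant K \<longleftrightarrow> 1 \<le> K \<and>
     (\<forall>w1 w2 y1 y2 m. solves w1 y1 \<longrightarrow> solves w2 y2 \<longrightarrow> (\<forall>t\<in>{0..T}. norm (w1 t - w2 t) \<le> m) \<longrightarrow>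
        (\<forall>t\<in>{0..T}. norm (y1 t - y2 t) \<le> K * m)) \<and>
     (\<forall>wp wm w yp ym y m. solves wp yp \<longrightarrow> solves wm ym \<longrightarrow> solves w y \<longrightarrow>
        (\<forall>t\<in>{0..T}. wp t + wm t = 2 *\<^sub>R w t) \<longrightarrow> (\<forall>t\<in>{0..T}. norm (wp t - w t) \<le> m) \<longrightarrow>
        (\<forall>t\<in>{0..T}. norm (yp t + ym t - 2 *\<^sub>R y t) \<le> K * m\<^sup>2))"

lemma stability_lipschitz:
  assumes "stability_constant K" "solves w1 y1" "solves w2 y2"
    "\<And>t. t \<in> {0..T} \<Longrightarrow> norm (w1 t - w2 t) \<le> m" "t \<in> {0..T}"
  shows "norm (y1 t - y2 t) \<le> K * m"
  by (rule assms(1)[unfolded stability_constant_def, THEN conjunct2, THEN conjunct1, rule_format]) (use assms in auto)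

lemma stability_second_diff:
  assumes "stability_constant K" "solves wp yp" "solves wm ym" "solves w y"
    "\<And>t. t \<in> {0..T} \<Longrightarrow> wp t + wm t = 2 *\<^sub>R w t"
    "\<And>t. t \<in> {0..T} \<Longrightarrow> norm (wp t - w t) \<le> m" "t \<in> {0..T}"
  shows "norm (yp t + ym t - 2 *\<^sub>R y t) \<le> K * m\<^sup>2"
  by (rule assms(1)[unfolded stability_constant_def, THEN conjunct2, THEN conjunct2, rule_format]) (use assms in auto)

text \<open>The combination \<open>y\<^sub>p + y\<^sub>m - 2 y\<close> solves a Volterra equation without forcing term, whose right hand side is
the second difference of \<open>B\<close>. That is linear in \<open>y\<^sub>p + y\<^sub>m - 2 y\<close> up to squares of \<open>y\<^sub>p - y\<close> and \<open>y\<^sub>m - y\<close>, already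
controlled by Lipschitz continuity, so Gronwall's inequality applies again.\<close>

lemma solution_estimates: "\<exists>K. stability_constant K"
proof -
  obtain K where gK: "gronwall_constant L K" using volterra_gronwall[OF L] by blast
  then have K: "1 \<le> K" by (simp add: gronwall_constant_def)
  have lip: "norm (y1 t - y2 t) \<le> K * m"
    if y1: "solves w1 y1" and y2: "solves w2 y2"
    and m: "\<And>t. t \<in> {0..T} \<Longrightarrow> norm (w1 t - w2 t) \<le> m" and t: "t \<in> {0..T}" for w1 w2 y1 y2 m t
  proof -
    have m0: "0 \<le> m" using m[OF t] norm_ge_zero order_trans by blast
    have c: "continuous_on {0..T} y1" "continuous_on {0..T} y2" using y1 y2 by (auto simp: solves_def)
    have "norm (y1 t - y2 t) \<le> K * (m + 0)"
    proof (rule gronwallD[OF gK, where f = "\<lambda>r. B (y1 r) - B (y2 r)" and y = "\<lambda>t. y1 t - y2 t"])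
      fix t assume t: "t \<in> {0..T}"
      have "y1 t - y2 t = (w1 t - w2 t) + conv (\<lambda>r. B (y1 r) - B (y2 r)) t"
        using y1 y2 t conv_diff[OF continuous_B[OF c(1)] continuous_B[OF c(2)] t] by (simp add: solves_def)
      then show "norm (y1 t - y2 t) \<le> m + norm (conv (\<lambda>r. B (y1 r) - B (y2 r)) t)"
        using norm_triangle_ineq[of "w1 t - w2 t"] m[OF t] by (smt (verit))
    qed (use m0 t B_lipschitz c in \<open>auto intro: continuous_intros\<close>)
    then show ?thesis by simp
  qed
  show ?thesis
    unfolding stability_constant_def
  proof (intro exI[of _ "K * (2 * L * K\<^sup>2 + 1)"] conjI allI impI ballI)
    have K1: "1 \<le> 2 * L * K\<^sup>2 + 1" using L by simp
    then have KK: "K \<le> K * (2 * L * K\<^sup>2 + 1)" using K mult_left_mono[OF K1, of K] by simp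
    then show "1 \<le> K * (2 * L * K\<^sup>2 + 1)" using K by linarith
    show "norm (y1 t - y2 t) \<le> K * (2 * L * K\<^sup>2 + 1) * m"
      if y1: "solves w1 y1" and y2: "solves w2 y2"
      and m': "\<forall>t\<in>{0..T}. norm (w1 t - w2 t) \<le> m" and t: "t \<in> {0..T}" for w1 w2 y1 y2 m t
    proof -
      note m = m'[rule_format]
      have m0: "0 \<le> m" using m[OF t] norm_ge_zero order_trans by blast
      show ?thesis using lip[OF y1 y2 m t] mult_right_mono[OF KK m0] by linarith
    qed
    fix wp wm w yp ym y m t
    assume yp: "solves wp yp" and ym: "solves wm ym" and y: "solves w y"
      and sum': "\<forall>t\<in>{0..T}. wp t + wm t = 2 *\<^sub>R w t"
      and bound: "\<forall>t\<in>{0..T}. norm (wp t - w t) \<le> m" and t: "t \<in> {0..T}"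
    note sum = sum'[rule_format] and m = bound[rule_format]
    have c: "continuous_on {0..T} yp" "continuous_on {0..T} ym" "continuous_on {0..T} y"
      using yp ym y by (auto simp: solves_def)
    have m0: "0 \<le> m" using m[OF t] norm_ge_zero order_trans by blast
    have m': "norm (wm t - w t) \<le> m" if "t \<in> {0..T}" for t
    proof -
      have "wm t - w t = - (wp t - w t)" using sum[OF that] by (simp add: scaleR_2 algebra_simps)
      then show ?thesis using m[OF that] by (simp only: norm_minus_cancel)
    qed
    note cB = continuous_B[OF c(1)] continuous_B[OF c(2)] continuous_B[OF c(3)]
    define f where "f r = B (yp r) + B (ym r) - 2 *\<^sub>R B (y r)" for r
    have "norm (yp t + ym t - 2 *\<^sub>R y t) \<le> K * (0 + 2 * L * (K * m)\<^sup>2)"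
    proof (rule gronwallD[OF gK, where f = f and y = "\<lambda>t. yp t + ym t - 2 *\<^sub>R y t"])
      fix t assume t: "t \<in> {0..T}"
      have "conv f t = conv (\<lambda>r. B (yp r)) t + conv (\<lambda>r. B (ym r)) t - conv (\<lambda>r. B (y r) + B (y r)) t"
        unfolding f_def scaleR_2
        by (simp only: conv_diff[OF continuous_on_add[OF cB(1,2)] continuous_on_add[OF cB(3,3)] t] conv_add[OF cB(1,2) t])
      also have "conv (\<lambda>r. B (y r) + B (y r)) t = 2 *\<^sub>R conv (\<lambda>r. B (y r)) t"
        by (simp only: conv_add[OF cB(3,3) t] scaleR_2)
      finally have "yp t + ym t - 2 *\<^sub>R y t = conv f t"
        using yp ym y t sum[OF t] by (auto simp: solves_def scaleR_2 algebra_simps)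
      then show "norm (yp t + ym t - 2 *\<^sub>R y t) \<le> 0 + norm (conv f t)" by simp
      have "(norm (yp t - y t))\<^sup>2 \<le> (K * m)\<^sup>2" "(norm (ym t - y t))\<^sup>2 \<le> (K * m)\<^sup>2"
        using lip[OF yp y m t] lip[OF ym y m' t] by (auto intro!: power_mono)
      then have "L * (norm (yp t + ym t - 2 *\<^sub>R y t) + (norm (yp t - y t))\<^sup>2 + (norm (ym t - y t))\<^sup>2)
          \<le> L * (norm (yp t + ym t - 2 *\<^sub>R y t) + (K * m)\<^sup>2 + (K * m)\<^sup>2)"
        using L by (intro mult_left_mono) auto
      then show "norm (f t) \<le> L * norm (yp t + ym t - 2 *\<^sub>R y t) + 2 * L * (K * m)\<^sup>2"
        unfolding f_def using B_second_diff[of "yp t" "ym t" "y t"] by (simp add: algebra_simps)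
    qed (use L t c in \<open>auto intro!: continuous_intros\<close>)
    also have "\<dots> = K * (2 * L * K\<^sup>2) * m\<^sup>2" by (simp add: power_mult_distrib)
    also have "\<dots> \<le> K * (2 * L * K\<^sup>2 + 1) * m\<^sup>2"
      using K by (intro mult_right_mono mult_left_mono) auto
    finally show "norm (yp t + ym t - 2 *\<^sub>R y t) \<le> K * (2 * L * K\<^sup>2 + 1) * m\<^sup>2" .
  qed
qed

end

section \<open>The mild equation as a Volterra equation\<close>

lemma semigroup_singular_kernel:
  fixes J :: "'h::real_inner \<Rightarrow> 'a::{real_inner,banach,second_countable_topology}" and Jm :: "'h \<Rightarrow> 'm::{real_inner,banach}"
  assumes J: "scale lam e s J" and Jm: "scale lam e (- sF) Jm"
    and T: "0 < T" and s: "0 \<le> s" "s < 1" "0 \<le> sF" "sF < 1"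
  shows "singular_kernel (semigroup lam e Jm J) T ((s + sF) / 2)"
proof -
  interpret J: scale lam e s J by fact
  interpret Jm: scale lam e "- sF" Jm by fact
  have bd: "\<bar>exp (- r * lam k)\<bar> * lam k powr ((s - - sF) / 2) \<le> r powr (- ((s + sF) / 2))" if "0 < r" "k \<ge> 1" for r k
    using powr_exp_le[of "(s + sF) / 2" "lam k" r] that s J.lam_pos by simp
  note coefs = pairing_diagonal_map[OF Jm J _ bd, folded semigroup_def, OF powr_ge_zero]
  show ?thesis
  proof (rule singular_kernel.intro)
    show "bounded_linear (semigroup lam e Jm J r)" if "0 < r" for r
      unfolding semigroup_def by (rule bounded_linear_diagonal_map[OF Jm J _ bd[OF that]]) auto
    show "norm (semigroup lam e Jm J r x) \<le> r powr (- ((s + sF) / 2)) * norm x" if "0 < r" for r x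
      unfolding semigroup_def by (rule norm_diagonal_map[OF Jm J _ bd[OF that]]) auto
    fix f :: "real \<Rightarrow> 'm" assume f: "continuous_on UNIV f"
    show "(\<lambda>r. indicator {0<..} r *\<^sub>R semigroup lam e Jm J r (f r)) \<in> borel_measurable borel"
    proof (rule borel_measurable_LIMSEQ_metric)
      fix n
      have fm: "(\<lambda>r. pairing e Jm k (f r)) \<in> borel_measurable borel" for k
        by (intro borel_measurable_continuous_onI continuous_on_compose2[OF linear_continuous_on[OF Jm.bounded_linear_coef] f]) auto
      show "(\<lambda>r. indicator {0<..} r *\<^sub>R (\<Sum>k=1..n. (exp (- r * lam k) * pairing e Jm k (f r)) *\<^sub>R J (e k))) \<in> borel_measurable borel"
        using fm by measurable
    next
      fix r
      show "(\<lambda>n. indicator {0<..} r *\<^sub>R (\<Sum>k=1..n. (exp (- r * lam k) * pairing e Jm k (f r)) *\<^sub>R J (e k)))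
        \<longlonglongrightarrow> indicator {0<..} r *\<^sub>R semigroup lam e Jm J r (f r)"
      proof (cases "0 < r")
        case True
        have "J.part {1..n} (semigroup lam e Jm J r (f r)) = (\<Sum>k=1..n. (exp (- r * lam k) * pairing e Jm k (f r)) *\<^sub>R J (e k))" for n
          unfolding J.part_def using coefs[OF True] by (intro sum.cong) auto
        then show ?thesis using J.expansion_tendsto[of "semigroup lam e Jm J r (f r)"] True by simp
      qed simp
    qed
  qed (use T s in auto)
qed

text \<open>Beyond the mode \<open>N\<close> one may write \<open>\<lambda>\<^sup>a = \<lambda>\<^sup>\<theta> \<lambda>\<^bsup>-(\<theta>-a)\<^esup>\<close>: the first factor is absorbed by the semigroup at the price of
\<open>r\<^bsup>-\<theta>\<^esup>\<close>, the second one is at most its value at \<open>N + 1\<close>.\<close>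

lemma galerkin_kernel_bound:
  fixes J :: "'h::real_inner \<Rightarrow> 'a::{real_inner,banach}" and Jm :: "'h \<Rightarrow> 'm::{real_inner,banach}"
  assumes J: "scale lam e s J" and Jm: "scale lam e (- sF) Jm"
    and s: "0 \<le> s" "0 \<le> sF" and \<theta>: "(s + sF) / 2 \<le> \<theta>" "\<theta> \<le> 1" and r: "0 < r"
  shows "norm (semigroup lam e Jm J r x - galerkin_proj e J N (semigroup lam e Jm J r x))
    \<le> (lam (N + 1) powr (- (\<theta> - (s + sF) / 2)) * norm x) * r powr (- \<theta>)"
proof -
  interpret J: scale lam e s J by fact
  interpret Jm: scale lam e "- sF" Jm by fact
  define a where "a = (s + sF) / 2"
  have a: "0 \<le> a" "a \<le> 1" using s \<theta> by (auto simp: a_def)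
  have bd: "\<bar>exp (- r * lam k)\<bar> * lam k powr ((s - - sF) / 2) \<le> r powr (- a)" if "k \<ge> 1" for k
    using powr_exp_le[of a "lam k" r] that a r J.lam_pos by (simp add: a_def)
  define m where "m k = (if k \<le> N then 0 else exp (- r * lam k))" for k
  have bd': "\<bar>m k\<bar> * lam k powr ((s - - sF) / 2) \<le> lam (N + 1) powr (- (\<theta> - a)) * r powr (- \<theta>)" if k: "k \<ge> 1" for k
  proof (cases "k \<le> N")
    case False
    have "lam k powr a = lam k powr \<theta> * lam k powr (- (\<theta> - a))"
      by (simp add: powr_add[symmetric])
    then have "\<bar>m k\<bar> * lam k powr ((s - - sF) / 2) = (exp (- r * lam k) * lam k powr \<theta>) * lam k powr (- (\<theta> - a))"
      using False by (simp add: m_def a_def)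
    also have "\<dots> \<le> r powr (- \<theta>) * lam (N + 1) powr (- (\<theta> - a))"
    proof (rule mult_mono)
      show "exp (- r * lam k) * lam k powr \<theta> \<le> r powr (- \<theta>)"
        using \<theta> a(1) r k J.lam_pos by (intro powr_exp_le) (auto simp: a_def)
      show "lam k powr (- (\<theta> - a)) \<le> lam (N + 1) powr (- (\<theta> - a))"
        using \<theta> False J.lam_pos[of "N + 1"] J.lam_mono[of "N + 1" k] by (intro powr_mono2') (auto simp: a_def)
    qed auto
    finally show ?thesis by (simp add: mult.commute)
  qed (simp add: m_def)
  have eq: "semigroup lam e Jm J r x - galerkin_proj e J N (semigroup lam e Jm J r x) = diagonal_map e Jm J m x"
  proof (rule J.coef_eqI)
    fix k :: nat assume k: "k \<ge> 1"
    have "pairing e J k (semigroup lam e Jm J r x) = exp (- r * lam k) * pairing e Jm k x"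
      unfolding semigroup_def by (rule pairing_diagonal_map[OF Jm J _ bd k]) auto
    moreover have "pairing e J k (diagonal_map e Jm J m x) = m k * pairing e Jm k x"
      by (rule pairing_diagonal_map[OF Jm J _ bd' k]) auto
    ultimately show "pairing e J k (semigroup lam e Jm J r x - galerkin_proj e J N (semigroup lam e Jm J r x))
       = pairing e J k (diagonal_map e Jm J m x)"
      using k by (simp add: J.coef_diff J.pairing_galerkin m_def)
  qed
  show ?thesis
    unfolding eq using norm_diagonal_map[OF Jm J _ bd', of x] by (simp add: a_def algebra_simps)
qed

text \<open>The projection commutes with the integral and therefore acts on the kernel.\<close>

lemma galerkin_conv_bound:
  fixes J :: "'h::real_inner \<Rightarrow> 'a::{real_inner,banach,second_countable_topology}" and Jm :: "'h \<Rightarrow> 'm::{real_inner,banach}"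
  assumes J: "scale lam e s J" and Jm: "scale lam e (- sF) Jm"
    and T: "0 < T" and s: "0 \<le> s" "s < 1" "0 \<le> sF" "sF < 1"
    and \<theta>: "(s + sF) / 2 \<le> \<theta>" "\<theta> < 1"
    and f: "continuous_on {0..T} f" "\<And>t. t \<in> {0..T} \<Longrightarrow> norm (f t) \<le> b" and t: "t \<in> {0..T}"
  defines "c \<equiv> singular_kernel.conv (semigroup lam e Jm J) f t"
  shows "norm (c - galerkin_proj e J N c)
    \<le> lam (N + 1) powr (- (\<theta> - (s + sF) / 2)) * b * (T powr (1 - \<theta>) / (1 - \<theta>))"
proof -
  interpret J: scale lam e s J by fact
  interpret singular_kernel "semigroup lam e Jm J" T "(s + sF) / 2"
    by (rule semigroup_singular_kernel[OF J Jm T s])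
  have b: "0 \<le> b" using f(2)[OF t] norm_ge_zero order_trans by blast
  define Q where "Q x = x - galerkin_proj e J N x" for x :: 'a
  have bl: "bounded_linear Q"
    unfolding Q_def by (intro bounded_linear_sub bounded_linear_ident J.bounded_linear_galerkin)
  have Q0: "Q 0 = 0" using bl by (simp add: linear_0[OF bounded_linear.linear])
  let ?C = "lam (N + 1) powr (- (\<theta> - (s + sF) / 2)) * b"
  have "c = (LINT r|lborel. integrand f t r)" unfolding c_def by (rule conv_eq[OF t])
  then have "Q c = (LINT r|lborel. Q (integrand f t r))"
    using integral_bounded_linear[OF bl integrand_integrable[OF f(1) t]] by simp
  also have "norm \<dots> \<le> ?C * (t powr (1 - \<theta>) / (1 - \<theta>))"
  proof (rule integral_singular_bound[OF \<theta>(2)])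
    fix r assume r: "0 < r" "r < t"
    have tr: "t - r \<in> {0..T}" using r t by auto
    have "norm (Q (integrand f t r)) = norm (Q (semigroup lam e Jm J r (f (t - r))))"
      using r clampT_id[OF tr] by (simp add: integrand_def)
    also have "\<dots> \<le> (lam (N + 1) powr (- (\<theta> - (s + sF) / 2)) * norm (f (t - r))) * r powr (- \<theta>)"
      unfolding Q_def by (rule galerkin_kernel_bound[OF J Jm s(1,3) \<theta>(1) _ r(1)]) (use \<theta> in simp)
    also have "\<dots> \<le> ?C * r powr (- \<theta>)"
      by (intro mult_right_mono mult_left_mono f(2) tr) auto
    finally show "norm (Q (integrand f t r)) \<le> ?C * r powr (- \<theta>)" .
  next
    show "Q (integrand f t r) = 0" if "\<not> (0 < r \<and> r < t)" for r
      using that Q0 by (auto simp: integrand_def indicator_def)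
  qed (use t b in auto)
  also have "\<dots> \<le> ?C * (T powr (1 - \<theta>) / (1 - \<theta>))"
    using t b \<theta> by (intro mult_left_mono divide_right_mono powr_mono2) auto
  finally show ?thesis by (simp add: Q_def)
qed

text \<open>The nonlinearity acts on the space of exponent \<open>s\<close> through the bounded inclusion into the space of
exponent \<open>s\<^sub>F \<le> s\<close>, which changes only the constants.\<close>

lemma nemytskii_volterra:
  fixes J :: "'h::real_inner \<Rightarrow> 'a::{real_inner,banach,second_countable_topology}"
    and Jp :: "'h \<Rightarrow> 'f::{real_inner,banach}" and Jm :: "'h \<Rightarrow> 'm::{real_inner,banach}" and F :: "'f \<Rightarrow> 'm"
  assumes J: "scale lam e s J" and Jp: "scale lam e sF Jp" and Jm: "scale lam e (- sF) Jm"
    and T: "0 < T" and s: "0 \<le> s" "s < 1" "0 \<le> sF" "sF < 1" "sF \<le> s"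
    and F: "C2_bounded_derivs F"
  shows "\<exists>L. volterra (semigroup lam e Jm J) T ((s + sF) / 2) (\<lambda>x. F (inclusion e J Jp x)) L"
proof -
  interpret J: scale lam e s J by fact
  define c where "c = lam 1 powr ((sF - s) / 2)"
  have c: "0 \<le> c" by (simp add: c_def)
  have bd: "\<bar>1\<bar> * lam k powr ((sF - s) / 2) \<le> c" if "k \<ge> 1" for k
    using J.lam_pos[of 1] J.lam_mono[of 1 k] that s unfolding c_def by (auto intro!: powr_mono2')
  define I where "I = inclusion e J Jp"
  have I_norm: "norm (I x) \<le> c * norm x" for x
    unfolding I_def inclusion_def by (rule norm_diagonal_map[OF J Jp c bd])
  have "bounded_linear I" unfolding I_def inclusion_def by (rule bounded_linear_diagonal_map[OF J Jp c bd])
  then have lin: "linear I" by (rule bounded_linear.linear)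
  obtain K where K: "K > 0" "\<And>x y. norm (F x - F y) \<le> K * norm (x - y)"
    "\<And>a b c. norm (F a + F b - 2 *\<^sub>R F c) \<le> K * (norm (a + b - 2 *\<^sub>R c) + (norm (a - c))\<^sup>2 + (norm (b - c))\<^sup>2)"
    using C2_bounded_derivs_estimates[OF F] by blast
  define L where "L = K * (c + c\<^sup>2)"
  have L: "K * c \<le> L" "K * c\<^sup>2 \<le> L" "0 \<le> L" using K(1) c by (auto simp: L_def algebra_simps)
  interpret singular_kernel "semigroup lam e Jm J" T "(s + sF) / 2"
    by (rule semigroup_singular_kernel[OF J Jm T s(1-4)])
  have "volterra (semigroup lam e Jm J) T ((s + sF) / 2) (\<lambda>x. F (I x)) L"
  proof
    show "0 \<le> L" by (rule L)
    have I_diff: "norm (I x - I y) \<le> c * norm (x - y)" for x y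
      using I_norm[of "x - y"] by (simp add: linear_diff[OF lin])
    show "norm (F (I x) - F (I y)) \<le> L * norm (x - y)" for x y
    proof -
      have "K * norm (I x - I y) \<le> K * (c * norm (x - y))"
        using K(1) by (intro mult_left_mono I_diff) simp
      then have "norm (F (I x) - F (I y)) \<le> K * (c * norm (x - y))"
        using K(2)[of "I x" "I y"] by linarith
      also have "\<dots> \<le> L * norm (x - y)" using mult_right_mono[OF L(1), of "norm (x - y)"] by (simp add: mult.assoc)
      finally show ?thesis .
    qed
    show "norm (F (I x) + F (I y) - 2 *\<^sub>R F (I z)) \<le> L * (norm (x + y - 2 *\<^sub>R z) + (norm (x - z))\<^sup>2 + (norm (y - z))\<^sup>2)" for x y z
    proof -
      have e: "I x + I y - 2 *\<^sub>R I z = I (x + y - 2 *\<^sub>R z)"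
        by (simp add: linear_diff[OF lin] linear_add[OF lin] linear_scale[OF lin])
      have sq: "(norm (I x - I y))\<^sup>2 \<le> c\<^sup>2 * (norm (x - y))\<^sup>2" for x y
        using power_mono[OF I_diff[of x y], of 2] by (simp add: power_mult_distrib)
      have "norm (F (I x) + F (I y) - 2 *\<^sub>R F (I z)) \<le> K * (norm (I (x + y - 2 *\<^sub>R z)) + (norm (I x - I z))\<^sup>2 + (norm (I y - I z))\<^sup>2)"
        using K(3)[of "I x" "I y" "I z"] by (simp only: e)
      also have "\<dots> \<le> K * (c * norm (x + y - 2 *\<^sub>R z) + c\<^sup>2 * (norm (x - z))\<^sup>2 + c\<^sup>2 * (norm (y - z))\<^sup>2)"
        using K(1) by (intro mult_left_mono add_mono I_norm sq) auto
      also have "\<dots> = K * c * norm (x + y - 2 *\<^sub>R z) + K * c\<^sup>2 * (norm (x - z))\<^sup>2 + K * c\<^sup>2 * (norm (y - z))\<^sup>2"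
        by (simp add: algebra_simps)
      also have "\<dots> \<le> L * norm (x + y - 2 *\<^sub>R z) + L * (norm (x - z))\<^sup>2 + L * (norm (y - z))\<^sup>2"
        by (intro add_mono mult_right_mono L) auto
      finally show ?thesis by (simp add: algebra_simps)
    qed
  qed
  then show ?thesis unfolding I_def by blast
qed

text \<open>Continuity up to \<open>t = 0\<close> comes from uniform approximation by the finite sums of modes, since the
semigroup is bounded from exponent \<open>s\<^sub>0\<close> to exponent \<open>s \<le> s\<^sub>0\<close> uniformly in \<open>t \<ge> 0\<close>.\<close>

lemma
  fixes J :: "'h::real_inner \<Rightarrow> 'a::{real_inner,banach}" and J0 :: "'h \<Rightarrow> 'z::{real_inner,banach}"
  assumes J: "scale lam e s J" and J0: "scale lam e s0 J0" and s: "s \<le> s0"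
  shows initial_continuous: "continuous_on {0..T} (\<lambda>t. semigroup lam e J0 J t u0)"
    and initial_bound: "0 \<le> t \<Longrightarrow> norm (semigroup lam e J0 J t u0) \<le> lam 1 powr ((s - s0) / 2) * norm u0"
    and initial_galerkin: "0 \<le> t \<Longrightarrow> norm (semigroup lam e J0 J t u0 - galerkin_proj e J N (semigroup lam e J0 J t u0))
      \<le> lam (N + 1) powr (- ((s0 - s) / 2)) * norm u0"
proof -
  interpret J: scale lam e s J by fact
  interpret J0: scale lam e s0 J0 by fact
  define c where "c = lam 1 powr ((s - s0) / 2)"
  have c: "0 \<le> c" by (simp add: c_def)
  have exp1: "exp (- t * lam k) \<le> 1" if "k \<ge> 1" "0 \<le> t" for k t
    using that J.lam_pos[of k] by simp
  have bd: "\<bar>exp (- t * lam k)\<bar> * lam k powr ((s - s0) / 2) \<le> c" if "0 \<le> t" "k \<ge> 1" for k t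
  proof -
    have "lam k powr ((s - s0) / 2) \<le> c"
      unfolding c_def using J.lam_pos[of 1] J.lam_mono[of 1 k] that s by (intro powr_mono2') auto
    then show ?thesis using mult_mono[OF exp1[OF that(2,1)], of "lam k powr ((s - s0) / 2)" c] c by simp
  qed
  show nb: "norm (semigroup lam e J0 J t u0) \<le> lam 1 powr ((s - s0) / 2) * norm u0" if "0 \<le> t" for t u0
    unfolding semigroup_def c_def[symmetric] by (rule norm_diagonal_map[OF J0 J c bd[OF that]])
  have pr: "pairing e J k (semigroup lam e J0 J t x) = exp (- t * lam k) * pairing e J0 k x" if "0 \<le> t" "k \<ge> 1" for t k x
    unfolding semigroup_def by (rule pairing_diagonal_map[OF J0 J c bd[OF that(1)] that(2)])
  show "norm (semigroup lam e J0 J t u0 - galerkin_proj e J N (semigroup lam e J0 J t u0))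
      \<le> lam (N + 1) powr (- ((s0 - s) / 2)) * norm u0" if t: "0 \<le> t"
  proof -
    define m where "m k = (if k \<le> N then 0 else exp (- t * lam k))" for k
    have bd': "\<bar>m k\<bar> * lam k powr ((s - s0) / 2) \<le> lam (N + 1) powr (- ((s0 - s) / 2))" if k: "k \<ge> 1" for k
    proof (cases "k \<le> N")
      case False
      have eq: "(s - s0) / 2 = - ((s0 - s) / 2)" by (simp add: minus_divide_left)
      have "lam k powr ((s - s0) / 2) \<le> lam (N + 1) powr (- ((s0 - s) / 2))"
        unfolding eq using J.lam_pos[of "N + 1"] J.lam_mono[of "N + 1" k] False s by (intro powr_mono2') auto
      then have "exp (- t * lam k) * lam k powr ((s - s0) / 2) \<le> 1 * lam (N + 1) powr (- ((s0 - s) / 2))"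
        by (intro mult_mono exp1[OF k t]) auto
      then show ?thesis using False by (simp add: m_def)
    qed (simp add: m_def)
    have "semigroup lam e J0 J t u0 - galerkin_proj e J N (semigroup lam e J0 J t u0) = diagonal_map e J0 J m u0"
    proof (rule J.coef_eqI)
      fix k :: nat assume k: "k \<ge> 1"
      have "pairing e J k (diagonal_map e J0 J m u0) = m k * pairing e J0 k u0"
        by (rule pairing_diagonal_map[OF J0 J _ bd' k]) auto
      then show "pairing e J k (semigroup lam e J0 J t u0 - galerkin_proj e J N (semigroup lam e J0 J t u0))
         = pairing e J k (diagonal_map e J0 J m u0)"
        using k pr[OF t k] by (simp add: J.coef_diff J.pairing_galerkin m_def)
    qed
    then show ?thesis using norm_diagonal_map[OF J0 J _ bd', of u0] by simp
  qed
  show "continuous_on {0..T} (\<lambda>t. semigroup lam e J0 J t u0)"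
  proof (rule uniform_limit_theorem)
    define S where "S n t = (\<Sum>k=1..n. (exp (- t * lam k) * pairing e J0 k u0) *\<^sub>R J (e k))" for n t
    show "\<forall>\<^sub>F n in sequentially. continuous_on {0..T} (S n)"
      unfolding S_def by (intro always_eventually allI continuous_intros)
    have eq: "S n t = semigroup lam e J0 J t (J0.part {1..n} u0)" if "0 \<le> t" for n t
    proof (rule J.coef_eqI)
      fix k :: nat assume k: "k \<ge> 1"
      show "pairing e J k (S n t) = pairing e J k (semigroup lam e J0 J t (J0.part {1..n} u0))"
        using k unfolding S_def pr[OF that k] J0.part_def
        by (subst J.coef_sum_basis, simp, force, simp, subst J0.coef_sum_basis) auto
    qed
    have lin: "linear (semigroup lam e J0 J t)" if "0 \<le> t" for t
      unfolding semigroup_def by (rule bounded_linear.linear[OF bounded_linear_diagonal_map[OF J0 J c bd[OF that]]])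
    show "uniform_limit {0..T} S (\<lambda>t. semigroup lam e J0 J t u0) sequentially"
    proof (rule uniform_limitI)
      fix \<epsilon> :: real assume "0 < \<epsilon>"
      have "(\<lambda>n. c * norm (u0 - J0.part {1..n} u0)) \<longlonglongrightarrow> c * norm (u0 - u0)"
        by (intro tendsto_intros J0.expansion_tendsto)
      then have "\<forall>\<^sub>F n in sequentially. c * norm (u0 - J0.part {1..n} u0) < \<epsilon>"
        using \<open>0 < \<epsilon>\<close> by (intro order_tendstoD) auto
      then show "\<forall>\<^sub>F n in sequentially. \<forall>t\<in>{0..T}. dist (S n t) (semigroup lam e J0 J t u0) < \<epsilon>"
      proof eventually_elim
        fix n assume n: "c * norm (u0 - J0.part {1..n} u0) < \<epsilon>"
        show "\<forall>t\<in>{0..T}. dist (S n t) (semigroup lam e J0 J t u0) < \<epsilon>"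
        proof
          fix t assume t: "t \<in> {0..T}"
          then have t0: "0 \<le> t" by simp
          have "dist (S n t) (semigroup lam e J0 J t u0) = norm (semigroup lam e J0 J t (u0 - J0.part {1..n} u0))"
            unfolding eq[OF t0] dist_norm linear_diff[OF lin[OF t0]] by (rule norm_minus_commute)
          also have "\<dots> \<le> c * norm (u0 - J0.part {1..n} u0)" unfolding c_def by (rule nb[OF t0])
          finally show "dist (S n t) (semigroup lam e J0 J t u0) < \<epsilon>" using n by simp
        qed
      qed
    qed
  qed simp
qed

section \<open>The Wiener integral of an exponential\<close>

lemma step_fun_measurable: "step_fun (xs :: (real \<times> real \<times> real) list) \<in> borel_measurable borel"
proof (induction xs)
  case (Cons y xs)
  obtain a a' c where y: "y = (a, a', c)" by (cases y)
  have e1: "step_fun (y # xs) = (\<lambda>r. indicator {a<..a'} r * c + step_fun xs r)"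
    by (simp add: step_fun_def y fun_eq_iff)
  show ?case unfolding e1 using Cons by measurable
qed (simp add: step_fun_def[abs_def])

locale wiener = prob_space M for M :: "'w measure" +
  fixes G :: "real \<Rightarrow> 'w measure" and b :: "real \<Rightarrow> 'w \<Rightarrow> real"
  assumes filtration: "usual_filtration M G"
    and process: "standard_wiener_process M G b"
begin

lemma sub: "0 \<le> t \<Longrightarrow> subalgebra M (G t)"
  and filtration_mono: "0 \<le> s \<Longrightarrow> s \<le> t \<Longrightarrow> sets (G s) \<subseteq> sets (G t)"
proof -
  note f = filtration[unfolded usual_filtration_def]
  from f[THEN conjunct1] f[THEN conjunct2, THEN conjunct1]
  show "0 \<le> t \<Longrightarrow> subalgebra M (G t)" "0 \<le> s \<Longrightarrow> s \<le> t \<Longrightarrow> sets (G s) \<subseteq> sets (G t)" by auto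
qed

lemma adapted: "0 \<le> s \<Longrightarrow> s \<le> t \<Longrightarrow> b s \<in> borel_measurable (G t)"
proof -
  assume st: "0 \<le> s" "s \<le> t"
  have "b s \<in> borel_measurable (G s)" using process st by (auto simp: standard_wiener_process_def)
  moreover have "subalgebra (G t) (G s)"
    using filtration_mono[OF st] sub[of s] sub[of t] st by (simp add: subalgebra_def)
  ultimately show ?thesis by (rule measurable_from_subalg[rotated])
qed


lemma b_measurable: "0 \<le> t \<Longrightarrow> b t \<in> borel_measurable M"
  using measurable_from_subalg[OF sub adapted[of t t]] by simp

lemma b_zero: "AE \<omega> in M. b 0 \<omega> = 0"
  using process by (simp add: standard_wiener_process_def)

lemma increment_distributed:
  "0 \<le> s \<Longrightarrow> s < t \<Longrightarrow> distributed M lborel (\<lambda>\<omega>. b t \<omega> - b s \<omega>) (normal_density 0 (sqrt (t - s)))"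
  using process by (simp add: standard_wiener_process_def)

text \<open>Stated for a function \<open>h\<close> of the increment, because independence of two random variables is expressed
only for variables with values in the same type: \<open>h\<close> moves the increment to the type of \<open>X\<close>.\<close>

lemma increment_indep:
  assumes "0 \<le> s" "s < t" and X: "X \<in> measurable (G s) N" and h: "h \<in> measurable borel N'"
  shows "indep_var N X N' (\<lambda>\<omega>. h (b t \<omega> - b s \<omega>))"
proof -
  have sp: "space (G s) = space M" using sub[OF assms(1)] by (simp add: subalgebra_def)
  have ind: "indep_set (sets (G s)) (sets (vimage_algebra (space M) (\<lambda>\<omega>. b t \<omega> - b s \<omega>) borel))"
    using process assms by (simp add: standard_wiener_process_def)
  have rv: "X \<in> measurable M N" by (rule measurable_from_subalg[OF sub[OF assms(1)] X])
  have "(\<lambda>\<omega>. b t \<omega> - b s \<omega>) \<in> borel_measurable M"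
    using b_measurable assms by (intro borel_measurable_diff) auto
  then have rv2: "(\<lambda>\<omega>. h (b t \<omega> - b s \<omega>)) \<in> measurable M N'" using h by (rule measurable_compose)
  let ?V = "vimage_algebra (space M) (\<lambda>\<omega>. b t \<omega> - b s \<omega>) borel"
  have s1: "sigma_sets (space M) {X -` A \<inter> space M |A. A \<in> sets N} \<subseteq> sets (G s)"
    unfolding sp[symmetric] by (rule sets.sigma_sets_subset) (use measurable_sets[OF X] in auto)
  have hV: "(\<lambda>\<omega>. h (b t \<omega> - b s \<omega>)) \<in> measurable ?V N'"
    by (rule measurable_compose[OF measurable_vimage_algebra1 h]) simp
  have "sigma_sets (space ?V) {(\<lambda>\<omega>. h (b t \<omega> - b s \<omega>)) -` A \<inter> space ?V |A. A \<in> sets N'} \<subseteq> sets ?V"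
    by (rule sets.sigma_sets_subset) (use measurable_sets[OF hV] in auto)
  then have s2: "sigma_sets (space M) {(\<lambda>\<omega>. h (b t \<omega> - b s \<omega>)) -` A \<inter> space M |A. A \<in> sets N'} \<subseteq> sets ?V"
    by simp
  have "indep_set (sigma_sets (space M) {X -` A \<inter> space M |A. A \<in> sets N})
     (sigma_sets (space M) {(\<lambda>\<omega>. h (b t \<omega> - b s \<omega>)) -` A \<inter> space M |A. A \<in> sets N'})"
    using ind unfolding indep_set_def
    by (rule indep_sets_mono_sets) (use s1 s2 in \<open>auto split: bool.splits\<close>)
  then show ?thesis unfolding indep_var_eq using rv rv2 by simp
qed

lemma increment_moment:
  assumes "0 \<le> s" "s \<le> t"
  shows "integrable M (\<lambda>\<omega>. (b t \<omega> - b s \<omega>) ^ (2 * k))"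
    and "0 < k \<Longrightarrow> expectation (\<lambda>\<omega>. (b t \<omega> - b s \<omega>) ^ (2 * k)) = (t - s) ^ k * (fact (2 * k) / (2 ^ k * fact k))"
proof -
  have "integrable M (\<lambda>\<omega>. (b t \<omega> - b s \<omega>) ^ (2 * k)) \<and> (0 < k \<longrightarrow>
    expectation (\<lambda>\<omega>. (b t \<omega> - b s \<omega>) ^ (2 * k)) = (t - s) ^ k * (fact (2 * k) / (2 ^ k * fact k)))"
  proof (cases "s = t")
    case True
    then show ?thesis by (cases k) simp_all
  next
    case False
    then have st: "s < t" using assms by simp
    then have pos: "0 < sqrt (t - s)" by simp
    have g: "(\<lambda>x::real. x ^ (2 * k)) \<in> borel_measurable lborel" by simp
    note D = increment_distributed[OF assms(1) st]
    note hb = normal_moment_even[OF pos, of 0 k]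
    have "integrable M (\<lambda>\<omega>. (b t \<omega> - b s \<omega>) ^ (2 * k))"
      using distributed_integrable[OF D g] hb by (auto simp: has_bochner_integral_iff)
    moreover have "expectation (\<lambda>\<omega>. (b t \<omega> - b s \<omega>) ^ (2 * k)) = fact (2 * k) / ((2 / (t - s)) ^ k * fact k)"
      using distributed_integral[OF D g] hb st by (auto simp: has_bochner_integral_iff)
    ultimately show ?thesis using st by (simp add: power_divide field_simps)
  qed
  then show "integrable M (\<lambda>\<omega>. (b t \<omega> - b s \<omega>) ^ (2 * k))"
    and "0 < k \<Longrightarrow> expectation (\<lambda>\<omega>. (b t \<omega> - b s \<omega>) ^ (2 * k)) = (t - s) ^ k * (fact (2 * k) / (2 ^ k * fact k))"
    by auto
qed

lemma increment_mean:
  assumes "0 \<le> s" "s \<le> t"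
  shows "integrable M (\<lambda>\<omega>. b t \<omega> - b s \<omega>)" and "expectation (\<lambda>\<omega>. b t \<omega> - b s \<omega>) = 0"
proof -
  have "integrable M (\<lambda>\<omega>. b t \<omega> - b s \<omega>) \<and> expectation (\<lambda>\<omega>. b t \<omega> - b s \<omega>) = 0"
  proof (cases "s = t")
    case False
    then have st: "s < t" using assms by simp
    then have pos: "0 < sqrt (t - s)" by simp
    note D = increment_distributed[OF assms(1) st]
    note hb = normal_moment_odd[OF pos, of 0 0]
    show ?thesis
      using distributed_integrable[OF D, of "\<lambda>x. x"] distributed_integral[OF D, of "\<lambda>x. x"] hb
      by (auto simp: has_bochner_integral_iff)
  qed simp
  then show "integrable M (\<lambda>\<omega>. b t \<omega> - b s \<omega>)" and "expectation (\<lambda>\<omega>. b t \<omega> - b s \<omega>) = 0" by auto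
qed

lemma b_integrable: "0 \<le> t \<Longrightarrow> integrable M (b t)" "0 \<le> t \<Longrightarrow> integrable M (\<lambda>\<omega>. (b t \<omega>)\<^sup>2)"
proof -
  assume t: "0 \<le> t"
  have "AE \<omega> in M. b t \<omega> - b 0 \<omega> = b t \<omega>" using b_zero by eventually_elim simp
  then show "integrable M (b t)"
    using increment_mean(1)[of 0 t] t by (subst integrable_cong_AE[of _ _ "\<lambda>\<omega>. b t \<omega> - b 0 \<omega>"])
      (auto intro!: b_measurable borel_measurable_diff)
  have "AE \<omega> in M. (b t \<omega> - b 0 \<omega>)\<^sup>2 = (b t \<omega>)\<^sup>2" using b_zero by eventually_elim simp
  then show "integrable M (\<lambda>\<omega>. (b t \<omega>)\<^sup>2)"
    using increment_moment(1)[of 0 t 1] t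
    by (subst integrable_cong_AE[of _ _ "\<lambda>\<omega>. (b t \<omega> - b 0 \<omega>)\<^sup>2"])
      (auto intro!: b_measurable borel_measurable_diff borel_measurable_power)
qed

lemma covariance_le:
  assumes "0 \<le> s" "s \<le> t"
  shows "integrable M (\<lambda>\<omega>. b s \<omega> * b t \<omega>)" "expectation (\<lambda>\<omega>. b s \<omega> * b t \<omega>) = s"
proof -
  have sq: "expectation (\<lambda>\<omega>. (b s \<omega>)\<^sup>2) = s"
  proof -
    have "expectation (\<lambda>\<omega>. (b s \<omega>)\<^sup>2) = expectation (\<lambda>\<omega>. (b s \<omega> - b 0 \<omega>)\<^sup>2)"
    proof (rule integral_cong_AE)
      show "AE \<omega> in M. (b s \<omega>)\<^sup>2 = (b s \<omega> - b 0 \<omega>)\<^sup>2" using b_zero by eventually_elim simp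
    qed (use b_measurable assms in \<open>auto intro!: borel_measurable_diff borel_measurable_power\<close>)
    then show ?thesis using increment_moment(2)[of 0 s 1] assms by (simp add: fact_numeral)
  qed
  have cross: "integrable M (\<lambda>\<omega>. b s \<omega> * (b t \<omega> - b s \<omega>)) \<and> expectation (\<lambda>\<omega>. b s \<omega> * (b t \<omega> - b s \<omega>)) = 0"
  proof (cases "s = t")
    case False
    then have st: "s < t" using assms by simp
    have ind: "indep_var borel (b s) borel (\<lambda>\<omega>. b t \<omega> - b s \<omega>)"
      by (rule increment_indep[OF assms(1) st adapted, of _ "\<lambda>x. x"]) (use assms in auto)
    note i = b_integrable(1)[OF assms(1)] increment_mean(1)[OF assms]
    show ?thesis
      using indep_var_lebesgue_integral[OF ind i] indep_var_integrable[OF ind i] increment_mean(2)[OF assms] by simp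
  qed simp
  have eq: "(\<lambda>\<omega>. b s \<omega> * b t \<omega>) = (\<lambda>\<omega>. (b s \<omega>)\<^sup>2 + b s \<omega> * (b t \<omega> - b s \<omega>))"
    by (simp add: fun_eq_iff power2_eq_square algebra_simps)
  show "integrable M (\<lambda>\<omega>. b s \<omega> * b t \<omega>)" "expectation (\<lambda>\<omega>. b s \<omega> * b t \<omega>) = s"
    unfolding eq using cross b_integrable(2)[OF assms(1)] sq by simp_all
qed

lemma covariance:
  assumes "0 \<le> s" "0 \<le> t"
  shows "integrable M (\<lambda>\<omega>. b s \<omega> * b t \<omega>)" "expectation (\<lambda>\<omega>. b s \<omega> * b t \<omega>) = min s t"
  using covariance_le[of s t] covariance_le[of t s] assms
  by (cases "s \<le> t"; simp add: mult.commute)+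

definition valid :: "real \<Rightarrow> (real \<times> real \<times> 'h) list \<Rightarrow> bool" where
  "valid t xs \<longleftrightarrow> (\<forall>(a, a', c)\<in>set xs. 0 \<le> a \<and> a \<le> a' \<and> a' \<le> t)"

lemma valid_simps: "valid t []" "valid t ((a, a', c) # xs) \<longleftrightarrow> 0 \<le> a \<and> a \<le> a' \<and> a' \<le> t \<and> valid t xs"
  "valid t (xs @ ys) \<longleftrightarrow> valid t xs \<and> valid t ys"
  by (simp_all add: valid_def ball_Un)

lemma increments_product:
  assumes "0 \<le> s" "s \<le> s'" "0 \<le> t" "t \<le> t'"
  shows "integrable M (\<lambda>\<omega>. (b s' \<omega> - b s \<omega>) * (b t' \<omega> - b t \<omega>))"
    "integrable lborel (\<lambda>r. indicator {s<..s'} r * indicator {t<..t'} r :: real)"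
    "expectation (\<lambda>\<omega>. (b s' \<omega> - b s \<omega>) * (b t' \<omega> - b t \<omega>))
      = (LINT r|lborel. indicator {s<..s'} r * indicator {t<..t'} r)"
proof -
  have eq: "(\<lambda>\<omega>. (b s' \<omega> - b s \<omega>) * (b t' \<omega> - b t \<omega>))
      = (\<lambda>\<omega>. b s' \<omega> * b t' \<omega> - b s' \<omega> * b t \<omega> - b s \<omega> * b t' \<omega> + b s \<omega> * b t \<omega>)"
    by (simp add: fun_eq_iff algebra_simps)
  have i: "integrable M (\<lambda>\<omega>. b s' \<omega> * b t' \<omega>)" "integrable M (\<lambda>\<omega>. b s' \<omega> * b t \<omega>)"
    "integrable M (\<lambda>\<omega>. b s \<omega> * b t' \<omega>)" "integrable M (\<lambda>\<omega>. b s \<omega> * b t \<omega>)"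
    using assms by (auto intro!: covariance)
  show "integrable M (\<lambda>\<omega>. (b s' \<omega> - b s \<omega>) * (b t' \<omega> - b t \<omega>))" unfolding eq using i by simp
  have ind: "(\<lambda>r. indicator {s<..s'} r * indicator {t<..t'} r :: real) = indicator {max s t<..min s' t'}"
    by (auto simp: indicator_def fun_eq_iff)
  show "integrable lborel (\<lambda>r. indicator {s<..s'} r * indicator {t<..t'} r :: real)"
    unfolding ind by (cases "max s t \<le> min s' t'") (auto simp: integrable_indicator_iff)
  have "(LINT r|lborel. indicator {s<..s'} r * indicator {t<..t'} r) = max 0 (min s' t' - max s t)"
    unfolding ind by (cases "max s t \<le> min s' t'") (auto simp: measure_def)
  moreover have "expectation (\<lambda>\<omega>. (b s' \<omega> - b s \<omega>) * (b t' \<omega> - b t \<omega>)) = min s' t' - min s' t - min s t' + min s t"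
    unfolding eq using i assms by (simp add: covariance)
  ultimately show "expectation (\<lambda>\<omega>. (b s' \<omega> - b s \<omega>) * (b t' \<omega> - b t \<omega>))
      = (LINT r|lborel. indicator {s<..s'} r * indicator {t<..t'} r)"
    using assms by (auto simp: min_def max_def)
qed

text \<open>The isometry for step functions with overlapping intervals. It is bilinear in the two lists of steps, so
it reduces to the covariance of two increments, the length of the intersection of their intervals.\<close>

lemma isometry1:
  fixes ys :: "(real \<times> real \<times> real) list"
  assumes "0 \<le> s" "s \<le> s'" "valid t ys"
  shows "integrable M (\<lambda>\<omega>. (b s' \<omega> - b s \<omega>) * step_integral b ys \<omega>) \<and>
    integrable lborel (\<lambda>r. indicator {s<..s'} r * step_fun ys r) \<and>
    expectation (\<lambda>\<omega>. (b s' \<omega> - b s \<omega>) * step_integral b ys \<omega>)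
      = (LINT r|lborel. indicator {s<..s'} r * step_fun ys r)"
  using assms(3)
proof (induction ys)
  case Nil
  then show ?case by (simp add: step_integral_def step_fun_def)
next
  case (Cons y ys)
  obtain a a' c where y: "y = (a, a', c)" by (cases y)
  note ip = increments_product[OF assms(1,2), of a a']
  have a: "0 \<le> a" "a \<le> a'" "valid t ys" using Cons(2) by (auto simp: y valid_simps)
  have e1: "(\<lambda>\<omega>. (b s' \<omega> - b s \<omega>) * step_integral b (y # ys) \<omega>)
     = (\<lambda>\<omega>. c * ((b s' \<omega> - b s \<omega>) * (b a' \<omega> - b a \<omega>)) + (b s' \<omega> - b s \<omega>) * step_integral b ys \<omega>)"
    by (simp add: step_integral_def y fun_eq_iff algebra_simps)
  have e2: "(\<lambda>r. indicator {s<..s'} r * step_fun (y # ys) r)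
     = (\<lambda>r. c * (indicator {s<..s'} r * indicator {a<..a'} r) + indicator {s<..s'} r * step_fun ys r)"
    by (simp add: step_fun_def y fun_eq_iff algebra_simps)
  show ?case
    unfolding e1 e2 using Cons(1)[OF a(3)] ip[OF a(1,2)] by simp
qed

lemma isometry2:
  fixes xs ys :: "(real \<times> real \<times> real) list"
  assumes "valid t xs" "valid t ys"
  shows "integrable M (\<lambda>\<omega>. step_integral b xs \<omega> * step_integral b ys \<omega>) \<and>
    integrable lborel (\<lambda>r. step_fun xs r * step_fun ys r) \<and>
    expectation (\<lambda>\<omega>. step_integral b xs \<omega> * step_integral b ys \<omega>)
      = (LINT r|lborel. step_fun xs r * step_fun ys r)"
  using assms(1)
proof (induction xs)
  case Nil
  then show ?case by (simp add: step_integral_def step_fun_def)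
next
  case (Cons y xs)
  obtain a a' c where y: "y = (a, a', c)" by (cases y)
  have a: "0 \<le> a" "a \<le> a'" "valid t xs" using Cons(2) by (auto simp: y valid_simps)
  note i1 = isometry1[OF a(1,2) assms(2)]
  have e1: "(\<lambda>\<omega>. step_integral b (y # xs) \<omega> * step_integral b ys \<omega>)
     = (\<lambda>\<omega>. c * ((b a' \<omega> - b a \<omega>) * step_integral b ys \<omega>) + step_integral b xs \<omega> * step_integral b ys \<omega>)"
    by (simp add: step_integral_def y fun_eq_iff algebra_simps)
  have e2: "(\<lambda>r. step_fun (y # xs) r * step_fun ys r)
     = (\<lambda>r. c * (indicator {a<..a'} r * step_fun ys r) + step_fun xs r * step_fun ys r)"
    by (simp add: step_fun_def y fun_eq_iff algebra_simps)
  show ?case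
    unfolding e1 e2 using Cons(1)[OF a(3)] i1 by simp
qed

definition neg_steps :: "(real \<times> real \<times> real) list \<Rightarrow> (real \<times> real \<times> real) list" where
  "neg_steps = map (\<lambda>(a, a', c). (a, a', - c))"

lemma neg_steps: "valid t (neg_steps xs) \<longleftrightarrow> valid t xs"
  "step_fun (xs @ neg_steps ys) r = step_fun xs r - step_fun ys r"
  "step_integral b (xs @ neg_steps ys) \<omega> = step_integral b xs \<omega> - step_integral b ys \<omega>"
  unfolding neg_steps_def valid_def step_fun_def step_integral_def
  by (induction ys) (auto split: prod.splits simp: algebra_simps)

lemma isometry_diff:
  fixes xs ys :: "(real \<times> real \<times> real) list"
  assumes "valid t xs" "valid t ys"
  shows "(\<integral>\<^sup>+\<omega>. ennreal ((step_integral b xs \<omega> - step_integral b ys \<omega>)\<^sup>2) \<partial>M)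
    = (\<integral>\<^sup>+r. ennreal ((step_fun xs r - step_fun ys r)\<^sup>2) \<partial>lborel)"
proof -
  let ?z = "xs @ neg_steps ys"
  have v: "valid t ?z" using assms by (simp add: valid_simps neg_steps)
  note i = isometry2[OF v v]
  have "(\<integral>\<^sup>+\<omega>. ennreal ((step_integral b ?z \<omega>)\<^sup>2) \<partial>M) = ennreal (expectation (\<lambda>\<omega>. (step_integral b ?z \<omega>)\<^sup>2))"
    using i by (intro nn_integral_eq_integral) (auto simp: power2_eq_square)
  also have "\<dots> = ennreal (LINT r|lborel. (step_fun ?z r)\<^sup>2)"
    using i by (simp add: power2_eq_square)
  also have "\<dots> = (\<integral>\<^sup>+r. ennreal ((step_fun ?z r)\<^sup>2) \<partial>lborel)"
    using i by (intro nn_integral_eq_integral[symmetric]) (auto simp: power2_eq_square)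
  finally show ?thesis by (simp add: neg_steps)
qed

lemma step_integral_measurable:
  fixes xs :: "(real \<times> real \<times> real) list"
  shows "valid t xs \<Longrightarrow> step_integral b xs \<in> borel_measurable M"
proof (induction xs)
  case Nil
  then show ?case by (simp add: step_integral_def[abs_def])
next
  case (Cons y xs)
  obtain a a' c where y: "y = (a, a', c)" by (cases y)
  have e1: "step_integral b (y # xs) = (\<lambda>\<omega>. (b a' \<omega> - b a \<omega>) * c + step_integral b xs \<omega>)"
    by (simp add: step_integral_def y fun_eq_iff)
  show ?case unfolding e1 using Cons
    by (auto simp: y valid_simps intro!: borel_measurable_add borel_measurable_times borel_measurable_diff b_measurable)
qed


lemma step_fun_support: "valid t xs \<Longrightarrow> \<not> (0 < r \<and> r \<le> t) \<Longrightarrow> step_fun (xs :: (real \<times> real \<times> real) list) r = 0"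
proof (induction xs)
  case (Cons y xs)
  obtain a a' c where y: "y = (a, a', c)" by (cases y)
  show ?case using Cons by (auto simp: step_fun_def y valid_simps indicator_def)
qed (simp add: step_fun_def)

text \<open>By the isometry any step function near \<open>f\<close> has a step integral near \<open>X\<close>, whichever approximating
sequence was used to define \<open>X\<close>. The factor 4 comes from using \<open>(x - z)\<^sup>2 \<le> 2 (x - y)\<^sup>2 + 2 (y - z)\<^sup>2\<close> twice.\<close>

lemma wiener_integral_error:
  fixes X :: "'w \<Rightarrow> real"
  assumes X: "is_wiener_integral M b t f X" and ys: "valid t ys" and f[measurable]: "f \<in> borel_measurable borel"
  shows "(\<integral>\<^sup>+\<omega>. ennreal ((X \<omega> - step_integral b ys \<omega>)\<^sup>2) \<partial>M)
    \<le> 4 * (\<integral>\<^sup>+r\<in>{0..t}. ennreal ((f r - step_fun ys r)\<^sup>2) \<partial>lborel)" (is "?l \<le> 4 * ?E")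
proof -
  obtain xs :: "nat \<Rightarrow> (real \<times> real \<times> real) list" where
    Xm[measurable]: "X \<in> borel_measurable M" and v: "\<And>n. valid t (xs n)"
    and e: "(\<lambda>n. \<integral>\<^sup>+r\<in>{0..t}. ennreal ((f r - step_fun (xs n) r)\<^sup>2) \<partial>lborel) \<longlonglongrightarrow> 0" (is "?e \<longlonglongrightarrow> 0")
    and d: "(\<lambda>n. \<integral>\<^sup>+\<omega>. ennreal ((X \<omega> - step_integral b (xs n) \<omega>)\<^sup>2) \<partial>M) \<longlonglongrightarrow> 0" (is "?d \<longlonglongrightarrow> 0")
    using X unfolding is_wiener_integral_def valid_def by auto
  note [measurable] = step_integral_measurable[OF ys] step_integral_measurable[OF v] step_fun_measurable
  have sq: "ennreal ((x - z)\<^sup>2) \<le> 2 * ennreal ((x - y)\<^sup>2) + 2 * ennreal ((y - z)\<^sup>2)" for x y z :: real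
  proof -
    have "(x - z)\<^sup>2 \<le> 2 * (x - y)\<^sup>2 + 2 * (y - z)\<^sup>2"
      using sum_squares_bound[of "x - y" "y - z"] by (simp add: power2_eq_square algebra_simps)
    then have "ennreal ((x - z)\<^sup>2) \<le> ennreal (2 * (x - y)\<^sup>2 + 2 * (y - z)\<^sup>2)" by (rule ennreal_leI)
    then show ?thesis by (simp add: ennreal_plus ennreal_mult)
  qed
  have "?l \<le> 2 * ?d n + (4 * ?e n + 4 * ?E)" for n
  proof -
    have "?l \<le> (\<integral>\<^sup>+\<omega>. 2 * ennreal ((X \<omega> - step_integral b (xs n) \<omega>)\<^sup>2)
        + 2 * ennreal ((step_integral b (xs n) \<omega> - step_integral b ys \<omega>)\<^sup>2) \<partial>M)"
      by (intro nn_integral_mono sq)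
    also have "\<dots> = 2 * ?d n + 2 * (\<integral>\<^sup>+\<omega>. ennreal ((step_integral b (xs n) \<omega> - step_integral b ys \<omega>)\<^sup>2) \<partial>M)"
      by (simp add: nn_integral_add nn_integral_cmult)
    also have "(\<integral>\<^sup>+\<omega>. ennreal ((step_integral b (xs n) \<omega> - step_integral b ys \<omega>)\<^sup>2) \<partial>M)
      = (\<integral>\<^sup>+r. ennreal ((step_fun (xs n) r - step_fun ys r)\<^sup>2) \<partial>lborel)"
      by (rule isometry_diff[OF v ys])
    also have "\<dots> \<le> (\<integral>\<^sup>+r. 2 * (ennreal ((f r - step_fun (xs n) r)\<^sup>2) * indicator {0..t} r)
        + 2 * (ennreal ((f r - step_fun ys r)\<^sup>2) * indicator {0..t} r) \<partial>lborel)"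
    proof (rule nn_integral_mono)
      fix r
      show "ennreal ((step_fun (xs n) r - step_fun ys r)\<^sup>2) \<le> 2 * (ennreal ((f r - step_fun (xs n) r)\<^sup>2) * indicator {0..t} r)
        + 2 * (ennreal ((f r - step_fun ys r)\<^sup>2) * indicator {0..t} r)"
        using sq[of "step_fun (xs n) r" "step_fun ys r" "f r"] step_fun_support[OF v, of r] step_fun_support[OF ys, of r]
        by (auto simp: indicator_def power2_commute)
    qed
    also have "\<dots> = 2 * ?e n + 2 * ?E"
      by (simp add: nn_integral_add nn_integral_cmult)
    finally have "?l \<le> 2 * ?d n + 2 * (2 * ?e n + 2 * ?E)" by (simp add: add_left_mono mult_left_mono)
    also have "\<dots> = 2 * ?d n + (4 * ?e n + 4 * ?E)"
      by (simp add: distrib_left mult.assoc[symmetric])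
    finally show ?thesis .
  qed
  moreover have "(\<lambda>n. 2 * ?d n + (4 * ?e n + 4 * ?E)) \<longlonglongrightarrow> 2 * 0 + (4 * 0 + 4 * ?E)"
    by (intro tendsto_add ennreal_tendsto_cmult d e tendsto_const) auto
  ultimately show ?thesis by (intro LIMSEQ_le_const) auto
qed

end

text \<open>The left point Riemann sum, on the uniform grid with \<open>n\<close> steps, of the Wiener integral
\<open>\<integral>\<^sub>0\<^sup>t e\<^bsup>-(t-r)l\<^esup> df(r)\<close>, which is the value at time \<open>t\<close> of an Ornstein-Uhlenbeck process of rate \<open>l\<close> driven by \<open>f\<close>.\<close>

definition ou_sum :: "real \<Rightarrow> real \<Rightarrow> nat \<Rightarrow> (real \<Rightarrow> real) \<Rightarrow> real" where
  "ou_sum l t n f = (\<Sum>i<n. exp (- (t - t * (i / n)) * l) * (f (t * (Suc i / n)) - f (t * (i / n))))"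

lemma exp_minus_lipschitz:
  fixes x y :: real
  assumes "0 \<le> x" "0 \<le> y" shows "\<bar>exp (- x) - exp (- y)\<bar> \<le> \<bar>x - y\<bar>"
proof -
  have *: "exp (- x) - exp (- y) \<le> y - x" if "0 \<le> x" "x \<le> y" for x y :: real
  proof -
    have "exp (- x) - exp (- y) = exp (- x) * (1 - exp (- (y - x)))"
      by (simp add: right_diff_distrib exp_add[symmetric])
    also have "\<dots> \<le> 1 * (1 - exp (- (y - x)))" using that by (intro mult_right_mono) auto
    also have "\<dots> \<le> y - x"
    proof -
      have "1 - exp (- z) \<le> z" for z :: real using exp_ge_add_one_self[of "- z"] by linarith
      from this[of "y - x"] show ?thesis by simp
    qed
    finally show ?thesis .
  qed
  show ?thesis using *[of x y] *[of y x] assms by (cases "x \<le> y") auto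
qed

context wiener
begin

text \<open>The integrand is Lipschitz continuous, so the mean square error of the Riemann sum with \<open>n\<close> steps is
\<open>O(n\<^bsup>-2\<^esup>)\<close>. This is summable in \<open>n\<close>, hence the Riemann sums converge almost surely along the whole
sequence. They express the Wiener integral as a limit of explicit functions of the path, which is all
that is needed both for its size and for its behaviour under a change of sign of the path.\<close>

lemma wiener_integral_ou:
  assumes t: "0 \<le> t" and l: "0 \<le> l" and X: "is_wiener_integral M b t (\<lambda>r. c * exp (- (t - r) * l)) X"
  shows "AE \<omega> in M. (\<lambda>n. c * ou_sum l t (Suc n) (\<lambda>s. b s \<omega>)) \<longlonglongrightarrow> X \<omega>"
proof -
  define f where "f r = c * exp (- (t - r) * l)" for r
  define p :: "nat \<Rightarrow> nat \<Rightarrow> real" where "p n i = t * (real i / real n)" for n i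
  define ys where "ys n = map (\<lambda>i. (p n i, p n (Suc i), f (p n i))) [0..<n]" for n
  have p0: "p n 0 = 0" and pn: "0 < n \<Longrightarrow> p n n = t" and p_mono: "i \<le> j \<Longrightarrow> p n i \<le> p n j" for n i j
    using t by (auto simp: p_def intro!: mult_left_mono divide_right_mono)
  have p_step: "p n (Suc i) - p n i = t / n" for n i
    by (simp add: p_def add_divide_distrib distrib_left)
  have p_in: "0 \<le> p n i \<and> p n i \<le> t" if "i \<le> n" "0 < n" for n i
    using p_mono[of 0 i n] p_mono[OF that(1), of n] pn[OF that(2)] p0[of n] by auto
  have v: "valid t (ys n)" for n
  proof (cases "n = 0")
    case False
    then show ?thesis unfolding valid_def ys_def using p_in[of _ n] p_mono[of _ "Suc _" n] by fastforce
  qed (simp add: ys_def valid_def)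
  have SI: "step_integral b (ys n) \<omega> = c * ou_sum l t n (\<lambda>s. b s \<omega>)" for n \<omega>
    unfolding step_integral_def ys_def ou_sum_def f_def p_def
    by (simp add: comp_def interv_sum_list_conv_sum_set_nat atLeast0LessThan sum_distrib_left algebra_simps)
  have SF: "step_fun (ys n) r = (\<Sum>i<n. indicator {p n i<..p n (Suc i)} r * f (p n i))" for n r
    unfolding step_fun_def ys_def by (simp add: comp_def interv_sum_list_conv_sum_set_nat atLeast0LessThan)
  define D where "D = \<bar>c\<bar> * l * t"
  have err: "\<bar>f r - step_fun (ys n) r\<bar> \<le> D / n" if r: "0 < r" "r \<le> t" and n: "0 < n" for r n
  proof -
    have one: "(\<Sum>i<n. indicator {p n i<..p n (Suc i)} r) = (1 :: real)"
    proof -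
      have "(\<Sum>i<n. indicator {p n i<..p n (Suc i)} r) = (\<Sum>i<n. of_bool (r \<le> p n (Suc i)) - of_bool (r \<le> p n i) :: real)"
        by (rule sum.cong) (use p_mono[of _ "Suc _" n] in \<open>auto simp: indicator_def intro: order_trans\<close>)
      also have "\<dots> = of_bool (r \<le> p n n) - of_bool (r \<le> p n 0)" by (rule sum_lessThan_telescope)
      finally show ?thesis using r n by (simp add: p0 pn)
    qed
    have "f r - step_fun (ys n) r = f r * (\<Sum>i<n. indicator {p n i<..p n (Suc i)} r) - step_fun (ys n) r"
      unfolding one by simp
    also have "\<dots> = (\<Sum>i<n. indicator {p n i<..p n (Suc i)} r * (f r - f (p n i)))"
      unfolding SF sum_distrib_left sum_subtractf[symmetric] by (rule sum.cong) (auto simp: algebra_simps)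
    also have "\<bar>\<dots>\<bar> \<le> (\<Sum>i<n. \<bar>indicator {p n i<..p n (Suc i)} r * (f r - f (p n i))\<bar>)" by (rule sum_abs)
    also have "\<dots> \<le> (\<Sum>i<n. indicator {p n i<..p n (Suc i)} r * (D / n))"
    proof (rule sum_mono)
      fix i assume "i \<in> {..<n}"
      show "\<bar>indicator {p n i<..p n (Suc i)} r * (f r - f (p n i))\<bar> \<le> indicator {p n i<..p n (Suc i)} r * (D / n)"
      proof (cases "r \<in> {p n i<..p n (Suc i)}")
        case True
        have "\<bar>exp (- ((t - r) * l)) - exp (- ((t - p n i) * l))\<bar> \<le> \<bar>(t - r) * l - (t - p n i) * l\<bar>"
          using r True l by (intro exp_minus_lipschitz mult_nonneg_nonneg) auto
        also have "\<dots> = l * (r - p n i)"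
          using True l by (subst left_diff_distrib[symmetric]) (auto simp: abs_mult)
        also have "\<dots> \<le> l * (t / n)" using True p_step[of n i] l by (intro mult_left_mono) auto
        finally have "\<bar>c\<bar> * \<bar>exp (- ((t - r) * l)) - exp (- ((t - p n i) * l))\<bar> \<le> \<bar>c\<bar> * (l * (t / n))"
          by (intro mult_left_mono) auto
        then have "\<bar>f r - f (p n i)\<bar> \<le> D / n"
          unfolding f_def right_diff_distrib[symmetric] abs_mult D_def mult_minus_left by (simp only: times_divide_eq_right mult.assoc)
        then show ?thesis using True by simp
      qed simp
    qed
    also have "\<dots> = D / n" unfolding sum_distrib_right[symmetric] one by simp
    finally show ?thesis .
  qed
  have fm: "f \<in> borel_measurable borel" unfolding f_def by measurable
  have bound: "(\<integral>\<^sup>+\<omega>. ennreal ((X \<omega> - step_integral b (ys (Suc n)) \<omega>)\<^sup>2) \<partial>M) \<le> ennreal (4 * (D\<^sup>2 * t) * (1 / (real (Suc n))\<^sup>2))" for n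
  proof -
    have "(\<integral>\<^sup>+r\<in>{0..t}. ennreal ((f r - step_fun (ys (Suc n)) r)\<^sup>2) \<partial>lborel)
       \<le> (\<integral>\<^sup>+r. ennreal ((D / Suc n)\<^sup>2) * indicator {0..t} r \<partial>lborel)"
    proof (rule nn_integral_mono_AE)
      show "AE r in lborel. ennreal ((f r - step_fun (ys (Suc n)) r)\<^sup>2) * indicator {0..t} r
         \<le> ennreal ((D / Suc n)\<^sup>2) * indicator {0..t} r"
        using AE_lborel_singleton[of 0]
      proof eventually_elim
        fix r :: real assume "r \<noteq> 0"
        show "ennreal ((f r - step_fun (ys (Suc n)) r)\<^sup>2) * indicator {0..t} r \<le> ennreal ((D / Suc n)\<^sup>2) * indicator {0..t} r"
        proof (cases "r \<in> {0..t}")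
          case True
          then have "\<bar>f r - step_fun (ys (Suc n)) r\<bar>\<^sup>2 \<le> (D / Suc n)\<^sup>2"
            using \<open>r \<noteq> 0\<close> by (intro power_mono err) auto
          then show ?thesis using True by (simp add: ennreal_leI)
        qed simp
      qed
    qed
    also have "\<dots> = ennreal ((D / Suc n)\<^sup>2 * t)"
      using t by (simp add: nn_integral_cmult_indicator ennreal_mult)
    finally have *: "(\<integral>\<^sup>+r\<in>{0..t}. ennreal ((f r - step_fun (ys (Suc n)) r)\<^sup>2) \<partial>lborel) \<le> ennreal ((D / Suc n)\<^sup>2 * t)" .
    have "(\<integral>\<^sup>+\<omega>. ennreal ((X \<omega> - step_integral b (ys (Suc n)) \<omega>)\<^sup>2) \<partial>M) \<le> 4 * ennreal ((D / Suc n)\<^sup>2 * t)"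
      using wiener_integral_error[OF X[folded f_def] v fm, of "Suc n"] mult_left_mono[OF *, of 4] by (rule order_trans) simp
    also have "\<dots> = ennreal (4 * ((D / Suc n)\<^sup>2 * t))" using t by (subst ennreal_mult) auto
    finally show ?thesis by (simp add: power_divide)
  qed
  have Xm: "X \<in> borel_measurable M" using X by (simp add: is_wiener_integral_def)
  note [measurable] = Xm step_integral_measurable[OF v]
  have summ: "summable (\<lambda>n. 4 * (D\<^sup>2 * t) * (1 / (real (Suc n))\<^sup>2))"
    using inverse_power_summable[of 2, where 'a = real] 
    by (intro summable_mult) (subst summable_Suc_iff, simp add: inverse_eq_divide)
  have "(\<integral>\<^sup>+\<omega>. (\<Sum>n. ennreal ((X \<omega> - step_integral b (ys (Suc n)) \<omega>)\<^sup>2)) \<partial>M)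
     = (\<Sum>n. \<integral>\<^sup>+\<omega>. ennreal ((X \<omega> - step_integral b (ys (Suc n)) \<omega>)\<^sup>2) \<partial>M)"
    by (rule nn_integral_suminf) measurable
  also have "\<dots> \<le> (\<Sum>n. ennreal (4 * (D\<^sup>2 * t) * (1 / (real (Suc n))\<^sup>2)))"
    by (intro suminf_le bound) auto
  also have "\<dots> = ennreal (\<Sum>n. 4 * (D\<^sup>2 * t) * (1 / (real (Suc n))\<^sup>2))"
    using t by (intro suminf_ennreal2 summ) auto
  also have "\<dots> < \<infinity>" by simp
  finally have "AE \<omega> in M. (\<Sum>n. ennreal ((X \<omega> - step_integral b (ys (Suc n)) \<omega>)\<^sup>2)) \<noteq> \<infinity>"
    by (intro nn_integral_PInf_AE) (auto simp: less_top)
  then show ?thesis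
  proof eventually_elim
    fix \<omega> assume "(\<Sum>n. ennreal ((X \<omega> - step_integral b (ys (Suc n)) \<omega>)\<^sup>2)) \<noteq> \<infinity>"
    then have "summable (\<lambda>n. (X \<omega> - step_integral b (ys (Suc n)) \<omega>)\<^sup>2)"
      by (intro summable_suminf_not_top) auto
    then have "(\<lambda>n. sqrt ((X \<omega> - step_integral b (ys (Suc n)) \<omega>)\<^sup>2)) \<longlonglongrightarrow> sqrt 0"
      by (intro tendsto_real_sqrt summable_LIMSEQ_zero)
    then have "(\<lambda>n. X \<omega> - step_integral b (ys (Suc n)) \<omega>) \<longlonglongrightarrow> 0"
      by (simp add: tendsto_rabs_zero_iff)
    from tendsto_diff[OF tendsto_const[of "X \<omega>"] this]
    show "(\<lambda>n. c * ou_sum l t (Suc n) (\<lambda>s. b s \<omega>)) \<longlonglongrightarrow> X \<omega>" by (simp add: SI)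
  qed
qed

text \<open>Reduces Wiener integrals with values in the Hilbert space to scalar ones, by applying the functional to
the coefficients of the approximating step functions.\<close>

lemma wiener_integral_inner:
  fixes X :: "'w \<Rightarrow> 'h::{real_inner, second_countable_topology}"
  assumes X: "is_wiener_integral M b t f X" and v: "norm v = 1"
  shows "is_wiener_integral M b t (\<lambda>r. f r \<bullet> v) (\<lambda>\<omega>. X \<omega> \<bullet> v)"
proof -
  obtain xs :: "nat \<Rightarrow> (real \<times> real \<times> 'h) list" where
    Xm[measurable]: "X \<in> borel_measurable M" and vd: "\<And>n. valid t (xs n)"
    and e: "(\<lambda>n. \<integral>\<^sup>+r\<in>{0..t}. ennreal ((norm (f r - step_fun (xs n) r))\<^sup>2) \<partial>lborel) \<longlonglongrightarrow> 0"
    and d: "(\<lambda>n. \<integral>\<^sup>+\<omega>. ennreal ((norm (X \<omega> - step_integral b (xs n) \<omega>))\<^sup>2) \<partial>M) \<longlonglongrightarrow> 0"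
    using X unfolding is_wiener_integral_def valid_def by auto
  define ys where "ys n = map (\<lambda>(a, a', c). (a, a', c \<bullet> v)) (xs n)" for n
  have SF: "step_fun (ys n) r = step_fun (xs n) r \<bullet> v" for n r
  proof -
    have "step_fun (map (\<lambda>(a, a', c). (a, a', c \<bullet> v)) zs) r = step_fun zs r \<bullet> v" for zs :: "(real \<times> real \<times> 'h) list"
      unfolding step_fun_def by (induction zs) (auto simp: inner_add_left split: prod.splits)
    then show ?thesis by (simp add: ys_def)
  qed
  have SI: "step_integral b (ys n) \<omega> = step_integral b (xs n) \<omega> \<bullet> v" for n \<omega>
  proof -
    have "step_integral b (map (\<lambda>(a, a', c). (a, a', c \<bullet> v)) zs) \<omega> = step_integral b zs \<omega> \<bullet> v" for zs :: "(real \<times> real \<times> 'h) list"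
      unfolding step_integral_def by (induction zs) (auto simp: inner_add_left split: prod.splits)
    then show ?thesis by (simp add: ys_def)
  qed
  have le: "(norm (x \<bullet> v))\<^sup>2 \<le> (norm x)\<^sup>2" for x
    using Cauchy_Schwarz_ineq2[of x v] v by (intro power_mono) auto
  show ?thesis unfolding is_wiener_integral_def
  proof (intro conjI exI[of _ ys] allI)
    show "\<forall>(a, a', c)\<in>set (ys n). 0 \<le> a \<and> a \<le> a' \<and> a' \<le> t" for n
      using vd[of n] unfolding ys_def valid_def by auto
    show "(\<lambda>n. \<integral>\<^sup>+r\<in>{0..t}. ennreal ((norm (f r \<bullet> v - step_fun (ys n) r))\<^sup>2) \<partial>lborel) \<longlonglongrightarrow> 0"
      unfolding SF inner_diff_left[symmetric]
      by (rule tendsto_sandwich[OF _ _ tendsto_const e])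
        (auto intro!: always_eventually nn_integral_mono mult_right_mono ennreal_leI le simp del: real_norm_def)
    show "(\<lambda>n. \<integral>\<^sup>+\<omega>. ennreal ((norm (X \<omega> \<bullet> v - step_integral b (ys n) \<omega>))\<^sup>2) \<partial>M) \<longlonglongrightarrow> 0"
      unfolding SI inner_diff_left[symmetric]
      by (rule tendsto_sandwich[OF _ _ tendsto_const d])
        (auto intro!: always_eventually nn_integral_mono ennreal_leI le simp del: real_norm_def)
    show "(\<lambda>\<omega>. X \<omega> \<bullet> v) \<in> borel_measurable M" by measurable
  qed
qed

end

section \<open>Uniform bounds for Ornstein-Uhlenbeck sums\<close>

text \<open>Chaining: \<open>f t\<close> is reached from \<open>f s\<close> through the dyadic points below \<open>s\<close> and \<open>t\<close> at the level \<open>n\<close> with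
\<open>t - s \<approx> T / 2\<^sup>n\<close>. At this level the two points agree or are neighbours, and the refinements form a geometric
series with sum \<open>1 / (2\<^sup>\<alpha> - 1)\<close>, which occurs twice.\<close>

lemma dyadic_holder:
  fixes f :: "real \<Rightarrow> real"
  assumes T: "0 < T" and \<alpha>: "0 < \<alpha>" and K: "0 \<le> K" and cont: "continuous_on {0..T} f"
    and incr: "\<And>n i. i < 2 ^ n \<Longrightarrow> \<bar>f (T * real (Suc i) / 2 ^ n) - f (T * real i / 2 ^ n)\<bar> \<le> K * 2 powr (- \<alpha> * n)"
    and s: "s \<in> {0..T}" and t: "t \<in> {0..T}"
  shows "\<bar>f t - f s\<bar> \<le> (2 / (2 powr \<alpha> - 1) + 1) * (2 / T) powr \<alpha> * K * \<bar>t - s\<bar> powr \<alpha>"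
proof -
  define c where "c = 1 / (2 powr \<alpha> - 1)"
  have two: "1 < 2 powr \<alpha>" using \<alpha> by simp
  then have c: "0 < c" by (simp add: c_def)
  \<comment> \<open>\<open>d n t\<close> is the largest point of the dyadic grid of level \<open>n\<close> that is not beyond \<open>t\<close>.\<close>
  define j where "j n t = nat \<lfloor>t * 2 ^ n / T\<rfloor>" for n t
  define d where "d n t = T * real (j n t) / 2 ^ n" for n t
  have jb: "real (j n t) \<le> t * 2 ^ n / T" "t * 2 ^ n / T < real (j n t) + 1" if "t \<in> {0..T}" for n t
  proof -
    have "0 \<le> t * 2 ^ n / T" using that T by auto
    then have "real (j n t) = of_int \<lfloor>t * 2 ^ n / T\<rfloor>" by (simp add: j_def)
    then show "real (j n t) \<le> t * 2 ^ n / T" "t * 2 ^ n / T < real (j n t) + 1" by linarith+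
  qed
  have jle: "j n t \<le> 2 ^ n" if "t \<in> {0..T}" for n t
  proof -
    have "t * 2 ^ n / T \<le> 2 ^ n" using that T by (simp add: field_simps mult_right_mono)
    then have "real (j n t) \<le> 2 ^ n" using jb(1)[OF that, of n] by linarith
    then show ?thesis by (metis of_nat_le_iff of_nat_numeral of_nat_power)
  qed
  have d_in: "d n t \<in> {0..T}" and d_close: "t - d n t \<le> T / 2 ^ n" "d n t \<le> t" if "t \<in> {0..T}" for n t
  proof -
    have "real (j n t) \<le> 2 ^ n" using jle[OF that, of n] by (metis of_nat_le_iff of_nat_numeral of_nat_power)
    then show "d n t \<in> {0..T}" using T by (auto simp: d_def field_simps)
    have "t < T * (real (j n t) + 1) / 2 ^ n" "T * real (j n t) / 2 ^ n \<le> t"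
      using jb[OF that, of n] T by (simp_all add: field_simps)
    then show "t - d n t \<le> T / 2 ^ n" "d n t \<le> t"
      by (simp_all add: d_def distrib_left add_divide_distrib)
  qed
  have refine: "\<bar>f (d (Suc n) t) - f (d n t)\<bar> \<le> K * 2 powr (- \<alpha> * Suc n)" if t: "t \<in> {0..T}" for n t
  proof -
    define x where "x = t * 2 ^ n / T"
    have "real (j (Suc n) t) \<le> 2 * x" "2 * x < real (j (Suc n) t) + 1" "real (j n t) \<le> x" "x < real (j n t) + 1"
    proof -
      have "t * 2 ^ Suc n / T = 2 * x" by (simp add: x_def)
      then show "real (j (Suc n) t) \<le> 2 * x" "2 * x < real (j (Suc n) t) + 1" "real (j n t) \<le> x" "x < real (j n t) + 1"
        using jb[OF t, of n] jb[OF t, of "Suc n"] unfolding x_def by metis+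
    qed
    then have "2 * real (j n t) < real (j (Suc n) t) + 1" "real (j (Suc n) t) < 2 * (real (j n t) + 1)"
      by simp_all
    then have "real (2 * j n t) < real (j (Suc n) t + 1)" "real (j (Suc n) t) < real (2 * (j n t + 1))"
      by simp_all
    then have "2 * j n t < j (Suc n) t + 1" "j (Suc n) t < 2 * (j n t + 1)"
      by (simp_all only: of_nat_less_iff)
    then have "j (Suc n) t = 2 * j n t \<or> j (Suc n) t = Suc (2 * j n t)" by arith
    then show ?thesis
    proof
      assume "j (Suc n) t = 2 * j n t"
      then have "d (Suc n) t = d n t" by (simp add: d_def)
      then show ?thesis using K by simp
    next
      assume e: "j (Suc n) t = Suc (2 * j n t)"
      then have "2 * j n t < 2 ^ Suc n" using jle[OF t, of "Suc n"] by linarith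
      from incr[OF this] show ?thesis using e by (simp add: d_def)
    qed
  qed
  have tele: "\<bar>f (d (n + p) t) - f (d n t)\<bar> \<le> K * c * (2 powr (- \<alpha> * n) - 2 powr (- \<alpha> * (n + p)))"
    if t: "t \<in> {0..T}" for n p t
  proof (induction p)
    case (Suc p)
    have "2 powr (- \<alpha> * (n + p)) = 2 powr \<alpha> * 2 powr (- \<alpha> * (n + Suc p))"
      by (simp add: powr_add[symmetric] algebra_simps)
    then have "c * (2 powr (- \<alpha> * (n + p)) - 2 powr (- \<alpha> * (n + Suc p))) = (c * (2 powr \<alpha> - 1)) * 2 powr (- \<alpha> * (n + Suc p))"
      by (simp only: left_diff_distrib right_diff_distrib mult.assoc mult_1)
    moreover have "c * (2 powr \<alpha> - 1) = 1" using two \<alpha> by (simp add: c_def)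
    ultimately have "2 powr (- \<alpha> * (n + Suc p)) = c * (2 powr (- \<alpha> * (n + p)) - 2 powr (- \<alpha> * (n + Suc p)))"
      by simp
    then have "\<bar>f (d (n + Suc p) t) - f (d (n + p) t)\<bar> \<le> K * (c * (2 powr (- \<alpha> * (n + p)) - 2 powr (- \<alpha> * (n + Suc p))))"
      using refine[OF t, of "n + p"] by simp
    then show ?case using Suc.IH by (simp add: algebra_simps)
  qed simp
  have approx: "\<bar>f t - f (d n t)\<bar> \<le> K * c * 2 powr (- \<alpha> * n)" if t: "t \<in> {0..T}" for n t
  proof (rule LIMSEQ_le_const2)
    have "(\<lambda>p. T / 2 ^ (n + p)) \<longlonglongrightarrow> 0"
      using LIMSEQ_ignore_initial_segment[OF LIMSEQ_divide_realpow_zero[of 2 T], of n] by (simp add: add.commute)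
    note up = this
    have "(\<lambda>p. t - d (n + p) t) \<longlonglongrightarrow> 0"
      by (rule tendsto_sandwich[OF _ _ tendsto_const up]) (use d_close[OF t] in auto)
    from tendsto_diff[OF tendsto_const[of t] this] have "(\<lambda>p. d (n + p) t) \<longlonglongrightarrow> t" by simp
    then have "(\<lambda>p. f (d (n + p) t)) \<longlonglongrightarrow> f t"
      using cont d_in[OF t] t by (auto simp: continuous_on_sequentially comp_def)
    then show "(\<lambda>p. \<bar>f (d (n + p) t) - f (d n t)\<bar>) \<longlonglongrightarrow> \<bar>f t - f (d n t)\<bar>"
      by (intro tendsto_intros)
    have "K * c * (2 powr (- \<alpha> * n) - 2 powr (- \<alpha> * (n + p))) \<le> K * c * 2 powr (- \<alpha> * n)" for p
      using K c by (intro mult_left_mono) auto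
    then show "\<exists>N. \<forall>p\<ge>N. \<bar>f (d (n + p) t) - f (d n t)\<bar> \<le> K * c * 2 powr (- \<alpha> * n)"
      using tele[OF t, of n] order_trans by blast
  qed
  have main: "\<bar>f t - f s\<bar> \<le> (2 * c + 1) * (2 / T) powr \<alpha> * K * (t - s) powr \<alpha>"
    if s: "s \<in> {0..T}" and t: "t \<in> {0..T}" and st: "s < t" for s t
  proof -
    have "\<exists>n. T / (t - s) < 2 ^ n" by (rule real_arch_pow) simp
    then have ex: "\<exists>n. T / 2 ^ Suc n < t - s"
    proof
      fix n assume "T / (t - s) < 2 ^ n"
      then have "T / 2 ^ n < t - s" using st by (simp add: field_simps)
      moreover have "T / 2 ^ Suc n \<le> T / 2 ^ n" using T by (intro divide_left_mono) auto
      ultimately show ?thesis by (intro exI[of _ n]) linarith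
    qed
    define n where "n = (LEAST n. T / 2 ^ Suc n < t - s)"
    have n1: "T / 2 ^ Suc n < t - s" unfolding n_def using ex by (rule LeastI_ex)
    have n2: "t - s \<le> T / 2 ^ n"
    proof (cases n)
      case 0 then show ?thesis using s t by simp
    next
      case (Suc m)
      then have "\<not> T / 2 ^ Suc m < t - s" unfolding n_def by (intro not_less_Least) simp
      then show ?thesis using Suc by simp
    qed
    have "t * 2 ^ n / T \<le> s * 2 ^ n / T + 1" using n2 T by (simp add: field_simps)
    then have "real (j n t) < real (j n s) + 2" using jb[OF t, of n] jb[OF s, of n] by linarith
    moreover have "real (j n s) < real (j n t) + 1"
    proof -
      have "s * 2 ^ n / T \<le> t * 2 ^ n / T" using st T by (intro divide_right_mono mult_right_mono) auto
      then show ?thesis using jb[OF t, of n] jb[OF s, of n] by linarith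
    qed
    ultimately have "real (j n t) < real (j n s + 2)" "real (j n s) < real (j n t + 1)" by simp_all
    then have "j n t < j n s + 2" "j n s < j n t + 1" by (simp_all only: of_nat_less_iff)
    then have "j n t = j n s \<or> j n t = Suc (j n s)" by arith
    then have mid: "\<bar>f (d n t) - f (d n s)\<bar> \<le> K * 2 powr (- \<alpha> * n)"
    proof
      assume "j n t = j n s" then show ?thesis using K by (simp add: d_def)
    next
      assume e: "j n t = Suc (j n s)"
      then have "j n s < 2 ^ n" using jle[OF t, of n] by linarith
      from incr[OF this] show ?thesis using e by (simp add: d_def)
    qed
    have "\<bar>f t - f s\<bar> \<le> \<bar>f t - f (d n t)\<bar> + \<bar>f (d n t) - f (d n s)\<bar> + \<bar>f s - f (d n s)\<bar>" by linarith
    also have "\<dots> \<le> (2 * c + 1) * K * 2 powr (- \<alpha> * n)"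
      using approx[OF t, of n] approx[OF s, of n] mid by (simp add: algebra_simps)
    finally have le: "\<bar>f t - f s\<bar> \<le> (2 * c + 1) * K * 2 powr (- \<alpha> * n)" .
    have "2 powr (- \<alpha> * n) \<le> ((2 / T) * (t - s)) powr \<alpha>"
    proof -
      have "2 powr (- \<alpha> * n) = (1 / 2 ^ n) powr \<alpha>"
        by (simp add: powr_divide powr_realpow[symmetric] powr_powr powr_minus_divide mult.commute)
      also have "\<dots> \<le> ((2 / T) * (t - s)) powr \<alpha>"
        using n1 T \<alpha> by (intro powr_mono2) (auto simp: field_simps)
      finally show ?thesis .
    qed
    also have "((2 / T) * (t - s)) powr \<alpha> = (2 / T) powr \<alpha> * (t - s) powr \<alpha>"
      by (rule powr_mult)
    finally have "(2 * c + 1) * K * 2 powr (- \<alpha> * n) \<le> (2 * c + 1) * K * ((2 / T) powr \<alpha> * (t - s) powr \<alpha>)"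
      using K c by (intro mult_left_mono) auto
    with le show ?thesis by (simp add: algebra_simps)
  qed
  show ?thesis
    using main[OF s t] main[OF t s] by (cases s t rule: linorder_cases) (auto simp: c_def abs_minus_commute)
qed

text \<open>Summation by parts moves the differences from \<open>f\<close> to the exponential. Relative to the value \<open>f t\<close> at the
right end the boundary term at \<open>t\<close> vanishes, and Hoelder continuity leaves sums of
\<open>x\<^sup>\<alpha>\<close> against increments of \<open>e\<^bsup>-xl\<^esup>\<close>, of order \<open>l\<^bsup>-\<alpha>\<^esup>\<close> independently of \<open>n\<close>. The boundary term at 0 contributes
1 to the constant 5 and the sum contributes 4.\<close>

lemma ou_sum_bound:
  assumes \<alpha>: "0 < \<alpha>" "\<alpha> \<le> 1" and l: "0 < l" and H: "0 \<le> H"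
    and hol: "\<And>r s. r \<in> {0..T} \<Longrightarrow> s \<in> {0..T} \<Longrightarrow> \<bar>f r - f s\<bar> \<le> H * \<bar>r - s\<bar> powr \<alpha>"
    and t: "t \<in> {0..T}"
  shows "\<bar>ou_sum l t n f\<bar> \<le> 5 * H * l powr (- \<alpha>)"
proof (cases "n = 0")
  case True
  then show ?thesis using H by (simp add: ou_sum_def)
next
  case False
  define p where "p i = t * (real i / real n)" for i
  define x where "x i = t - p i" for i
  define c where "c i = f (p i) - f t" for i
  have p: "p 0 = 0" "p n = t" using False by (auto simp: p_def)
  have p_mono: "i \<le> k \<Longrightarrow> p i \<le> p k" for i k using t by (auto simp: p_def intro!: mult_left_mono divide_right_mono)
  have p_in: "p i \<in> {0..T}" "p i \<le> t" if "i \<le> n" for i using p_mono[of 0 i] p_mono[OF that] p t by auto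
  have x: "0 \<le> x i" if "i \<le> n" for i using p_in[OF that] by (simp add: x_def)
  have xm: "x (Suc i) \<le> x i" for i using p_mono[of i "Suc i"] by (simp add: x_def)
  have cb: "\<bar>c i\<bar> \<le> H * x i powr \<alpha>" if "i \<le> n" for i
    using hol[OF p_in(1)[OF that] t] p_in(2)[OF that] by (simp add: c_def x_def abs_minus_commute)
  let ?g = "\<lambda>i. exp (- (x i * l))"
  have key: "x powr \<alpha> * exp (- (x * m)) \<le> m powr (- \<alpha>)" if "0 \<le> x" "0 < m" for x m
    using powr_exp_le[of \<alpha> x m] that \<alpha> by (cases "x = 0") (auto simp: mult.commute)
  have "ou_sum l t n f = (\<Sum>i<n. ?g i * (c (Suc i) - c i))"
    unfolding ou_sum_def c_def x_def p_def by (intro sum.cong) (auto simp: algebra_simps)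
  also have "\<dots> = (\<Sum>i<n. (?g (Suc i) * c (Suc i) - ?g i * c i) - c (Suc i) * (?g (Suc i) - ?g i))"
    by (rule sum.cong) (auto simp: algebra_simps)
  also have "\<dots> = ?g n * c n - ?g 0 * c 0 - (\<Sum>i<n. c (Suc i) * (?g (Suc i) - ?g i))"
    by (subst sum_subtractf) (simp only: sum_lessThan_telescope[of "\<lambda>i. ?g i * c i" n])
  also have "\<dots> = - (?g 0 * c 0) - (\<Sum>i<n. c (Suc i) * (?g (Suc i) - ?g i))"
    by (simp add: c_def p)
  finally have eq: "ou_sum l t n f = - (?g 0 * c 0) - (\<Sum>i<n. c (Suc i) * (?g (Suc i) - ?g i))" .
  have first: "\<bar>?g 0 * c 0\<bar> \<le> H * l powr (- \<alpha>)"
  proof -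
    have "\<bar>?g 0 * c 0\<bar> \<le> ?g 0 * (H * x 0 powr \<alpha>)" unfolding abs_mult using cb[of 0] by (intro mult_mono) auto
    also have "\<dots> = H * (x 0 powr \<alpha> * ?g 0)" by simp
    also have "\<dots> \<le> H * l powr (- \<alpha>)" using H x[of 0] l by (intro mult_left_mono key) auto
    finally show ?thesis .
  qed
  define B where "B = 2 * H * l powr (- \<alpha>)"
  have B0: "0 \<le> B" using H by (simp add: B_def)
  \<comment> \<open>Half of the exponential absorbs the factor \<open>x\<^sup>\<alpha>\<close>; the increments of the other half telescope.\<close>
  let ?h = "\<lambda>i. exp (- (x i * (l / 2)))"
  have "\<bar>c (Suc i) * (?g (Suc i) - ?g i)\<bar> \<le> 2 * B * (?h (Suc i) - ?h i)" if i: "i < n" for i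
  proof -
    have g_sq: "?g k = ?h k * ?h k" for k by (simp add: exp_add[symmetric])
    have hm: "?h i \<le> ?h (Suc i)" using xm[of i] l by simp
    have "x (Suc i) powr \<alpha> * ?h (Suc i) \<le> 2 * l powr (- \<alpha>)"
    proof -
      have "x (Suc i) powr \<alpha> * ?h (Suc i) \<le> (l / 2) powr (- \<alpha>)"
        using x[of "Suc i"] i l by (intro key) auto
      also have "\<dots> = 2 powr \<alpha> * l powr (- \<alpha>)" using l by (simp add: powr_divide powr_minus field_simps)
      also have "\<dots> \<le> 2 powr 1 * l powr (- \<alpha>)" using \<alpha> by (intro mult_right_mono powr_mono) auto
      finally show ?thesis by simp
    qed
    then have "H * (x (Suc i) powr \<alpha> * ?h (Suc i)) \<le> B" unfolding B_def using H
      by (metis mult.assoc mult.left_commute mult_left_mono)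
    have "\<bar>c (Suc i) * (?g (Suc i) - ?g i)\<bar> = \<bar>c (Suc i)\<bar> * ((?h (Suc i) - ?h i) * (?h (Suc i) + ?h i))"
      using mult_mono[OF hm hm] unfolding abs_mult g_sq by (simp add: algebra_simps)
    also have "\<dots> \<le> (H * x (Suc i) powr \<alpha>) * ((?h (Suc i) - ?h i) * (2 * ?h (Suc i)))"
      using cb[of "Suc i"] i hm by (intro mult_mono mult_left_mono) auto
    also have "\<dots> = 2 * (H * (x (Suc i) powr \<alpha> * ?h (Suc i))) * (?h (Suc i) - ?h i)" by (simp add: algebra_simps)
    also have "\<dots> \<le> 2 * B * (?h (Suc i) - ?h i)"
      using hm \<open>H * (x (Suc i) powr \<alpha> * ?h (Suc i)) \<le> B\<close> by (intro mult_right_mono mult_left_mono) auto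
    finally show ?thesis .
  qed
  then have "\<bar>\<Sum>i<n. c (Suc i) * (?g (Suc i) - ?g i)\<bar> \<le> (\<Sum>i<n. 2 * B * (?h (Suc i) - ?h i))"
    by (intro order_trans[OF sum_abs] sum_mono) auto
  also have "\<dots> = 2 * B * (?h n - ?h 0)" unfolding sum_distrib_left[symmetric] by (simp only: sum_lessThan_telescope[of ?h n])
  also have "\<dots> \<le> 2 * B * 1" using B0 by (intro mult_left_mono) (auto simp: x_def p)
  finally show ?thesis using first eq by (simp add: B_def)
qed

text \<open>One random variable dominates the squares of the sums for all rates \<open>l\<close>, all times and all grids at once.
Extended nonnegative values avoid a separate discussion of the null set where it is infinite.\<close>

definition ou_majorant ::
    "'w measure \<Rightarrow> (real \<Rightarrow> 'w \<Rightarrow> real) \<Rightarrow> real \<Rightarrow> real \<Rightarrow> real \<Rightarrow> ('w \<Rightarrow> ennreal) \<Rightarrow> bool" where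
  "ou_majorant M b T \<alpha> C R \<longleftrightarrow> R \<in> borel_measurable M \<and> (\<integral>\<^sup>+\<omega>. R \<omega> \<partial>M) \<le> ennreal C \<and>
     (AE \<omega> in M. \<forall>l>0. \<forall>t\<in>{0..T}. \<forall>n.
        ennreal ((ou_sum l t n (\<lambda>s. b s \<omega>))\<^sup>2) \<le> R \<omega> * ennreal (l powr (- (2 * \<alpha>))))"

text \<open>The sum of the \<open>2p\<close>-th powers of all dyadic increments, weighted by \<open>2\<^bsup>2p\<alpha>n\<^esup>\<close> at level \<open>n\<close>, bounds the Hoelder
constant of the path. At level \<open>n\<close> there are \<open>2\<^sup>n\<close> increments with \<open>2p\<close>-th moment of order \<open>2\<^bsup>-pn\<^esup>\<close>, so the expectation
is a geometric series of ratio \<open>2\<^bsup>1 - p(1 - 2\<alpha>)\<^esup>\<close>, which converges for large \<open>p\<close>. The bound \<open>C\<close> does not depend on the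
process, and therefore serves for all modes.\<close>

lemma wiener_ou_sup:
  assumes T: "0 < T" and \<alpha>: "0 < \<alpha>" "\<alpha> < 1 / 2"
  shows "\<exists>C>0. \<forall>(M :: 'w measure) G b. wiener M G b \<longrightarrow> (\<exists>R. ou_majorant M b T \<alpha> C R)"
proof -
  obtain p :: nat where p: "1 / (1 - 2 * \<alpha>) < p" using reals_Archimedean2 by blast
  then have p1: "1 < p * (1 - 2 * \<alpha>)" using \<alpha> by (simp add: field_simps)
  have p0: "0 < p" using p1 by (cases p) auto
  define cp :: real where "cp = fact (2 * p) / (2 ^ p * fact p)"
  have cp: "0 < cp" by (simp add: cp_def)
  define \<rho> where "\<rho> = 2 powr (1 - p * (1 - 2 * \<alpha>))"
  have \<rho>: "0 < \<rho>" "\<rho> < 1"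
    using p1 powr_less_mono[of "1 - p * (1 - 2 * \<alpha>)" 0 2] by (simp_all add: \<rho>_def)
  define E where "E = (\<Sum>n. cp * T ^ p * \<rho> ^ n)"
  have summ: "summable (\<lambda>n. cp * T ^ p * \<rho> ^ n)" using \<rho> by (intro summable_mult summable_geometric) auto
  have E: "0 \<le> E" unfolding E_def using cp T \<rho> by (intro suminf_nonneg summ) auto
  define c where "c = 5 * ((2 / (2 powr \<alpha> - 1) + 1) * (2 / T) powr \<alpha>)"
  have c: "0 < c" using \<alpha> T by (auto simp: c_def intro!: mult_pos_pos add_pos_pos divide_pos_pos)
  show ?thesis
  proof (intro exI[of _ "c\<^sup>2 * (1 + E)"] conjI allI impI)
    show "0 < c\<^sup>2 * (1 + E)" using c E by simp
    fix M :: "'w measure" and G b assume "wiener M G b"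
    then interpret wiener M G b .
    define \<Delta> where "\<Delta> n i \<omega> = b (T * real (Suc i) / 2 ^ n) \<omega> - b (T * real i / 2 ^ n) \<omega>" for n i \<omega>
    define V where "V \<omega> = (\<Sum>n. \<Sum>i<2 ^ n. ennreal ((2 powr (\<alpha> * n) * \<Delta> n i \<omega>) ^ (2 * p)))" for \<omega>
    have tm: "0 \<le> T * real i / 2 ^ n" "T * real i / 2 ^ n \<le> T * real (Suc i) / 2 ^ n"
      "T * real (Suc i) / 2 ^ n - T * real i / 2 ^ n = T / 2 ^ n" for i n
    proof -
      show "0 \<le> T * real i / 2 ^ n" using T by simp
      show "T * real i / 2 ^ n \<le> T * real (Suc i) / 2 ^ n"
        using T by (intro divide_right_mono mult_left_mono) auto
      show "T * real (Suc i) / 2 ^ n - T * real i / 2 ^ n = T / 2 ^ n"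
        by (simp add: diff_divide_distrib[symmetric] distrib_left)
    qed
    have [measurable]: "\<Delta> n i \<in> borel_measurable M" for n i
      unfolding \<Delta>_def by (intro borel_measurable_diff b_measurable tm(1))
    have Vm[measurable]: "V \<in> borel_measurable M" unfolding V_def by measurable
    have mom: "(\<integral>\<^sup>+\<omega>. ennreal ((2 powr (\<alpha> * n) * \<Delta> n i \<omega>) ^ (2 * p)) \<partial>M)
        = ennreal (2 powr (2 * p * \<alpha> * n) * ((T / 2 ^ n) ^ p * cp))" for n i
    proof -
      note m = increment_moment[OF tm(1)[of i n] tm(2)[of i n], of p, folded \<Delta>_def]
      have "(\<integral>\<^sup>+\<omega>. ennreal ((2 powr (\<alpha> * n) * \<Delta> n i \<omega>) ^ (2 * p)) \<partial>M)
         = ennreal (expectation (\<lambda>\<omega>. (2 powr (\<alpha> * n) * \<Delta> n i \<omega>) ^ (2 * p)))"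
        using m(1) by (intro nn_integral_eq_integral) (auto simp: power_mult_distrib intro!: integrable_mult_right AE_I2 mult_nonneg_nonneg simp: zero_le_even_power)
      also have "expectation (\<lambda>\<omega>. (2 powr (\<alpha> * n) * \<Delta> n i \<omega>) ^ (2 * p)) = (2 powr (\<alpha> * n)) ^ (2 * p) * ((T / 2 ^ n) ^ p * cp)"
        using m(1) m(2)[OF p0, unfolded tm(3)] by (simp add: power_mult_distrib cp_def)
      also have "(2 powr (\<alpha> * n)) ^ (2 * p) = 2 powr (2 * p * \<alpha> * n)"
        by (simp add: powr_realpow[symmetric] powr_powr algebra_simps)
      finally show ?thesis .
    qed
    have "(\<integral>\<^sup>+\<omega>. V \<omega> \<partial>M) = (\<Sum>n. \<Sum>i<2 ^ n. \<integral>\<^sup>+\<omega>. ennreal ((2 powr (\<alpha> * n) * \<Delta> n i \<omega>) ^ (2 * p)) \<partial>M)"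
      unfolding V_def by (subst nn_integral_suminf) (auto simp: nn_integral_sum simp del: sum_ennreal)
    also have "\<dots> = (\<Sum>n. ennreal (cp * T ^ p * \<rho> ^ n))"
    proof (rule suminf_cong)
      fix n :: nat
      have "2 ^ n * (2 powr (2 * p * \<alpha> * n) * ((T / 2 ^ n) ^ p * cp)) = cp * T ^ p * \<rho> ^ n"
      proof -
        have "2 ^ n * 2 powr (2 * p * \<alpha> * n) / (2 ^ n) ^ p = \<rho> ^ n"
        proof -
          have "(2 ^ n :: real) = 2 powr n" by (simp add: powr_realpow)
          moreover have "((2 ^ n) ^ p :: real) = 2 powr (n * p)" by (simp add: powr_realpow power_mult[symmetric] flip: of_nat_mult)
          moreover have "\<rho> ^ n = 2 powr ((1 - p * (1 - 2 * \<alpha>)) * n)" by (simp add: \<rho>_def powr_realpow[symmetric] powr_powr)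
          ultimately show ?thesis by (simp add: powr_add[symmetric] powr_diff[symmetric] algebra_simps)
        qed
        moreover have "2 ^ n * (2 powr (2 * p * \<alpha> * n) * ((T / 2 ^ n) ^ p * cp))
            = cp * T ^ p * (2 ^ n * 2 powr (2 * p * \<alpha> * n) / (2 ^ n) ^ p)"
          by (simp add: power_divide)
        ultimately show ?thesis by (simp only:)
      qed
      moreover have "(\<Sum>i<(2::nat) ^ n. ennreal (2 powr (2 * p * \<alpha> * n) * ((T / 2 ^ n) ^ p * cp)))
          = ennreal (2 ^ n * (2 powr (2 * p * \<alpha> * n) * ((T / 2 ^ n) ^ p * cp)))"
        using T cp by (subst sum_ennreal) auto
      ultimately show "(\<Sum>i<2 ^ n. \<integral>\<^sup>+\<omega>. ennreal ((2 powr (\<alpha> * n) * \<Delta> n i \<omega>) ^ (2 * p)) \<partial>M) = ennreal (cp * T ^ p * \<rho> ^ n)"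
        unfolding mom by (simp only:)
    qed
    also have "\<dots> = ennreal E" unfolding E_def using cp T \<rho> by (intro suminf_ennreal2 summ) auto
    finally have EV: "(\<integral>\<^sup>+\<omega>. V \<omega> \<partial>M) = ennreal E" .
    define R where "R \<omega> = ennreal (c\<^sup>2) * (1 + V \<omega>)" for \<omega>
    have "(\<integral>\<^sup>+\<omega>. R \<omega> \<partial>M) = ennreal (c\<^sup>2) * (1 + ennreal E)"
      unfolding R_def by (simp add: nn_integral_cmult nn_integral_add EV emeasure_space_1)
    also have "\<dots> = ennreal (c\<^sup>2 * (1 + E))"
      using E by (simp add: ennreal_mult ennreal_plus)
    finally have ER: "(\<integral>\<^sup>+\<omega>. R \<omega> \<partial>M) \<le> ennreal (c\<^sup>2 * (1 + E))" by simp
    have "AE \<omega> in M. V \<omega> \<noteq> \<infinity>" by (rule nn_integral_PInf_AE) (auto simp: EV)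
    moreover have "AE \<omega> in M. continuous_on {0..} (\<lambda>t. b t \<omega>)"
      using process by (simp add: standard_wiener_process_def)
    ultimately have "AE \<omega> in M. \<forall>l>0. \<forall>t\<in>{0..T}. \<forall>n.
            ennreal ((ou_sum l t n (\<lambda>s. b s \<omega>))\<^sup>2) \<le> R \<omega> * ennreal (l powr (- (2 * \<alpha>)))"
    proof eventually_elim
      fix \<omega> assume V: "V \<omega> \<noteq> \<infinity>" and cont: "continuous_on {0..} (\<lambda>t. b t \<omega>)"
      define v where "v = enn2real (V \<omega>)"
      have v: "V \<omega> = ennreal v" "0 \<le> v" using V by (auto simp: v_def less_top)
      \<comment> \<open>A square \<open>x\<close> with \<open>x\<^sup>p \<le> v\<close> satisfies \<open>x \<le> 1 + v\<close>; so \<open>K\<^sup>2\<close> is linear in \<open>v\<close> and has finite expectation.\<close>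
      define K where "K = sqrt (1 + v)"
      have incr: "\<bar>b (T * real (Suc i) / 2 ^ n) \<omega> - b (T * real i / 2 ^ n) \<omega>\<bar> \<le> K * 2 powr (- \<alpha> * n)"
        if i: "i < 2 ^ n" for n i
      proof -
        let ?x = "(2 powr (\<alpha> * n) * \<Delta> n i \<omega>)\<^sup>2"
        have "ennreal (?x ^ p) \<le> (\<Sum>i<2 ^ n. ennreal ((2 powr (\<alpha> * n) * \<Delta> n i \<omega>) ^ (2 * p)))"
          unfolding power_mult[symmetric] using i by (intro member_le_sum) auto
        also have "\<dots> \<le> V \<omega>" unfolding V_def
          by (rule order_trans[OF _ sum_le_suminf[where I = "{n}"]]) auto
        finally have "?x ^ p \<le> v" using v by simp
        have "?x \<le> 1 + v"
        proof (cases "?x \<le> 1")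
          case False
          then have "?x ^ 1 \<le> ?x ^ p" using p0 by (intro power_increasing) auto
          then show ?thesis using \<open>?x ^ p \<le> v\<close> by simp
        qed (use v in simp)
        then have "\<bar>2 powr (\<alpha> * n) * \<Delta> n i \<omega>\<bar> \<le> K" unfolding K_def by (rule real_le_rsqrt[of "\<bar>_\<bar>", simplified])
        then have "2 powr (\<alpha> * n) * \<bar>\<Delta> n i \<omega>\<bar> \<le> K" by (simp add: abs_mult)
        then show ?thesis by (simp add: powr_minus field_simps \<Delta>_def)
      qed
      have K: "0 \<le> K" using v by (simp add: K_def)
      have "continuous_on {0..T} (\<lambda>t. b t \<omega>)" by (rule continuous_on_subset[OF cont]) auto
      note hol = dyadic_holder[OF T \<alpha>(1) K this incr]
      define H where "H = (2 / (2 powr \<alpha> - 1) + 1) * (2 / T) powr \<alpha> * K"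
      have cH: "5 * H = c * K" by (simp add: c_def H_def)
      have H: "0 \<le> H" using cH c K by (smt (verit) mult_nonneg_nonneg)
      show "\<forall>l>0. \<forall>t\<in>{0..T}. \<forall>n. ennreal ((ou_sum l t n (\<lambda>s. b s \<omega>))\<^sup>2) \<le> R \<omega> * ennreal (l powr (- (2 * \<alpha>)))"
      proof (intro allI impI ballI)
        fix l t :: real and n assume l: "0 < l" and t: "t \<in> {0..T}"
        have "\<bar>ou_sum l t n (\<lambda>s. b s \<omega>)\<bar> \<le> 5 * H * l powr (- \<alpha>)"
          by (rule ou_sum_bound[OF \<alpha>(1) _ l H _ t]) (use \<alpha> hol in \<open>auto simp: H_def\<close>)
        then have "\<bar>ou_sum l t n (\<lambda>s. b s \<omega>)\<bar>\<^sup>2 \<le> (c * K * l powr (- \<alpha>))\<^sup>2"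
          unfolding cH by (intro power_mono) auto
        also have "\<dots> = (c\<^sup>2 * (1 + v)) * l powr (- (2 * \<alpha>))"
        proof -
          have "K\<^sup>2 = 1 + v" using v by (simp add: K_def)
          moreover have "(l powr (- \<alpha>))\<^sup>2 = l powr (- (2 * \<alpha>))" by (simp add: power2_eq_square powr_add[symmetric])
          ultimately show ?thesis by (simp only: power_mult_distrib)
        qed
        finally have "ennreal ((ou_sum l t n (\<lambda>s. b s \<omega>))\<^sup>2) \<le> ennreal ((c\<^sup>2 * (1 + v)) * l powr (- (2 * \<alpha>)))"
          by (simp add: ennreal_leI)
        also have "\<dots> = R \<omega> * ennreal (l powr (- (2 * \<alpha>)))"
          using v by (simp add: R_def ennreal_mult ennreal_plus)
        finally show "ennreal ((ou_sum l t n (\<lambda>s. b s \<omega>))\<^sup>2) \<le> R \<omega> * ennreal (l powr (- (2 * \<alpha>)))" .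
      qed
    qed
    then show "\<exists>R. ou_majorant M b T \<alpha> (c\<^sup>2 * (1 + E)) R"
      unfolding ou_majorant_def
    proof (intro exI[of _ R] conjI ER)
      show "R \<in> borel_measurable M" unfolding R_def by measurable
    qed
  qed
qed

section \<open>Coefficients of the stochastic convolution\<close>

text \<open>The pairing with \<open>e\<^sub>j\<close> is continuous for mean square convergence in the original space. It annihilates the
Wiener integrals of all other modes and turns that of the mode \<open>j\<close> into a scalar Ornstein-Uhlenbeck integral.\<close>

lemma convolution_coefficient:
  fixes e :: "nat \<Rightarrow> 'h::{real_inner,banach,second_countable_topology}"
    and J :: "'h \<Rightarrow> 'a::{real_inner,banach,second_countable_topology}"
  assumes sp: "spectral lam e" and J: "scale lam e s J" and s: "0 \<le> s"
    and W: "\<And>k. k \<ge> 1 \<Longrightarrow> wiener M G (\<beta> k)"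
    and Z: "is_stochastic_convolution lam e q M \<beta> T J path_at Z"
    and t: "t \<in> {0..T}" and j: "j \<ge> 1"
  shows "AE \<omega> in M. (\<lambda>n. sqrt (q j) * ou_sum (lam j) t (Suc n) (\<lambda>s. \<beta> j s \<omega>)) \<longlonglongrightarrow> pairing e J j (path_at (Z \<omega>) t)"
proof -
  interpret spectral lam e by fact
  interpret J: scale lam e s J by fact
  have idsc: "scale lam e 0 (id :: 'h \<Rightarrow> 'h)" by (rule scale_id[OF sp])
  interpret I: scale lam e 0 "id :: 'h \<Rightarrow> 'h" by (rule idsc)
  have pid: "pairing e id k x = x \<bullet> e k" if "k \<ge> 1" for k and x :: 'h
    using I.e_orth[OF that that] by (simp add: pairing_def)
  have incl_bd: "\<bar>1\<bar> * lam k powr ((0 - s) / 2) \<le> lam 1 powr (- s / 2)" if "k \<ge> 1" for k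
    using lam_pos[of 1] lam_mono[of 1 k] that s by (auto intro!: powr_mono2')
  have incl: "inclusion e J id x \<bullet> e k = pairing e J k x" if "k \<ge> 1" for k x
    using pairing_diagonal_map[OF J idsc _ incl_bd that, of x] pid[OF that] by (simp add: inclusion_def)
  have incl_bl: "bounded_linear (inclusion e J id)"
    unfolding inclusion_def by (rule bounded_linear_diagonal_map[OF J idsc _ incl_bd]) auto
  obtain I where Zm[measurable]: "(\<lambda>\<omega>. path_at (Z \<omega>) t) \<in> borel_measurable M"
    and I: "\<And>k. k \<ge> 1 \<Longrightarrow> is_wiener_integral M (\<beta> k) t
              (\<lambda>r. semigroup lam e id id (t - r) (sqrt (q k) *\<^sub>R e k)) (I k)"
    and lim: "(\<lambda>n. \<integral>\<^sup>+\<omega>. ennreal ((norm (inclusion e J id (path_at (Z \<omega>) t) - (\<Sum>k=1..n. I k \<omega>)))\<^sup>2) \<partial>M)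
             \<longlonglongrightarrow> 0"
    using Z t unfolding is_stochastic_convolution_def by blast
  have sg: "semigroup lam e id id r (c *\<^sub>R e k) = (exp (- r * lam k) * c) *\<^sub>R e k" if k: "k \<ge> 1" for r c k
  proof -
    have "(\<Sum>\<^sub>\<infinity>i\<in>{1..}. (exp (- r * lam i) * pairing e id i (c *\<^sub>R e k)) *\<^sub>R e i)
       = (\<Sum>\<^sub>\<infinity>i\<in>{k}. (exp (- r * lam i) * pairing e id i (c *\<^sub>R e k)) *\<^sub>R e i)"
      by (rule infsum_cong_neutral) (use k in \<open>auto simp: pid I.e_orth\<close>)
    then show ?thesis using k by (simp add: semigroup_def diagonal_map_def pid I.e_orth)
  qed
  have nv: "norm (e j) = 1" using I.e_orth[OF j j] by (simp add: norm_eq_sqrt_inner)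
  have Ij: "is_wiener_integral M (\<beta> k) t (\<lambda>r. (if k = j then sqrt (q j) else 0) * exp (- (t - r) * lam k)) (\<lambda>\<omega>. I k \<omega> \<bullet> e j)"
    if k: "k \<ge> 1" for k
  proof -
    have "(\<lambda>r. semigroup lam e id id (t - r) (sqrt (q k) *\<^sub>R e k) \<bullet> e j)
      = (\<lambda>r. (if k = j then sqrt (q j) else 0) * exp (- (t - r) * lam k))"
      using I.e_orth[OF k j] by (auto simp: sg[OF k] fun_eq_iff)
    then show ?thesis
      using wiener.wiener_integral_inner[OF W[OF k] I[OF k] nv] by simp
  qed
  have t0: "0 \<le> t" using t by simp
  have conv: "AE \<omega> in M. (\<lambda>n. (if k = j then sqrt (q j) else 0) * ou_sum (lam k) t (Suc n) (\<lambda>s. \<beta> k s \<omega>)) \<longlonglongrightarrow> I k \<omega> \<bullet> e j"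
    if k: "k \<ge> 1" for k
    by (rule wiener.wiener_integral_ou[OF W[OF k] t0 _ Ij[OF k]]) (use lam_pos[OF k] in simp)
  have zero: "AE \<omega> in M. \<forall>k\<in>{1..} - {j}. I k \<omega> \<bullet> e j = 0"
    unfolding AE_ball_countable[OF countable_subset[OF subset_UNIV countableI_type]]
  proof
    fix k assume k: "k \<in> {1..} - {j}"
    then have "k \<ge> 1" by simp
    from conv[OF this] show "AE \<omega> in M. I k \<omega> \<bullet> e j = 0"
      by eventually_elim (use k in \<open>simp add: LIMSEQ_const_iff\<close>)
  qed
  let ?D = "\<lambda>\<omega>. pairing e J j (path_at (Z \<omega>) t) - I j \<omega> \<bullet> e j"
  have Im: "I k \<in> borel_measurable M" if "k \<ge> 1" for k using I[OF that] by (simp add: is_wiener_integral_def)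
  have pm: "(\<lambda>\<omega>. pairing e J j (path_at (Z \<omega>) t)) \<in> borel_measurable M"
    by (rule borel_measurable_continuous_on[OF _ Zm])
       (intro linear_continuous_on J.bounded_linear_coef)
  have Dm: "?D \<in> borel_measurable M"
    using pm Im[OF j] by measurable
  have "(\<integral>\<^sup>+\<omega>. ennreal ((?D \<omega>)\<^sup>2) \<partial>M) \<le> 0"
  proof (rule LIMSEQ_le_const[OF lim], intro exI allI impI)
    fix n assume n: "n \<ge> j"
    show "(\<integral>\<^sup>+\<omega>. ennreal ((?D \<omega>)\<^sup>2) \<partial>M)
       \<le> (\<integral>\<^sup>+\<omega>. ennreal ((norm (inclusion e J id (path_at (Z \<omega>) t) - (\<Sum>k=1..n. I k \<omega>)))\<^sup>2) \<partial>M)"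
    proof (rule nn_integral_mono_AE)
      show "AE \<omega> in M. ennreal ((?D \<omega>)\<^sup>2) \<le> ennreal ((norm (inclusion e J id (path_at (Z \<omega>) t) - (\<Sum>k=1..n. I k \<omega>)))\<^sup>2)"
        using zero
      proof eventually_elim
        fix \<omega> assume z: "\<forall>k\<in>{1..} - {j}. I k \<omega> \<bullet> e j = 0"
        let ?x = "inclusion e J id (path_at (Z \<omega>) t) - (\<Sum>k=1..n. I k \<omega>)"
        have "(\<Sum>k=1..n. I k \<omega> \<bullet> e j) = (\<Sum>k=1..n. if k = j then I j \<omega> \<bullet> e j else 0)"
          by (rule sum.cong) (use z in auto)
        also have "\<dots> = I j \<omega> \<bullet> e j" using n j by simp
        finally have "?x \<bullet> e j = ?D \<omega>" by (simp add: inner_diff_left inner_sum_left incl[OF j])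
        then have "\<bar>?D \<omega>\<bar> \<le> norm ?x" using Cauchy_Schwarz_ineq2[of ?x "e j"] nv by simp
        then show "ennreal ((?D \<omega>)\<^sup>2) \<le> ennreal ((norm ?x)\<^sup>2)"
          by (intro ennreal_leI) (metis abs_ge_zero power2_abs power_mono)
      qed
    qed
  qed
  then have "AE \<omega> in M. ennreal ((?D \<omega>)\<^sup>2) = 0"
    using Dm by (subst nn_integral_0_iff_AE[symmetric]) auto
  moreover have "AE \<omega> in M. (\<lambda>n. sqrt (q j) * ou_sum (lam j) t (Suc n) (\<lambda>s. \<beta> j s \<omega>)) \<longlonglongrightarrow> I j \<omega> \<bullet> e j"
    using conv[OF j] by simp
  ultimately show ?thesis by eventually_elim simp
qed

section \<open>Sign changes of the driving processes\<close>

context wiener begin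

lemma increment_symmetric:
  assumes "0 \<le> s" "s < t"
  shows "distr M borel (\<lambda>\<omega>. b t \<omega> - b s \<omega>) = distr M borel (\<lambda>\<omega>. - (b t \<omega> - b s \<omega>))"
proof -
  note D = increment_distributed[OF assms]
  have pos: "0 < sqrt (t - s)" using assms by simp
  have "distributed M lborel (\<lambda>\<omega>. 0 + (-1) * (b t \<omega> - b s \<omega>)) (normal_density (0 + (-1) * 0) (\<bar>-1\<bar> * sqrt (t - s)))"
    by (rule normal_density_affine[OF D pos]) simp
  then have D': "distributed M lborel (\<lambda>\<omega>. - (b t \<omega> - b s \<omega>)) (normal_density 0 (sqrt (t - s)))" by simp
  have "distr M lborel (\<lambda>\<omega>. b t \<omega> - b s \<omega>) = distr M lborel (\<lambda>\<omega>. - (b t \<omega> - b s \<omega>))"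
    using distributed_distr_eq_density[OF D] distributed_distr_eq_density[OF D'] by simp
  moreover have "distr M lborel f = distr M borel f" for f :: "'w \<Rightarrow> real"
    by (rule distr_cong) auto
  ultimately show ?thesis by simp
qed

lemma restrict_measurable:
  assumes "I \<subseteq> {0..t}" shows "(\<lambda>\<omega>. \<lambda>r\<in>I. c * b r \<omega>) \<in> measurable (G t) (PiM I (\<lambda>_. borel))"
proof (rule measurable_restrict)
  fix i assume "i \<in> I"
  then have "b i \<in> borel_measurable (G t)" using assms by (intro adapted) auto
  then show "(\<lambda>\<omega>. c * b i \<omega>) \<in> borel_measurable (G t)" by measurable
qed

text \<open>Induction on the largest time: a new value is the previous one plus an independent increment of
symmetric law. The time 0 is kept in the index set, so that there always is a previous value; there the
process vanishes only almost surely.\<close>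

lemma finite_dim_symmetric:
  assumes "finite J" "J \<subseteq> {0<..}"
  shows "distr M (PiM (insert 0 J) (\<lambda>_. borel)) (\<lambda>\<omega>. \<lambda>t\<in>insert 0 J. 1 * b t \<omega>)
       = distr M (PiM (insert 0 J) (\<lambda>_. borel)) (\<lambda>\<omega>. \<lambda>t\<in>insert 0 J. (-1) * b t \<omega>)"
  using assms
proof (induction J rule: finite_linorder_max_induct)
  case empty
  have m: "(\<lambda>\<omega>. \<lambda>t\<in>{0}. c * b t \<omega>) \<in> measurable M (PiM {0} (\<lambda>_. borel))" for c
    by (rule measurable_from_subalg[OF sub restrict_measurable[of "{0}" 0]]) auto
  show ?case
  proof (rule distr_cong_AE[OF refl refl])
    show "AE \<omega> in M. (\<lambda>t\<in>{0}. 1 * b t \<omega>) = (\<lambda>t\<in>{0}. (-1) * b t \<omega>)"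
      using b_zero by eventually_elim (auto simp: fun_eq_iff restrict_def)
  qed (rule m)+
next
  case (insert t J)
  define I where "I = insert 0 J"
  have I: "finite I" "I \<noteq> {}" "I \<subseteq> {0..}" "\<And>i. i \<in> I \<Longrightarrow> i < t" "t \<notin> I" using insert by (auto simp: I_def)
  define m where "m = Max I"
  have mI: "m \<in> I" unfolding m_def by (rule Max_in[OF I(1,2)])
  have m: "m \<in> I" "I \<subseteq> {0..m}" "0 \<le> m" "m < t"
    using mI I(3) I(4)[OF mI] Max_ge[OF I(1), folded m_def] by auto
  let ?P = "PiM I (\<lambda>_. borel) :: (real \<Rightarrow> real) measure"
  \<comment> \<open>The increment is regarded as a function on \<open>{t}\<close>, to have the same type as the vector of earlier values.\<close>
  let ?Q = "PiM {t} (\<lambda>_. borel) :: (real \<Rightarrow> real) measure"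
  let ?X = "\<lambda>c \<omega>. \<lambda>r\<in>I. c * b r \<omega>" and ?D = "\<lambda>c \<omega>. \<lambda>r\<in>{t}. c * (b t \<omega> - b m \<omega>)"
  have Xm: "?X c \<in> measurable M ?P" for c
    by (rule measurable_from_subalg[OF sub[OF m(3)] restrict_measurable[OF m(2)]])
  have lift: "(\<lambda>x. \<lambda>r\<in>{t}. c * x) \<in> measurable borel ?Q" for c
    by (rule measurable_restrict) simp
  have dm: "(\<lambda>\<omega>. c * (b t \<omega> - b m \<omega>)) \<in> borel_measurable M" for c
  proof -
    have "b t \<in> borel_measurable M" "b m \<in> borel_measurable M" using m b_measurable by auto
    then show ?thesis by measurable
  qed
  have Dm: "?D c \<in> measurable M ?Q" for c
    using measurable_compose[OF dm[of 1] lift[of c]] by simp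
  have ind: "indep_var ?P (?X c) ?Q (?D c)" for c
    by (rule increment_indep[OF m(3,4) restrict_measurable[OF m(2)] lift])
  have pair: "distr M ?P (?X c) \<Otimes>\<^sub>M distr M ?Q (?D c) = distr M (?P \<Otimes>\<^sub>M ?Q) (\<lambda>\<omega>. (?X c \<omega>, ?D c \<omega>))" for c
    using ind[of c] unfolding indep_var_distribution_eq by simp
  have IH: "distr M ?P (?X 1) = distr M ?P (?X (-1))"
    unfolding I_def by (rule insert.IH) (use insert.prems in auto)
  have dD: "distr M ?Q (?D 1) = distr M ?Q (?D (-1))"
  proof -
    have "distr M ?Q (?D c) = distr (distr M borel (\<lambda>\<omega>. c * (b t \<omega> - b m \<omega>))) ?Q (\<lambda>x. \<lambda>r\<in>{t}. 1 * x)" for c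
      by (subst distr_distr[OF lift dm]) (simp add: comp_def)
    moreover have "distr M borel (\<lambda>\<omega>. 1 * (b t \<omega> - b m \<omega>)) = distr M borel (\<lambda>\<omega>. (-1) * (b t \<omega> - b m \<omega>))"
      using increment_symmetric[OF m(3,4)] by simp
    ultimately show ?thesis by (simp only:)
  qed
  define h :: "(real \<Rightarrow> real) \<times> (real \<Rightarrow> real) \<Rightarrow> real \<Rightarrow> real" where
    "h z = (\<lambda>r\<in>insert t I. if r = t then fst z m + snd z t else fst z r)" for z
  have hm: "h \<in> measurable (?P \<Otimes>\<^sub>M ?Q) (PiM (insert t I) (\<lambda>_. borel))"
    unfolding h_def
  proof (rule measurable_restrict)
    fix r assume r: "r \<in> insert t I"
    have f: "(\<lambda>z. fst z r) \<in> borel_measurable (?P \<Otimes>\<^sub>M ?Q)" if "r \<in> I" for r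
      by (rule measurable_compose[OF measurable_fst measurable_component_singleton[OF that]])
    have s: "(\<lambda>z. snd z t) \<in> borel_measurable (?P \<Otimes>\<^sub>M ?Q)"
      by (rule measurable_compose[OF measurable_snd measurable_component_singleton]) simp
    show "(\<lambda>z. if r = t then fst z m + snd z t else fst z r) \<in> borel_measurable (?P \<Otimes>\<^sub>M ?Q)"
      using r f[OF m(1)] f[of r] s by (cases "r = t") simp_all
  qed
  have comp: "distr M (PiM (insert t I) (\<lambda>_. borel)) (\<lambda>\<omega>. \<lambda>r\<in>insert t I. c * b r \<omega>)
     = distr (distr M ?P (?X c) \<Otimes>\<^sub>M distr M ?Q (?D c)) (PiM (insert t I) (\<lambda>_. borel)) h" for c
  proof -
    have "(\<lambda>\<omega>. (?X c \<omega>, ?D c \<omega>)) \<in> measurable M (?P \<Otimes>\<^sub>M ?Q)"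
      using Xm Dm by (rule measurable_Pair)
    moreover have "h \<circ> (\<lambda>\<omega>. (?X c \<omega>, ?D c \<omega>)) = (\<lambda>\<omega>. \<lambda>r\<in>insert t I. c * b r \<omega>)"
      using m(1) I(5) by (auto simp: h_def fun_eq_iff algebra_simps)
    ultimately show ?thesis unfolding pair by (subst distr_distr[OF hm]) simp_all
  qed
  have "insert 0 (insert t J) = insert t I" by (auto simp: I_def)
  then show ?case unfolding comp IH dD by (simp only: comp IH dD)
qed

text \<open>A measure on the product space is determined by the finite dimensional boxes, and every box becomes one
over an index set containing 0 by adding the trivial condition there.\<close>

lemma path_law_symmetric:
  "distr M (PiM {0..} (\<lambda>_. borel)) (\<lambda>\<omega>. \<lambda>t\<in>{0..}. b t \<omega>)
   = distr M (PiM {0..} (\<lambda>_. borel)) (\<lambda>\<omega>. \<lambda>t\<in>{0..}. - b t \<omega>)"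
proof -
  let ?S = "PiM {0..} (\<lambda>_. borel) :: (real \<Rightarrow> real) measure"
  let ?X = "\<lambda>c \<omega>. \<lambda>t\<in>{0..}. c * b t \<omega>"
  have Xm: "?X c \<in> measurable M ?S" for c
    by (rule measurable_restrict) (use b_measurable in \<open>auto intro!: borel_measurable_times\<close>)
  have "distr M ?S (?X 1) = distr M ?S (?X (-1))"
  proof (rule measure_eqI_PiM_infinite[of _ "{0..}" "\<lambda>_. borel"])
    show "finite_measure (distr M ?S (?X 1))"
      by (intro prob_space.finite_measure prob_space_distr Xm)
    fix A :: "real \<Rightarrow> real set" and J :: "real set"
    assume J: "finite J" "J \<subseteq> {0..}" and A: "\<And>i. i \<in> J \<Longrightarrow> A i \<in> sets borel"
    define K where "K = insert 0 (J - {0})"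
    define A' where "A' i = (if i \<in> J then A i else UNIV)" for i
    have K: "finite K" "K \<subseteq> {0..}" "J \<subseteq> K" using J by (auto simp: K_def)
    have A': "A' i \<in> sets borel" for i using A by (simp add: A'_def)
    have Km: "(\<lambda>\<omega>. \<lambda>t\<in>K. c * b t \<omega>) \<in> measurable M (PiM K (\<lambda>_. borel))" for c
      by (rule measurable_restrict) (use b_measurable K in \<open>auto intro!: borel_measurable_times\<close>)
    have boxS: "prod_emb {0..} (\<lambda>_. borel) J (Pi\<^sub>E J A) \<in> sets ?S"
      using J A by (intro sets_PiM_I) auto
    have boxK: "Pi\<^sub>E K A' \<in> sets (PiM K (\<lambda>_. borel))"
      using K A' by (intro sets_PiM_I_finite) auto
    have E: "emeasure (distr M ?S (?X c)) (prod_emb {0..} (\<lambda>_. borel) J (Pi\<^sub>E J A))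
        = emeasure (distr M (PiM K (\<lambda>_. borel)) (\<lambda>\<omega>. \<lambda>t\<in>K. c * b t \<omega>)) (Pi\<^sub>E K A')" for c
    proof -
      have "?X c -` prod_emb {0..} (\<lambda>_. borel) J (Pi\<^sub>E J A) \<inter> space M = (\<lambda>\<omega>. \<lambda>t\<in>K. c * b t \<omega>) -` (Pi\<^sub>E K A') \<inter> space M"
      proof -
        have "restrict (?X c \<omega>) J = (\<lambda>t\<in>J. c * b t \<omega>)" for \<omega>
          using J by (auto simp: restrict_def fun_eq_iff)
        then have "?X c \<omega> \<in> prod_emb {0..} (\<lambda>_. borel) J (Pi\<^sub>E J A) \<longleftrightarrow> (\<forall>i\<in>J. c * b i \<omega> \<in> A i)" for \<omega>
          by (simp add: prod_emb_def restrict_PiE_iff Pi_iff)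
        moreover have "(\<lambda>t\<in>K. c * b t \<omega>) \<in> Pi\<^sub>E K A' \<longleftrightarrow> (\<forall>i\<in>J. c * b i \<omega> \<in> A i)" for \<omega>
          unfolding restrict_PiE_iff A'_def using K(3) by (auto simp: subset_iff)
        ultimately show ?thesis by auto
      qed
      then show ?thesis by (simp add: emeasure_distr[OF Xm boxS] emeasure_distr[OF Km boxK])
    qed
    have "distr M (PiM K (\<lambda>_. borel)) (\<lambda>\<omega>. \<lambda>t\<in>K. 1 * b t \<omega>) = distr M (PiM K (\<lambda>_. borel)) (\<lambda>\<omega>. \<lambda>t\<in>K. (-1) * b t \<omega>)"
      unfolding K_def by (rule finite_dim_symmetric) (use J in auto)
    then show "emeasure (distr M ?S (?X 1)) (prod_emb {0..} (\<lambda>_. borel) J (Pi\<^sub>E J A))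
      = emeasure (distr M ?S (?X (-1))) (prod_emb {0..} (\<lambda>_. borel) J (Pi\<^sub>E J A))"
      unfolding E by (rule arg_cong)
  qed simp_all
  then show ?thesis by simp
qed

end

lemma assumption_W_wiener: "assumption_W M G \<beta> \<Longrightarrow> k \<ge> 1 \<Longrightarrow> wiener M G (\<beta> k)"
  unfolding assumption_W_def wiener_def wiener_axioms_def by (elim conjE) (intro conjI; blast)

text \<open>By independence the joint law is the product of the laws of the single processes, each of which is symmetric.\<close>

lemma sign_flip_law:
  assumes W: "assumption_W M G \<beta>" and \<sigma>: "\<And>k. \<sigma> k = 1 \<or> \<sigma> k = (-1 :: real)"
  defines "S \<equiv> PiM {0..} (\<lambda>_. borel) :: (real \<Rightarrow> real) measure"
  shows "distr M (PiM {1..} (\<lambda>_. S)) (\<lambda>\<omega>. \<lambda>k\<in>{1..}. \<lambda>t\<in>{0..}. \<beta> k t \<omega>)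
       = distr M (PiM {1..} (\<lambda>_. S)) (\<lambda>\<omega>. \<lambda>k\<in>{1..}. \<lambda>t\<in>{0..}. \<sigma> k * \<beta> k t \<omega>)"
proof -
  interpret prob_space M using W by (simp add: assumption_W_def)
  note wn = assumption_W_wiener[OF W]
  let ?X = "\<lambda>k \<omega>. \<lambda>t\<in>{0..}. \<beta> k t \<omega>" and ?Y = "\<lambda>k \<omega>. \<lambda>t\<in>{0..}. \<sigma> k * \<beta> k t \<omega>"
  have ind: "indep_vars (\<lambda>_. S) ?X {1..}"
    using W unfolding assumption_W_def S_def by (elim conjE)
  have "indep_vars (\<lambda>_. S) (\<lambda>k \<omega>. (\<lambda>x. \<lambda>t\<in>{0..}. \<sigma> k * x t) (?X k \<omega>)) {1..}"
  proof (rule indep_vars_compose2[OF ind])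
    fix k show "(\<lambda>x. \<lambda>t\<in>{0..}. \<sigma> k * x t) \<in> measurable S S"
      unfolding S_def by measurable
  qed
  moreover have "(\<lambda>x. \<lambda>t\<in>{0..}. \<sigma> k * x t) (?X k \<omega>) = ?Y k \<omega>" for k \<omega> by auto
  ultimately have ind': "indep_vars (\<lambda>_. S) ?Y {1..}" by simp
  have rv: "?X k \<in> measurable M S" "?Y k \<in> measurable M S" if "k \<in> {1..}" for k
    using ind ind' that unfolding indep_vars_def by auto
  have "distr M S (?X k) = distr M S (?Y k)" if "k \<in> {1..}" for k
    using \<sigma>[of k] wiener.path_law_symmetric[OF wn[of k]] that unfolding S_def by auto
  then have "PiM {1..} (\<lambda>k. distr M S (?X k)) = PiM {1..} (\<lambda>k. distr M S (?Y k))"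
    by (intro PiM_cong) auto
  then show ?thesis
    using indep_vars_iff_distr_eq_PiM'[THEN iffD1, OF _ rv(1) ind] indep_vars_iff_distr_eq_PiM'[THEN iffD1, OF _ rv(2) ind']
    by simp
qed

lemma ou_sum_scale: "ou_sum l t n (\<lambda>s. c * f s) = c * ou_sum l t n f"
  by (simp add: ou_sum_def sum_distrib_left algebra_simps)

text \<open>The random variables \<open>\<zeta> i k\<close> are almost sure limits of linear functions of the path of \<open>\<beta>\<^sub>k\<close>. The identity holds
for these approximations by equality of laws, and passes to the limit by bounded convergence, for
continuous functions \<open>g\<close> on the space of all arrays with the product topology.\<close>

lemma sign_flip_expectation:
  fixes g :: "(nat \<times> nat \<Rightarrow> real) \<Rightarrow> real" and \<zeta> :: "nat \<Rightarrow> nat \<Rightarrow> 'w \<Rightarrow> real"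
  assumes W: "assumption_W M G \<beta>" and \<sigma>: "\<And>k. \<sigma> k = 1 \<or> \<sigma> k = (-1 :: real)"
    and \<tau>: "\<And>i. 0 \<le> \<tau> i"
    and \<zeta>m: "\<And>i k. k \<ge> 1 \<Longrightarrow> \<zeta> i k \<in> borel_measurable M"
    and lim: "\<And>i k. k \<ge> 1 \<Longrightarrow> AE \<omega> in M. (\<lambda>n. c k * ou_sum (l k) (\<tau> i) (Suc n) (\<lambda>s. \<beta> k s \<omega>)) \<longlonglongrightarrow> \<zeta> i k \<omega>"
    and g: "continuous_on UNIV g" and B: "\<And>x. \<bar>g x\<bar> \<le> B"
  shows "(\<integral>\<omega>. g (\<lambda>(i, k). if k \<ge> 1 then \<zeta> i k \<omega> else 0) \<partial>M) = (\<integral>\<omega>. g (\<lambda>(i, k). if k \<ge> 1 then \<sigma> k * \<zeta> i k \<omega> else 0) \<partial>M)"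
proof -
  interpret prob_space M using W by (simp add: assumption_W_def)
  note wn = assumption_W_wiener[OF W]
  define S where "S = (PiM {0..} (\<lambda>_. borel) :: (real \<Rightarrow> real) measure)"
  let ?P = "PiM {1..} (\<lambda>_::nat. S)"
  define H where "H n x = (\<lambda>(i, k). if k \<ge> 1 then c k * ou_sum (l k) (\<tau> i) (Suc n) (x k) else 0)" for n and x :: "nat \<Rightarrow> real \<Rightarrow> real"
  have gm: "g \<in> borel_measurable borel" using g by (rule borel_measurable_continuous_onI)
  have Hm: "H n \<in> borel_measurable ?P" for n
  proof (rule measurable_coordinatewise_then_product)
    fix p :: "nat \<times> nat"
    obtain i k where p: "p = (i, k)" by (cases p)
    show "(\<lambda>x. H n x p) \<in> borel_measurable ?P"
    proof (cases "k \<ge> 1")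
      case True
      have ev: "(\<lambda>x. x k t) \<in> borel_measurable ?P" if "0 \<le> t" for t
      proof -
        have "(\<lambda>x. x k) \<in> measurable ?P S" using True by (intro measurable_component_singleton) simp
        moreover have "(\<lambda>y. y t) \<in> borel_measurable S" unfolding S_def using that by (intro measurable_component_singleton) simp
        ultimately show ?thesis by (rule measurable_compose)
      qed
      have "(\<lambda>x. H n x p) = (\<lambda>x. c k * (\<Sum>j<Suc n. exp (- (\<tau> i - \<tau> i * (j / Suc n)) * l k)
          * (x k (\<tau> i * (Suc j / Suc n)) - x k (\<tau> i * (j / Suc n)))))"
        using True by (simp only: p H_def ou_sum_def case_prod_conv if_True)
      then show ?thesis
        by (simp only:) (intro borel_measurable_times borel_measurable_sum borel_measurable_diff borel_measurable_const ev
            mult_nonneg_nonneg divide_nonneg_nonneg of_nat_0_le_iff \<tau>)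
    qed (simp add: p H_def)
  qed
  let ?X = "\<lambda>\<omega>. \<lambda>k\<in>{1..}. \<lambda>t\<in>{0..}. \<beta> k t \<omega>" and ?Y = "\<lambda>\<omega>. \<lambda>k\<in>{1..}. \<lambda>t\<in>{0..}. \<sigma> k * \<beta> k t \<omega>"
  have bm: "(\<lambda>\<omega>. \<sigma> k * \<beta> k t \<omega>) \<in> borel_measurable M" "\<beta> k t \<in> borel_measurable M" if "k \<ge> 1" "0 \<le> t" for k t
    using wiener.b_measurable[OF wn[OF that(1)] that(2)] by measurable
  have Xm: "?X \<in> measurable M ?P" "?Y \<in> measurable M ?P"
    unfolding S_def by (intro measurable_restrict; use bm in auto)+
  have eqn: "(\<integral>\<omega>. g (H n (?X \<omega>)) \<partial>M) = (\<integral>\<omega>. g (H n (?Y \<omega>)) \<partial>M)" for n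
  proof -
    have gH: "(\<lambda>x. g (H n x)) \<in> borel_measurable ?P" by (rule measurable_compose[OF Hm gm])
    have "(\<integral>\<omega>. g (H n (?X \<omega>)) \<partial>M) = (\<integral>x. g (H n x) \<partial>distr M ?P ?X)"
      by (rule integral_distr[symmetric, OF Xm(1) gH])
    also have "\<dots> = (\<integral>x. g (H n x) \<partial>distr M ?P ?Y)"
      using sign_flip_law[OF W \<sigma>] unfolding S_def by simp
    also have "\<dots> = (\<integral>\<omega>. g (H n (?Y \<omega>)) \<partial>M)"
      by (rule integral_distr[OF Xm(2) gH])
    finally show ?thesis .
  qed
  have Hx: "H n (?X \<omega>) = (\<lambda>(i, k). if k \<ge> 1 then c k * ou_sum (l k) (\<tau> i) (Suc n) (\<lambda>s. \<beta> k s \<omega>) else 0)"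
    and Hy: "H n (?Y \<omega>) = (\<lambda>(i, k). if k \<ge> 1 then \<sigma> k * (c k * ou_sum (l k) (\<tau> i) (Suc n) (\<lambda>s. \<beta> k s \<omega>)) else 0)" for n \<omega>
  proof -
    have "ou_sum (l k) (\<tau> i) (Suc n) (\<lambda>t\<in>{0..}. f t) = ou_sum (l k) (\<tau> i) (Suc n) f" for f k i
      unfolding ou_sum_def using \<tau>[of i] by (intro sum.cong) auto
    then show "H n (?X \<omega>) = (\<lambda>(i, k). if k \<ge> 1 then c k * ou_sum (l k) (\<tau> i) (Suc n) (\<lambda>s. \<beta> k s \<omega>) else 0)"
      "H n (?Y \<omega>) = (\<lambda>(i, k). if k \<ge> 1 then \<sigma> k * (c k * ou_sum (l k) (\<tau> i) (Suc n) (\<lambda>s. \<beta> k s \<omega>)) else 0)"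
      unfolding H_def by (auto simp: fun_eq_iff ou_sum_scale)
  qed
  have all: "AE \<omega> in M. \<forall>p\<in>UNIV \<times> {1..}. (\<lambda>n. c (snd p) * ou_sum (l (snd p)) (\<tau> (fst p)) (Suc n) (\<lambda>s. \<beta> (snd p) s \<omega>)) \<longlonglongrightarrow> \<zeta> (fst p) (snd p) \<omega>"
    unfolding AE_ball_countable[OF countable_subset[OF subset_UNIV countableI_type]]
    using lim by auto
  have tend: "(\<lambda>n. g (f n)) \<longlonglongrightarrow> g h" if "\<And>p. (\<lambda>n. f n p) \<longlonglongrightarrow> h p" for f :: "nat \<Rightarrow> nat \<times> nat \<Rightarrow> real" and h
  proof -
    have "limitin (product_topology (\<lambda>_. euclidean) UNIV) f h sequentially"
      unfolding limitin_componentwise using that by auto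
    then have "f \<longlonglongrightarrow> h" by (simp add: euclidean_product_topology)
    then show ?thesis by (rule continuous_on_tendsto_compose[OF g]) auto
  qed
  have fm: "(\<lambda>\<omega>. g (\<lambda>(i, k). if k \<ge> 1 then \<zeta> i k \<omega> else 0)) \<in> borel_measurable M"
    "(\<lambda>\<omega>. g (\<lambda>(i, k). if k \<ge> 1 then \<sigma> k * \<zeta> i k \<omega> else 0)) \<in> borel_measurable M"
  proof -
    have *: "(\<lambda>\<omega>. case p of (i, k) \<Rightarrow> if k \<ge> 1 then r k * \<zeta> i k \<omega> else 0) \<in> borel_measurable M" for p and r :: "nat \<Rightarrow> real"
      using \<zeta>m[of "snd p" "fst p"] by (cases p; cases "snd p \<ge> 1") auto
    have "(\<lambda>\<omega>. g (\<lambda>(i, k). if k \<ge> 1 then r k * \<zeta> i k \<omega> else 0)) \<in> borel_measurable M" for r :: "nat \<Rightarrow> real"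
      by (rule measurable_compose[OF measurable_coordinatewise_then_product[OF *] gm])
    from this[of "\<lambda>_. 1", unfolded mult_1] this[of \<sigma>]
    show "(\<lambda>\<omega>. g (\<lambda>(i, k). if k \<ge> 1 then \<zeta> i k \<omega> else 0)) \<in> borel_measurable M"
      "(\<lambda>\<omega>. g (\<lambda>(i, k). if k \<ge> 1 then \<sigma> k * \<zeta> i k \<omega> else 0)) \<in> borel_measurable M"
      by simp_all
  qed
  have sm: "(\<lambda>\<omega>. g (H n (?X \<omega>))) \<in> borel_measurable M" "(\<lambda>\<omega>. g (H n (?Y \<omega>))) \<in> borel_measurable M" for n
    using measurable_compose[OF Xm(1) measurable_compose[OF Hm gm]] measurable_compose[OF Xm(2) measurable_compose[OF Hm gm]] by auto
  have l1: "(\<lambda>n. \<integral>\<omega>. g (H n (?X \<omega>)) \<partial>M) \<longlonglongrightarrow> (\<integral>\<omega>. g (\<lambda>(i, k). if k \<ge> 1 then \<zeta> i k \<omega> else 0) \<partial>M)"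
  proof (rule integral_dominated_convergence[where w = "\<lambda>_. B"])
    show "AE \<omega> in M. (\<lambda>n. g (H n (?X \<omega>))) \<longlonglongrightarrow> g (\<lambda>(i, k). if k \<ge> 1 then \<zeta> i k \<omega> else 0)"
      unfolding Hx using all by eventually_elim (rule tend, auto split: prod.splits)
  qed (use fm sm B in auto)
  have l2: "(\<lambda>n. \<integral>\<omega>. g (H n (?Y \<omega>)) \<partial>M) \<longlonglongrightarrow> (\<integral>\<omega>. g (\<lambda>(i, k). if k \<ge> 1 then \<sigma> k * \<zeta> i k \<omega> else 0) \<partial>M)"
  proof (rule integral_dominated_convergence[where w = "\<lambda>_. B"])
    show "AE \<omega> in M. (\<lambda>n. g (H n (?Y \<omega>))) \<longlonglongrightarrow> g (\<lambda>(i, k). if k \<ge> 1 then \<sigma> k * \<zeta> i k \<omega> else 0)"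
      unfolding Hy using all by eventually_elim (rule tend, auto split: prod.splits intro!: tendsto_mult)
  qed (use fm sm B in auto)
  show ?thesis using LIMSEQ_unique[OF l1 l2[folded eqn]] .
qed

section \<open>The path space and reflection of the high modes\<close>

locale path_space =
  fixes T :: real and path_at :: "'p::real_normed_vector \<Rightarrow> real \<Rightarrow> 'a::real_normed_vector"
  assumes T: "0 < T" and ps: "is_path_space T path_at"
begin

lemma path_add: "t \<in> {0..T} \<Longrightarrow> path_at (x + y) t = path_at x t + path_at y t"
  and path_scale: "t \<in> {0..T} \<Longrightarrow> path_at (c *\<^sub>R x) t = c *\<^sub>R path_at x t"
  and path_continuous: "continuous_on {0..T} (path_at x)"
  and path_exists: "continuous_on {0..T} f \<Longrightarrow> \<exists>x. \<forall>t\<in>{0..T}. path_at x t = f t"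
  and path_norm: "norm x = (SUP t\<in>{0..T}. norm (path_at x t))"
  using ps unfolding is_path_space_def by blast+

lemma path_diff: "t \<in> {0..T} \<Longrightarrow> path_at (x - y) t = path_at x t - path_at y t"
  using path_add[of t "x - y" y] by simp

lemma path_zero: "t \<in> {0..T} \<Longrightarrow> path_at 0 t = 0"
  using path_scale[of t 0 0] by simp

lemma path_sum: "t \<in> {0..T} \<Longrightarrow> path_at (sum f A) t = (\<Sum>i\<in>A. path_at (f i) t)"
  by (induction A rule: infinite_finite_induct) (auto simp: path_zero path_add)

lemma norm_path_le: "t \<in> {0..T} \<Longrightarrow> norm (path_at x t) \<le> norm x"
proof -
  assume t: "t \<in> {0..T}"
  have "bounded (path_at x ` {0..T})"
    by (intro compact_imp_bounded compact_continuous_image path_continuous) simp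
  then have "bdd_above ((\<lambda>t. norm (path_at x t)) ` {0..T})"
    unfolding bounded_iff bdd_above_def by auto
  then show ?thesis unfolding path_norm by (rule cSUP_upper2[OF _ t]) simp
qed

lemma path_norm_leI: "(\<And>t. t \<in> {0..T} \<Longrightarrow> norm (path_at x t) \<le> m) \<Longrightarrow> norm x \<le> m"
  unfolding path_norm using T by (intro cSUP_least) auto

lemma path_eqI: "(\<And>t. t \<in> {0..T} \<Longrightarrow> path_at x t = path_at y t) \<Longrightarrow> x = y"
  using path_norm_leI[of "x - y" 0] by (auto simp: path_diff)

definition mk :: "(real \<Rightarrow> 'a) \<Rightarrow> 'p" where
  "mk f = (SOME x. \<forall>t\<in>{0..T}. path_at x t = f t)"

lemma path_mk: "continuous_on {0..T} f \<Longrightarrow> t \<in> {0..T} \<Longrightarrow> path_at (mk f) t = f t"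
  unfolding mk_def using someI_ex[OF path_exists, of f] by blast

text \<open>Hat functions centred at the nodes of the uniform grid. Dividing by their sum yields a partition of unity
on \<open>[0,T]\<close> as soon as that sum is positive, which is easier to see than that it equals 1.\<close>

definition hat :: "nat \<Rightarrow> nat \<Rightarrow> real \<Rightarrow> real" where
  "hat n i t = max 0 (1 - \<bar>n * t / T - i\<bar>)"

definition weight :: "nat \<Rightarrow> nat \<Rightarrow> real \<Rightarrow> real" where
  "weight n i t = hat n i t / (\<Sum>j\<le>n. hat n j t)"

definition bump :: "nat \<Rightarrow> nat \<Rightarrow> 'a \<Rightarrow> 'p" where
  "bump n i y = mk (\<lambda>t. weight n i t *\<^sub>R y)"

text \<open>The minimum keeps the nodes in \<open>[0,T]\<close> also for the indices \<open>i > n\<close>, which occur in sequences of random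
variables indexed by all natural numbers.\<close>

definition node :: "nat \<Rightarrow> nat \<Rightarrow> real" where "node n i = T * min 1 (i / n)"

definition interp :: "nat \<Rightarrow> (nat \<Rightarrow> 'a) \<Rightarrow> 'p" where
  "interp n x = (\<Sum>i\<le>n. bump n i (x i))"

lemma node_in: "node n i \<in> {0..T}"
  using T mult_left_mono[of "min 1 (i / n)" 1 T] by (auto simp: node_def)

lemma hat_nonneg: "0 \<le> hat n i t" by (simp add: hat_def)

lemma hat_sum_pos:
  assumes "t \<in> {0..T}" shows "0 < (\<Sum>j\<le>n. hat n j t)"
proof -
  have "n * t \<le> n * T" using assms by (intro mult_left_mono) auto
  then have x: "0 \<le> n * t / T" "n * t / T \<le> n" using assms T by (auto simp: field_simps)
  define i where "i = nat \<lfloor>n * t / T\<rfloor>"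
  have i: "real i \<le> n * t / T" "n * t / T < real i + 1"
    using x by (auto simp: i_def)
  have "real i \<le> real n" using i x by linarith
  then have "i \<le> n" by simp
  have "0 < hat n i t" using i by (simp add: hat_def)
  then show ?thesis using \<open>i \<le> n\<close> hat_nonneg by (intro sum_pos2[of _ i]) auto
qed

lemma continuous_weight: "continuous_on {0..T} (weight n i)"
proof -
  have h: "continuous_on {0..T} (hat n j)" for j
    unfolding hat_def using T by (intro continuous_intros) auto
  show ?thesis unfolding weight_def
    by (intro continuous_intros h) (use hat_sum_pos less_irrefl in \<open>metis\<close>)
qed

lemma weight_nonneg: "t \<in> {0..T} \<Longrightarrow> 0 \<le> weight n i t"
  using hat_sum_pos[of t n] hat_nonneg by (simp add: weight_def)

lemma weight_sum: "t \<in> {0..T} \<Longrightarrow> (\<Sum>i\<le>n. weight n i t) = 1"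
  using hat_sum_pos[of t n] by (simp add: weight_def sum_divide_distrib[symmetric])

lemma weight_local:
  assumes "0 < n" "i \<le> n" "t \<in> {0..T}" "weight n i t \<noteq> 0" shows "\<bar>t - node n i\<bar> < T / n"
proof -
  have "\<bar>n * t / T - i\<bar> < 1" using assms(4) by (auto simp: weight_def hat_def)
  moreover have "n * t / T - i = (n / T) * (t - node n i)"
    using T assms(1,2) by (simp add: node_def field_simps min_def)
  ultimately have "(n / T) * \<bar>t - node n i\<bar> < 1" using T by (simp add: abs_mult)
  then show ?thesis using T assms(1) by (simp add: field_simps)
qed

lemma path_bump: "t \<in> {0..T} \<Longrightarrow> path_at (bump n i y) t = weight n i t *\<^sub>R y"
  unfolding bump_def by (rule path_mk) (intro continuous_intros continuous_weight)

lemma path_interp: "t \<in> {0..T} \<Longrightarrow> path_at (interp n x) t = (\<Sum>i\<le>n. weight n i t *\<^sub>R x i)"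
  by (simp add: interp_def path_sum path_bump)

lemma bounded_linear_bump: "bounded_linear (bump n i)"
proof (rule bounded_linear_intro[where K = 1])
  show "bump n i (x + y) = bump n i x + bump n i y" for x y
    by (rule path_eqI) (simp add: path_bump path_add scaleR_add_right)
  show "bump n i (c *\<^sub>R x) = c *\<^sub>R bump n i x" for c x
    by (rule path_eqI) (simp add: path_bump path_scale)
  show "norm (bump n i x) \<le> norm x * 1" for x
  proof (rule path_norm_leI)
    fix t assume t: "t \<in> {0..T}"
    have "weight n i t \<le> 1"
    proof (cases "i \<le> n")
      case True
      then have "weight n i t \<le> (\<Sum>j\<le>n. weight n j t)" using weight_nonneg[OF t] by (intro member_le_sum) auto
      then show ?thesis using weight_sum[OF t] by simp
    next
      case False
      have "n * t \<le> n * T" using t by (intro mult_left_mono) auto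
      then have "n * t / T \<le> n" using T by (simp add: field_simps)
      then show ?thesis using False by (simp add: weight_def hat_def)
    qed
    then show "norm (path_at (bump n i x) t) \<le> norm x * 1"
      using weight_nonneg[OF t] by (simp add: path_bump[OF t] mult_left_le_one_le)
  qed
qed

lemma continuous_interp: "continuous_on UNIV (interp n)"
  unfolding interp_def
  by (intro continuous_on_sum continuous_on_compose2[OF linear_continuous_on[OF bounded_linear_bump]]
      continuous_on_product_coordinates) auto

text \<open>A path is a limit of interpolations that depend continuously on finitely many of its values. This makes
continuous functionals of a process measurable as soon as its values are, without discussing the Borel
sets of the path space.\<close>

lemma interp_tendsto: "(\<lambda>n. interp (Suc n) (\<lambda>i. path_at x (node (Suc n) i))) \<longlonglongrightarrow> x"
proof (rule LIMSEQ_I)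
  fix \<epsilon> :: real assume "0 < \<epsilon>"
  have "uniformly_continuous_on {0..T} (path_at x)"
    by (intro compact_uniformly_continuous path_continuous) simp
  then obtain d where d: "0 < d" "\<And>s t. s \<in> {0..T} \<Longrightarrow> t \<in> {0..T} \<Longrightarrow> dist s t < d \<Longrightarrow> dist (path_at x s) (path_at x t) < \<epsilon> / 2"
    unfolding uniformly_continuous_on_def using \<open>0 < \<epsilon>\<close> by (metis half_gt_zero)
  obtain N :: nat where N: "T / d < N" using reals_Archimedean2 by blast
  show "\<exists>N. \<forall>n\<ge>N. norm (interp (Suc n) (\<lambda>i. path_at x (node (Suc n) i)) - x) < \<epsilon>"
  proof (intro exI allI impI)
    fix n assume n: "n \<ge> N"
    have "T / d < Suc n" using N n by simp
    then have small: "T / Suc n < d" using d(1) T by (simp add: field_simps)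
    have "norm (interp (Suc n) (\<lambda>i. path_at x (node (Suc n) i)) - x) \<le> \<epsilon> / 2"
    proof (rule path_norm_leI)
      fix t assume t: "t \<in> {0..T}"
      have "path_at (interp (Suc n) (\<lambda>i. path_at x (node (Suc n) i)) - x) t
        = (\<Sum>i\<le>Suc n. weight (Suc n) i t *\<^sub>R path_at x (node (Suc n) i)) - (\<Sum>i\<le>Suc n. weight (Suc n) i t) *\<^sub>R path_at x t"
        by (simp only: path_diff[OF t] path_interp[OF t] weight_sum[OF t] scaleR_one)
      also have "\<dots> = (\<Sum>i\<le>Suc n. weight (Suc n) i t *\<^sub>R (path_at x (node (Suc n) i) - path_at x t))"
        by (simp only: scaleR_sum_left scaleR_diff_right sum_subtractf)
      also have "norm \<dots> \<le> (\<Sum>i\<le>Suc n. weight (Suc n) i t * (\<epsilon> / 2))"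
      proof (rule sum_norm_le)
        fix i assume i: "i \<in> {..Suc n}"
        show "norm (weight (Suc n) i t *\<^sub>R (path_at x (node (Suc n) i) - path_at x t)) \<le> weight (Suc n) i t * (\<epsilon> / 2)"
        proof (cases "weight (Suc n) i t = 0")
          case False
          then have "\<bar>t - node (Suc n) i\<bar> < d"
            using weight_local[of "Suc n" i t] i t small by simp
          then have "norm (path_at x (node (Suc n) i) - path_at x t) \<le> \<epsilon> / 2"
            using d(2)[OF node_in t, of "Suc n" i] by (simp add: dist_norm abs_minus_commute)
          then show ?thesis
            using mult_left_mono[OF _ weight_nonneg[OF t], of _ "\<epsilon> / 2" "Suc n" i] weight_nonneg[OF t, of "Suc n" i]
            unfolding norm_scaleR abs_of_nonneg[OF weight_nonneg[OF t]] by blast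
        qed simp
      qed
      also have "\<dots> = \<epsilon> / 2" unfolding sum_distrib_right[symmetric] weight_sum[OF t] by simp
      finally show "norm (path_at (interp (Suc n) (\<lambda>i. path_at x (node (Suc n) i)) - x) t) \<le> \<epsilon> / 2" .
    qed
    then show "norm (interp (Suc n) (\<lambda>i. path_at x (node (Suc n) i)) - x) < \<epsilon>" using \<open>0 < \<epsilon>\<close> by simp
  qed
qed

end

locale sep_path_space = path_space T path_at
  for T and path_at :: "'p::real_normed_vector \<Rightarrow> real \<Rightarrow> 'a::{real_normed_vector, second_countable_topology}"
begin

lemma interp_measurable:
  fixes \<Psi> :: "'p \<Rightarrow> real"
  assumes \<Psi>: "continuous_on UNIV \<Psi>" and X: "\<And>i. X i \<in> borel_measurable M"
  shows "(\<lambda>\<omega>. \<Psi> (interp n (\<lambda>i. X i \<omega>))) \<in> borel_measurable M"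
proof -
  have "(\<lambda>\<omega> i. X i \<omega>) \<in> borel_measurable M"
    by (rule measurable_coordinatewise_then_product) (rule X)
  moreover have "(\<lambda>x. \<Psi> (interp n x)) \<in> borel_measurable borel"
    by (intro borel_measurable_continuous_onI continuous_on_compose2[OF \<Psi> continuous_interp]) auto
  ultimately show ?thesis by (rule measurable_compose)
qed

lemma functional_measurable:
  fixes \<Psi> :: "'p \<Rightarrow> real"
  assumes \<Psi>: "continuous_on UNIV \<Psi>" and X: "\<And>t. t \<in> {0..T} \<Longrightarrow> (\<lambda>\<omega>. path_at (X \<omega>) t) \<in> borel_measurable M"
  shows "(\<lambda>\<omega>. \<Psi> (X \<omega>)) \<in> borel_measurable M"
proof (rule borel_measurable_LIMSEQ_real)
  fix \<omega>
  show "(\<lambda>n. \<Psi> (interp (Suc n) (\<lambda>i. path_at (X \<omega>) (node (Suc n) i)))) \<longlonglongrightarrow> \<Psi> (X \<omega>)"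
    by (rule continuous_on_tendsto_compose[OF \<Psi> interp_tendsto]) auto
qed (intro interp_measurable \<Psi> X node_in)

end

text \<open>Changing the sign of the modes beyond \<open>N\<close> does not change the law of the stochastic convolution. For
interpolated and truncated paths this is \<open>sign_flip_expectation\<close>; the truncation is removed first, then the
interpolation, both by bounded convergence.\<close>

lemma reflection:
  fixes e :: "nat \<Rightarrow> 'h::{real_inner,banach,second_countable_topology}"
    and J :: "'h \<Rightarrow> 'a::{real_inner,banach,second_countable_topology}"
    and path_at :: "'p::real_normed_vector \<Rightarrow> real \<Rightarrow> 'a" and \<Psi> :: "'p \<Rightarrow> real"
  assumes J: "scale lam e s J" and s: "0 \<le> s" and T: "0 < T" and ps: "is_path_space T path_at"
    and W: "assumption_W M G \<beta>"
    and Z: "is_stochastic_convolution lam e q M \<beta> T J path_at Z"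
    and \<Psi>: "continuous_on UNIV \<Psi>" and B: "\<And>x. \<bar>\<Psi> x\<bar> \<le> B"
    and R: "\<And>\<omega> t. t \<in> {0..T} \<Longrightarrow> path_at (R \<omega>) t = 2 *\<^sub>R galerkin_proj e J N (path_at (Z \<omega>) t) - path_at (Z \<omega>) t"
  shows "(\<integral>\<omega>. \<Psi> (Z \<omega>) \<partial>M) = (\<integral>\<omega>. \<Psi> (R \<omega>) \<partial>M)"
proof -
  interpret J: scale lam e s J by fact
  interpret sep_path_space T path_at using T ps by unfold_locales
  interpret prob_space M using W by (simp add: assumption_W_def)
  note wn = assumption_W_wiener[OF W]
  define \<sigma> :: "nat \<Rightarrow> real" where "\<sigma> k = (if k \<le> N then 1 else - 1)" for k
  have Zm: "(\<lambda>\<omega>. path_at (Z \<omega>) t) \<in> borel_measurable M" if "t \<in> {0..T}" for t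
    using Z that by (auto simp: is_stochastic_convolution_def)
  have Rm: "(\<lambda>\<omega>. path_at (R \<omega>) t) \<in> borel_measurable M" if "t \<in> {0..T}" for t
  proof -
    have "(\<lambda>\<omega>. galerkin_proj e J N (path_at (Z \<omega>) t)) \<in> borel_measurable M"
      by (rule borel_measurable_continuous_on[OF linear_continuous_on[OF J.bounded_linear_galerkin] Zm[OF that]])
    then show ?thesis unfolding R[OF that] using Zm[OF that] by measurable
  qed
  have step: "(\<integral>\<omega>. \<Psi> (interp n (\<lambda>i. path_at (Z \<omega>) (node n i))) \<partial>M) = (\<integral>\<omega>. \<Psi> (interp n (\<lambda>i. path_at (R \<omega>) (node n i))) \<partial>M)" for n
  proof -
    define \<zeta> where "\<zeta> i k \<omega> = pairing e J k (path_at (Z \<omega>) (node n i))" for i k \<omega>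
    define E where "E m c = (\<lambda>i. \<Sum>k=1..m. c (i, k) *\<^sub>R J (e k))" for m and c :: "nat \<times> nat \<Rightarrow> real"
    have contE: "continuous_on UNIV (E m)" for m
      unfolding E_def by (intro continuous_on_coordinatewise_then_product continuous_intros continuous_on_product_coordinates)
    have contg: "continuous_on UNIV (\<lambda>c. \<Psi> (interp n (E m c)))" for m
      by (rule continuous_on_compose2[OF \<Psi> continuous_on_compose2[OF continuous_interp contE]]) auto
    have \<zeta>m: "\<zeta> i k \<in> borel_measurable M" for i k
      unfolding \<zeta>_def by (rule borel_measurable_continuous_on[OF linear_continuous_on[OF J.bounded_linear_coef] Zm[OF node_in]])
    have sg: "\<sigma> k = 1 \<or> \<sigma> k = -1" for k by (simp add: \<sigma>_def)
    have nn: "0 \<le> node n i" for i using node_in[of n i] by simp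
    have lim: "AE \<omega> in M. (\<lambda>n'. sqrt (q k) * ou_sum (lam k) (node n i) (Suc n') (\<lambda>s. \<beta> k s \<omega>)) \<longlonglongrightarrow> \<zeta> i k \<omega>"
      if "k \<ge> 1" for i k
      unfolding \<zeta>_def by (rule convolution_coefficient[OF J.spectral_axioms J s wn Z node_in that])
    have flip: "(\<integral>\<omega>. \<Psi> (interp n (E m (\<lambda>(i, k). if k \<ge> 1 then \<zeta> i k \<omega> else 0))) \<partial>M)
        = (\<integral>\<omega>. \<Psi> (interp n (E m (\<lambda>(i, k). if k \<ge> 1 then \<sigma> k * \<zeta> i k \<omega> else 0))) \<partial>M)" for m
      by (rule sign_flip_expectation[OF W sg nn \<zeta>m lim contg B])
    have E1: "E m (\<lambda>(i, k). if k \<ge> 1 then \<zeta> i k \<omega> else 0) = (\<lambda>i. J.part {1..m} (path_at (Z \<omega>) (node n i)))" for m \<omega>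
      unfolding E_def J.part_def \<zeta>_def by (intro ext sum.cong) auto
    have E2: "E m (\<lambda>(i, k). if k \<ge> 1 then \<sigma> k * \<zeta> i k \<omega> else 0) = (\<lambda>i. J.part {1..m} (path_at (R \<omega>) (node n i)))" for m \<omega>
      unfolding E_def J.part_def \<zeta>_def R[OF node_in]
      by (intro ext sum.cong) (auto simp: J.coef_diff J.coef_scale J.pairing_galerkin \<sigma>_def)
    have tend: "(\<lambda>m. \<Psi> (interp n (\<lambda>i. J.part {1..m} (x i)))) \<longlonglongrightarrow> \<Psi> (interp n x)" for x
    proof (rule continuous_on_tendsto_compose[OF \<Psi>])
      show "(\<lambda>m. interp n (\<lambda>i. J.part {1..m} (x i))) \<longlonglongrightarrow> interp n x"
        unfolding interp_def
        by (intro tendsto_sum bounded_linear.tendsto[OF bounded_linear_bump] J.expansion_tendsto)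
    qed auto
    have pm: "(\<lambda>\<omega>. J.part {1..m} (path_at (X \<omega>) t)) \<in> borel_measurable M"
      if "(\<lambda>\<omega>. path_at (X \<omega>) t) \<in> borel_measurable M" for m X t
      using borel_measurable_continuous_on[OF linear_continuous_on[OF J.bounded_linear_galerkin] that]
      by (simp add: J.galerkin_proj_part)
    have conv: "(\<lambda>m. \<integral>\<omega>. \<Psi> (interp n (\<lambda>i. J.part {1..m} (path_at (X \<omega>) (node n i)))) \<partial>M)
       \<longlonglongrightarrow> (\<integral>\<omega>. \<Psi> (interp n (\<lambda>i. path_at (X \<omega>) (node n i))) \<partial>M)"
      if X: "\<And>t. t \<in> {0..T} \<Longrightarrow> (\<lambda>\<omega>. path_at (X \<omega>) t) \<in> borel_measurable M" for X
    proof (rule integral_dominated_convergence[where w = "\<lambda>_. B"])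
      show "(\<lambda>\<omega>. \<Psi> (interp n (\<lambda>i. path_at (X \<omega>) (node n i)))) \<in> borel_measurable M"
        by (intro interp_measurable[OF \<Psi>] X node_in)
      show "(\<lambda>\<omega>. \<Psi> (interp n (\<lambda>i. J.part {1..m} (path_at (X \<omega>) (node n i))))) \<in> borel_measurable M" for m
        by (intro interp_measurable[OF \<Psi>] pm X node_in)
      show "AE \<omega> in M. (\<lambda>m. \<Psi> (interp n (\<lambda>i. J.part {1..m} (path_at (X \<omega>) (node n i)))))
          \<longlonglongrightarrow> \<Psi> (interp n (\<lambda>i. path_at (X \<omega>) (node n i)))"
        by (intro AE_I2 tend)
    qed (use B in auto)
    show ?thesis
    proof (rule LIMSEQ_unique)
      show "(\<lambda>m. \<integral>\<omega>. \<Psi> (interp n (\<lambda>i. J.part {1..m} (path_at (Z \<omega>) (node n i)))) \<partial>M)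
        \<longlonglongrightarrow> (\<integral>\<omega>. \<Psi> (interp n (\<lambda>i. path_at (Z \<omega>) (node n i))) \<partial>M)"
        by (rule conv[OF Zm])
      show "(\<lambda>m. \<integral>\<omega>. \<Psi> (interp n (\<lambda>i. J.part {1..m} (path_at (Z \<omega>) (node n i)))) \<partial>M)
        \<longlonglongrightarrow> (\<integral>\<omega>. \<Psi> (interp n (\<lambda>i. path_at (R \<omega>) (node n i))) \<partial>M)"
        unfolding flip[unfolded E1 E2] by (rule conv[OF Rm])
    qed
  qed
  have conv: "(\<lambda>n. \<integral>\<omega>. \<Psi> (interp (Suc n) (\<lambda>i. path_at (X \<omega>) (node (Suc n) i))) \<partial>M) \<longlonglongrightarrow> (\<integral>\<omega>. \<Psi> (X \<omega>) \<partial>M)"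
    if X: "\<And>t. t \<in> {0..T} \<Longrightarrow> (\<lambda>\<omega>. path_at (X \<omega>) t) \<in> borel_measurable M" for X
  proof (rule integral_dominated_convergence[where w = "\<lambda>_. B"])
    show "AE \<omega> in M. (\<lambda>n. \<Psi> (interp (Suc n) (\<lambda>i. path_at (X \<omega>) (node (Suc n) i)))) \<longlonglongrightarrow> \<Psi> (X \<omega>)"
      by (intro AE_I2 continuous_on_tendsto_compose[OF \<Psi> interp_tendsto]) auto
    show "(\<lambda>\<omega>. \<Psi> (interp (Suc n) (\<lambda>i. path_at (X \<omega>) (node (Suc n) i)))) \<in> borel_measurable M" for n
      by (intro interp_measurable[OF \<Psi>] X node_in)
    show "(\<lambda>\<omega>. \<Psi> (X \<omega>)) \<in> borel_measurable M" by (rule functional_measurable[OF \<Psi> X])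
  qed (use B in auto)
  show ?thesis
  proof (rule LIMSEQ_unique)
    show "(\<lambda>n. \<integral>\<omega>. \<Psi> (interp (Suc n) (\<lambda>i. path_at (Z \<omega>) (node (Suc n) i))) \<partial>M) \<longlonglongrightarrow> (\<integral>\<omega>. \<Psi> (Z \<omega>) \<partial>M)"
      by (rule conv[OF Zm])
    show "(\<lambda>n. \<integral>\<omega>. \<Psi> (interp (Suc n) (\<lambda>i. path_at (Z \<omega>) (node (Suc n) i))) \<partial>M) \<longlonglongrightarrow> (\<integral>\<omega>. \<Psi> (R \<omega>) \<partial>M)"
      unfolding step by (rule conv[OF Rm])
  qed
qed

section \<open>Decay of the high modes of the noise\<close>

lemma neg_A_power_trace:
  fixes e :: "nat \<Rightarrow> 'h::{real_inner,banach}"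
  assumes sp: "spectral lam e" and Q: "assumption_Q Q q e" and k: "k \<ge> 1"
  shows "(neg_A_power lam e a \<circ> Q) (e k) \<bullet> e k = lam k powr a * q k"
proof -
  interpret spectral lam e by fact
  have o: "e i \<bullet> e j = (if i = j then 1 else 0)" if "i \<ge> 1" "j \<ge> 1" for i j
    using onb that by (simp add: orthonormal_basis_def)
  have Qe: "Q (e k) = q k *\<^sub>R e k" using Q k by (simp add: assumption_Q_def)
  have "neg_A_power lam e a (q k *\<^sub>R e k) = (\<Sum>\<^sub>\<infinity>j\<in>{k}. (lam j powr a * ((q k *\<^sub>R e k) \<bullet> e j)) *\<^sub>R e j)"
    unfolding neg_A_power_def by (rule infsum_cong_neutral) (use k o in auto)
  then show ?thesis using k by (simp add: Qe o)
qed

text \<open>The trace condition holds at some exponent above \<open>r\<close> by definition of the supremum, and lowering the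
exponent costs only a power of \<open>\<lambda>\<^sub>1\<close>.\<close>

lemma trace_summable:
  fixes e :: "nat \<Rightarrow> 'h::{real_inner,banach}"
  assumes sp: "spectral lam e" and Q: "assumption_Q Q q e"
    and tr: "finite_trace e (neg_A_power lam e (-1) \<circ> Q)" and r: "r < s_Q lam e Q"
  shows "(\<lambda>k. lam k powr (r - 1) * q k) summable_on {1..}" and "s_Q lam e Q \<le> 1"
proof -
  interpret spectral lam e by fact
  define S where "S = {r. 0 \<le> r \<and> finite_trace e (neg_A_power lam e (r - 1) \<circ> Q)}"
  have S: "r \<in> S \<longleftrightarrow> 0 \<le> r \<and> (\<lambda>k. lam k powr (r - 1) * q k) summable_on {1..}" for r
  proof -
    have "(\<lambda>k. (neg_A_power lam e (r - 1) \<circ> Q) (e k) \<bullet> e k) summable_on {1..}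
       \<longleftrightarrow> (\<lambda>k. lam k powr (r - 1) * q k) summable_on {1..}"
      by (rule summable_on_cong) (use neg_A_power_trace[OF sp Q] in auto)
    then show ?thesis by (simp add: S_def finite_trace_def)
  qed
  have "0 \<in> S" using tr by (simp add: S_def)
  then have "ereal 0 \<le> Sup (ereal ` S)" by (intro Sup_upper) auto
  then have s0: "0 \<le> s_Q0 lam e Q" by (simp add: s_Q0_def S_def zero_ereal_def)
  have eq: "ereal (s_Q lam e Q) = min (s_Q0 lam e Q) 1"
    unfolding s_Q_def using s0 by (cases "s_Q0 lam e Q") (auto simp: min_def one_ereal_def)
  then have "ereal (s_Q lam e Q) \<le> ereal 1" by (simp add: one_ereal_def)
  then show "s_Q lam e Q \<le> 1" by simp
  have "ereal r < min (s_Q0 lam e Q) 1" unfolding eq[symmetric] using r by simp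
  then have "ereal r < s_Q0 lam e Q" by simp
  then obtain r' where r': "r' \<in> S" "r < r'"
    unfolding s_Q0_def S_def[symmetric] less_Sup_iff by auto
  have q: "0 \<le> q k" if "k \<ge> 1" for k using Q that by (simp add: assumption_Q_def)
  have "(\<lambda>k. lam 1 powr (r - r') * (lam k powr (r' - 1) * q k)) summable_on {1..}"
    using r'(1) by (intro summable_on_cmult_right) (simp add: S)
  then show "(\<lambda>k. lam k powr (r - 1) * q k) summable_on {1..}"
  proof (rule summable_on_comparison_test)
    fix k :: nat assume "k \<in> {1..}"
    then have k: "k \<ge> 1" by simp
    have "lam k powr (r - 1) = lam k powr (r - r') * lam k powr (r' - 1)" by (simp add: powr_add[symmetric])
    also have "\<dots> \<le> lam 1 powr (r - r') * lam k powr (r' - 1)"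
      using lam_pos[of 1] lam_mono[of 1 k] k r'(2) by (intro mult_right_mono powr_mono2') auto
    finally have "lam k powr (r - 1) \<le> lam 1 powr (r - r') * lam k powr (r' - 1)" .
    from mult_right_mono[OF this q[OF k]]
    show "lam k powr (r - 1) * q k \<le> lam 1 powr (r - r') * (lam k powr (r' - 1) * q k)"
      by (simp only: mult.assoc)
    show "0 \<le> lam k powr (r - 1) * q k" using q[OF k] by simp
  qed
qed

lemma closure_Rats_Icc: assumes "0 < (T::real)" shows "closure ({0..T} \<inter> \<rat>) = {0..T}"
proof
  show "closure ({0..T} \<inter> \<rat>) \<subseteq> {0..T}" by (rule closure_minimal) auto
  have "closure ({0<..<T} \<inter> \<rat>) = closure {0<..<T}"
    by (rule closure_open_Int_superset) (auto simp: Rats_closure_real)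
  also have "\<dots> = {0..T}" using assms by simp
  finally have eq: "closure ({0<..<T} \<inter> \<rat>) = {0..T}" .
  have "{0<..<T} \<inter> \<rat> \<subseteq> {0..T} \<inter> \<rat>" by (rule Int_mono) auto
  then show "{0..T} \<subseteq> closure ({0..T} \<inter> \<rat>)"
    unfolding eq[symmetric] by (rule closure_mono)
qed

text \<open>For \<open>k > N\<close> the \<open>k\<close>-th term of the squared norm is at most \<open>\<lambda>\<^sub>k\<^bsup>s-2\<alpha>\<^esup> q\<^sub>k R\<^sub>k\<close> with \<open>E R\<^sub>k \<le> C\<close>, uniformly in time. The choice
\<open>2\<alpha> = 1 - \<epsilon>/2\<close> gives \<open>s - 2\<alpha> = (s\<^sub>Q - \<epsilon>/2 - 1) - (s\<^sub>Q - s - \<epsilon>)\<close>: the first part belongs to a convergent trace, the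
second one is the rate. The coefficients are known almost surely at rational times only, which suffices
because paths are continuous.\<close>

lemma noise_tail:
  fixes e :: "nat \<Rightarrow> 'h::{real_inner,banach,second_countable_topology}"
    and J :: "'h \<Rightarrow> 'a::{real_inner,banach,second_countable_topology}"
    and path_at :: "'p::real_normed_vector \<Rightarrow> real \<Rightarrow> 'a" and M :: "'w measure"
  assumes J: "scale lam e s J" and s: "0 \<le> s" and T: "0 < T" and ps: "is_path_space T path_at"
    and W: "assumption_W M G \<beta>" and Q: "assumption_Q Q q e"
    and tr: "finite_trace e (neg_A_power lam e (-1) \<circ> Q)"
    and Z: "is_stochastic_convolution lam e q M \<beta> T J path_at Z"
    and \<epsilon>: "0 < \<epsilon>" "\<epsilon> < s_Q lam e Q - s"
  shows "\<exists>C>0. \<forall>N Y. (\<forall>\<omega>. \<forall>t\<in>{0..T}. path_at (Y \<omega>) t = path_at (Z \<omega>) t - galerkin_proj e J N (path_at (Z \<omega>) t)) \<longrightarrow>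
     integrable M (\<lambda>\<omega>. (norm (Y \<omega>))\<^sup>2) \<and> (\<integral>\<omega>. (norm (Y \<omega>))\<^sup>2 \<partial>M) \<le> C * lam (N + 1) powr (- (s_Q lam e Q - s - \<epsilon>))"
proof -
  interpret J: scale lam e s J by fact
  interpret sep_path_space T path_at using T ps by unfold_locales
  interpret prob_space M using W by (simp add: assumption_W_def)
  note wn = assumption_W_wiener[OF W]
  have q: "0 \<le> q k" if "k \<ge> 1" for k using Q that by (simp add: assumption_Q_def)
  define \<delta> where "\<delta> = s_Q lam e Q - s - \<epsilon>"
  define \<alpha> where "\<alpha> = 1 / 2 - \<epsilon> / 4"
  have rq: "s_Q lam e Q - \<epsilon> / 2 < s_Q lam e Q" using \<epsilon> by simp
  have sQ1: "s_Q lam e Q \<le> 1" by (rule trace_summable(2)[OF J.spectral_axioms Q tr rq])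
  have \<delta>: "0 < \<delta>" and \<alpha>: "0 < \<alpha>" "\<alpha> < 1 / 2" using \<epsilon> s sQ1 by (auto simp: \<delta>_def \<alpha>_def)
  define g where "g k = lam k powr (s_Q lam e Q - \<epsilon> / 2 - 1) * q k" for k
  have SucUNIV: "range Suc = {1..}" by (auto simp: image_iff Suc_le_eq gr0_conv_Suc)
  have "g summable_on (range Suc)"
    using trace_summable(1)[OF J.spectral_axioms Q tr rq] unfolding g_def by (simp add: SucUNIV)
  then have gs: "summable (\<lambda>k. g (Suc k))"
    by (subst (asm) summable_on_reindex) (auto simp: comp_def dest: summable_on_imp_summable)
  have g0: "0 \<le> g (Suc k)" for k using q[of "Suc k"] by (simp add: g_def)
  obtain C where C: "0 < (C::real)"
    and sup: "\<And>(M :: 'w measure) G b. wiener M G b \<Longrightarrow> \<exists>R. ou_majorant M b T \<alpha> C R"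
    using wiener_ou_sup[OF T \<alpha>, where 'w = 'w] by blast
  have "\<forall>k. \<exists>R. ou_majorant M (\<beta> (Suc k)) T \<alpha> C R"
    by (intro allI sup[OF wn]) simp
  from choice[OF this] obtain R where R: "\<And>k. ou_majorant M (\<beta> (Suc k)) T \<alpha> C (R k)" by blast
  note majorant = R[unfolded ou_majorant_def]
  have Rm[measurable]: "R k \<in> borel_measurable M" for k by (rule majorant[THEN conjunct1])
  have RC: "(\<integral>\<^sup>+\<omega>. R k \<omega> \<partial>M) \<le> ennreal C" for k by (rule majorant[THEN conjunct2, THEN conjunct1])
  define c where "c N k = (if Suc k \<le> N then 0 else lam (Suc k) powr (s - 2 * \<alpha>) * q (Suc k))" for N k
  have c0: "0 \<le> c N k" for N k using q[of "Suc k"] by (simp add: c_def)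
  have cg: "c N k \<le> lam (N + 1) powr (- \<delta>) * g (Suc k)" for N k
  proof (cases "Suc k \<le> N")
    case False
    have "s - 2 * \<alpha> = - \<delta> + (s_Q lam e Q - \<epsilon> / 2 - 1)" by (simp add: \<delta>_def \<alpha>_def field_simps)
    then have "lam (Suc k) powr (s - 2 * \<alpha>) = lam (Suc k) powr (- \<delta>) * lam (Suc k) powr (s_Q lam e Q - \<epsilon> / 2 - 1)"
      by (simp only: powr_add)
    also have "\<dots> \<le> lam (N + 1) powr (- \<delta>) * lam (Suc k) powr (s_Q lam e Q - \<epsilon> / 2 - 1)"
      using False \<delta> J.lam_pos[of "N + 1"] J.lam_mono[of "N + 1" "Suc k"] by (intro mult_right_mono powr_mono2') auto
    finally have le: "lam (Suc k) powr (s - 2 * \<alpha>) \<le> lam (N + 1) powr (- \<delta>) * lam (Suc k) powr (s_Q lam e Q - \<epsilon> / 2 - 1)" .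
    have "lam (Suc k) powr (s - 2 * \<alpha>) * q (Suc k) \<le> lam (N + 1) powr (- \<delta>) * lam (Suc k) powr (s_Q lam e Q - \<epsilon> / 2 - 1) * q (Suc k)"
      by (intro mult_right_mono le q) simp
    then show ?thesis using False by (simp add: c_def g_def mult.assoc)
  qed (use g0[of k] in \<open>simp add: c_def\<close>)
  define V where "V N \<omega> = (\<Sum>k. ennreal (c N k) * R k \<omega>)" for N \<omega>
  have Vm[measurable]: "V N \<in> borel_measurable M" for N unfolding V_def by measurable
  define D where "D = C * (\<Sum>k. g (Suc k))"
  have D0: "0 \<le> D" using C g0 by (auto simp: D_def intro!: mult_nonneg_nonneg suminf_nonneg gs)
  have EV: "(\<integral>\<^sup>+\<omega>. V N \<omega> \<partial>M) \<le> ennreal (D * lam (N + 1) powr (- \<delta>))" for N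
  proof -
    have "(\<integral>\<^sup>+\<omega>. V N \<omega> \<partial>M) = (\<Sum>k. ennreal (c N k) * (\<integral>\<^sup>+\<omega>. R k \<omega> \<partial>M))"
      unfolding V_def by (subst nn_integral_suminf) (auto simp: nn_integral_cmult)
    also have "\<dots> \<le> (\<Sum>k. ennreal (lam (N + 1) powr (- \<delta>) * C * g (Suc k)))"
    proof (rule suminf_le)
      fix k
      have "ennreal (c N k) * (\<integral>\<^sup>+\<omega>. R k \<omega> \<partial>M) \<le> ennreal (lam (N + 1) powr (- \<delta>) * g (Suc k)) * ennreal C"
        by (intro mult_mono RC ennreal_leI cg) auto
      also have "\<dots> = ennreal (lam (N + 1) powr (- \<delta>) * C * g (Suc k))"
        using C g0[of k] by (simp add: ennreal_mult[symmetric] ac_simps)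
      finally show "ennreal (c N k) * (\<integral>\<^sup>+\<omega>. R k \<omega> \<partial>M) \<le> ennreal (lam (N + 1) powr (- \<delta>) * C * g (Suc k))" .
    qed auto
    also have "\<dots> = ennreal (\<Sum>k. lam (N + 1) powr (- \<delta>) * C * g (Suc k))"
      using C g0 by (intro suminf_ennreal2 summable_mult gs) auto
    also have "(\<Sum>k. lam (N + 1) powr (- \<delta>) * C * g (Suc k)) = D * lam (N + 1) powr (- \<delta>)"
      by (simp add: suminf_mult[OF gs] D_def)
    finally show ?thesis .
  qed
  have Zm: "(\<lambda>\<omega>. path_at (Z \<omega>) t) \<in> borel_measurable M" if "t \<in> {0..T}" for t
    using Z that by (auto simp: is_stochastic_convolution_def)
  have lims: "AE \<omega> in M. \<forall>p\<in>UNIV \<times> ({0..T} \<inter> \<rat>).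
     (\<lambda>n. sqrt (q (Suc (fst p))) * ou_sum (lam (Suc (fst p))) (snd p) (Suc n) (\<lambda>s. \<beta> (Suc (fst p)) s \<omega>)) \<longlonglongrightarrow> pairing e J (Suc (fst p)) (path_at (Z \<omega>) (snd p))"
  proof (subst AE_ball_countable)
    show "countable ((UNIV :: nat set) \<times> ({0..T} \<inter> \<rat>))" by (intro countable_SIGMA countable_Int2 countable_rat) auto
    show "\<forall>p\<in>(UNIV :: nat set) \<times> ({0..T} \<inter> \<rat>). AE \<omega> in M.
     (\<lambda>n. sqrt (q (Suc (fst p))) * ou_sum (lam (Suc (fst p))) (snd p) (Suc n) (\<lambda>s. \<beta> (Suc (fst p)) s \<omega>)) \<longlonglongrightarrow> pairing e J (Suc (fst p)) (path_at (Z \<omega>) (snd p))"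
      by (intro ballI convolution_coefficient[OF J.spectral_axioms J s wn Z]) auto
  qed
  have RA': "AE \<omega> in M. \<forall>k. \<forall>l>0. \<forall>t\<in>{0..T}. \<forall>n.
            ennreal ((ou_sum l t n (\<lambda>s. \<beta> (Suc k) s \<omega>))\<^sup>2) \<le> R k \<omega> * ennreal (l powr (- (2 * \<alpha>)))"
    unfolding AE_all_countable by (intro allI majorant[THEN conjunct2, THEN conjunct2])
  show ?thesis
  proof (intro exI[of _ "D + 1"] conjI allI impI)
    show "0 < D + 1" using D0 by simp
    fix N Y assume Y: "\<forall>\<omega>. \<forall>t\<in>{0..T}. path_at (Y \<omega>) t = path_at (Z \<omega>) t - galerkin_proj e J N (path_at (Z \<omega>) t)"
    have Ym: "(\<lambda>\<omega>. (norm (Y \<omega>))\<^sup>2) \<in> borel_measurable M"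
    proof (rule functional_measurable[of "\<lambda>x. (norm x)\<^sup>2"])
      show "continuous_on UNIV (\<lambda>x :: 'p. (norm x)\<^sup>2)" by (intro continuous_intros)
      fix t assume t: "t \<in> {0..T}"
      have "(\<lambda>\<omega>. galerkin_proj e J N (path_at (Z \<omega>) t)) \<in> borel_measurable M"
        by (rule borel_measurable_continuous_on[OF linear_continuous_on[OF J.bounded_linear_galerkin] Zm[OF t]])
      then show "(\<lambda>\<omega>. path_at (Y \<omega>) t) \<in> borel_measurable M"
        using Y t Zm[OF t] by (subst measurable_cong[OF Y[rule_format, OF t]]) measurable
    qed
    have "AE \<omega> in M. ennreal ((norm (Y \<omega>))\<^sup>2) \<le> V N \<omega>"
      using lims RA'
    proof eventually_elim
      fix \<omega>
      assume lim: "\<forall>p\<in>UNIV \<times> ({0..T} \<inter> \<rat>). (\<lambda>n. sqrt (q (Suc (fst p))) * ou_sum (lam (Suc (fst p))) (snd p) (Suc n) (\<lambda>s. \<beta> (Suc (fst p)) s \<omega>)) \<longlonglongrightarrow> pairing e J (Suc (fst p)) (path_at (Z \<omega>) (snd p))"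
        and R: "\<forall>k. \<forall>l>0. \<forall>t\<in>{0..T}. \<forall>n. ennreal ((ou_sum l t n (\<lambda>s. \<beta> (Suc k) s \<omega>))\<^sup>2) \<le> R k \<omega> * ennreal (l powr (- (2 * \<alpha>)))"
      show "ennreal ((norm (Y \<omega>))\<^sup>2) \<le> V N \<omega>"
      proof (cases "V N \<omega> = \<infinity>")
        case False
        define v where "v = enn2real (V N \<omega>)"
        have v: "V N \<omega> = ennreal v" "0 \<le> v" using False by (auto simp: v_def less_top)
        have coef_bound: "ennreal (lam (Suc k) powr s * (pairing e J (Suc k) (path_at (Y \<omega>) t))\<^sup>2) \<le> ennreal (c N k) * R k \<omega>"
          if t: "t \<in> {0..T} \<inter> \<rat>" for t k
        proof (cases "Suc k \<le> N")
          case True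
          then show ?thesis using Y t by (simp add: J.coef_diff J.pairing_galerkin)
        next
          case F: False
          then have pY: "pairing e J (Suc k) (path_at (Y \<omega>) t) = pairing e J (Suc k) (path_at (Z \<omega>) t)"
            using Y t by (simp add: J.coef_diff J.pairing_galerkin)
          have l: "(\<lambda>n. sqrt (q (Suc k)) * ou_sum (lam (Suc k)) t (Suc n) (\<lambda>s. \<beta> (Suc k) s \<omega>)) \<longlonglongrightarrow> pairing e J (Suc k) (path_at (Z \<omega>) t)"
            using lim[rule_format, of "(k, t)"] t by simp
          have a: "(\<lambda>n. ennreal (lam (Suc k) powr s * (sqrt (q (Suc k)) * ou_sum (lam (Suc k)) t (Suc n) (\<lambda>s. \<beta> (Suc k) s \<omega>))\<^sup>2))
             \<longlonglongrightarrow> ennreal (lam (Suc k) powr s * (pairing e J (Suc k) (path_at (Z \<omega>) t))\<^sup>2)"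
            by (intro tendsto_ennrealI tendsto_intros l)
          have b: "ennreal (lam (Suc k) powr s * (sqrt (q (Suc k)) * ou_sum (lam (Suc k)) t (Suc n) (\<lambda>s. \<beta> (Suc k) s \<omega>))\<^sup>2)
              \<le> ennreal (c N k) * R k \<omega>" for n
          proof -
            let ?o = "(ou_sum (lam (Suc k)) t (Suc n) (\<lambda>s. \<beta> (Suc k) s \<omega>))\<^sup>2"
            have "ennreal (lam (Suc k) powr s * (sqrt (q (Suc k)) * ou_sum (lam (Suc k)) t (Suc n) (\<lambda>s. \<beta> (Suc k) s \<omega>))\<^sup>2)
               = ennreal (lam (Suc k) powr s * q (Suc k)) * ennreal ?o"
              using q[of "Suc k"] by (subst ennreal_mult[symmetric]) (auto simp: power_mult_distrib)
            also have "\<dots> \<le> ennreal (lam (Suc k) powr s * q (Suc k)) * (R k \<omega> * ennreal (lam (Suc k) powr (- (2 * \<alpha>))))"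
              using R J.lam_pos[of "Suc k"] t by (intro mult_left_mono) auto
            also have "\<dots> = ennreal ((lam (Suc k) powr s * q (Suc k)) * lam (Suc k) powr (- (2 * \<alpha>))) * R k \<omega>"
              using q[of "Suc k"] by (subst ennreal_mult) (auto simp: ac_simps)
            also have "(lam (Suc k) powr s * q (Suc k)) * lam (Suc k) powr (- (2 * \<alpha>)) = c N k"
              using F powr_add[of "lam (Suc k)" s "- (2 * \<alpha>)"] by (simp add: c_def)
            finally show ?thesis .
          qed
          show ?thesis unfolding pY by (rule LIMSEQ_le_const2[OF a]) (use b in blast)
        qed
        have "norm (path_at (Y \<omega>) t) \<le> sqrt v" if t: "t \<in> {0..T} \<inter> \<rat>" for t
        proof -
          have "(norm (path_at (Y \<omega>) t))\<^sup>2 \<le> v"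
          proof (rule J.norm_le_coefI)
            fix n
            let ?a = "\<lambda>k. lam k powr s * (pairing e J k (path_at (Y \<omega>) t))\<^sup>2"
            have "ennreal (\<Sum>k\<in>{1..n}. ?a k) = (\<Sum>k<n. ennreal (?a (Suc k)))"
              by (subst sum_ennreal) (auto simp: sum.atLeast1_atMost_eq)
            also have "\<dots> \<le> (\<Sum>k<n. ennreal (c N k) * R k \<omega>)" by (intro sum_mono coef_bound t)
            also have "\<dots> \<le> V N \<omega>" unfolding V_def by (rule sum_le_suminf) auto
            finally show "(\<Sum>k\<in>{1..n}. ?a k) \<le> v" using v by simp
          qed
          then show ?thesis by (simp add: real_le_rsqrt)
        qed
        then have le: "norm (path_at (Y \<omega>) t) \<le> sqrt v" if "t \<in> {0..T}" for t
          using continuous_le_on_closure[of "{0..T} \<inter> \<rat>" "\<lambda>t. norm (path_at (Y \<omega>) t)" t "sqrt v"] that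
          unfolding closure_Rats_Icc[OF T] by (auto intro: continuous_intros path_continuous)
        have "norm (Y \<omega>) \<le> sqrt v" by (rule path_norm_leI[OF le])
        then have "(norm (Y \<omega>))\<^sup>2 \<le> (sqrt v)\<^sup>2" by (intro power_mono) auto
        then show ?thesis using v by (simp add: ennreal_leI)
      qed simp
    qed
    then have nn: "(\<integral>\<^sup>+\<omega>. ennreal ((norm (Y \<omega>))\<^sup>2) \<partial>M) \<le> ennreal (D * lam (N + 1) powr (- \<delta>))"
      by (rule order_trans[OF nn_integral_mono_AE EV])
    show int: "integrable M (\<lambda>\<omega>. (norm (Y \<omega>))\<^sup>2)"
    proof (rule integrableI_bounded[OF Ym])
      have "(\<integral>\<^sup>+\<omega>. ennreal (norm ((norm (Y \<omega>))\<^sup>2)) \<partial>M) = (\<integral>\<^sup>+\<omega>. ennreal ((norm (Y \<omega>))\<^sup>2) \<partial>M)" by simp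
      also have "\<dots> < \<infinity>" by (rule le_less_trans[OF nn]) simp
      finally show "(\<integral>\<^sup>+\<omega>. ennreal (norm ((norm (Y \<omega>))\<^sup>2)) \<partial>M) < \<infinity>" .
    qed
    have "ennreal (\<integral>\<omega>. (norm (Y \<omega>))\<^sup>2 \<partial>M) \<le> ennreal (D * lam (N + 1) powr (- \<delta>))"
      using nn nn_integral_eq_integral[OF int] by simp
    then have "(\<integral>\<omega>. (norm (Y \<omega>))\<^sup>2 \<partial>M) \<le> D * lam (N + 1) powr (- \<delta>)"
      using D0 by (subst (asm) ennreal_le_iff) auto
    also have "\<dots> \<le> (D + 1) * lam (N + 1) powr (- \<delta>)" by (intro mult_right_mono) auto
    finally show "(\<integral>\<omega>. (norm (Y \<omega>))\<^sup>2 \<partial>M) \<le> (D + 1) * lam (N + 1) powr (- (s_Q lam e Q - s - \<epsilon>))"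
      by (simp add: \<delta>_def)
  qed
qed

section \<open>The solution map\<close>

lemma continuous_eq_on_closure:
  fixes f g :: "real \<Rightarrow> 'a::real_normed_vector"
  assumes T: "0 < T" and f: "continuous_on {0..T} f" and g: "continuous_on {0..T} g"
    and eq: "\<And>t. t \<in> {0..T} \<inter> \<rat> \<Longrightarrow> f t = g t" and t: "t \<in> {0..T}"
  shows "f t = g t"
proof -
  have "norm (f t - g t) \<le> 0"
    by (rule continuous_le_on_closure[of "{0..T} \<inter> \<rat>" "\<lambda>t. norm (f t - g t)"])
       (use t eq f g in \<open>auto simp: closure_Rats_Icc[OF T] intro!: continuous_intros\<close>)
  then show ?thesis by simp
qed

text \<open>The forcing noise is kept abstract: \<open>Z\<close> is an arbitrary process with measurable values, and the passage
from \<open>Z\<close> to the solutions is deterministic. The law of \<open>Z\<close> enters in \<open>weak_error\<close> only.\<close>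

locale additive_spde =
  J: scale lam e s J + J0: scale lam e s0 J0 + Jm: scale lam e "- sF" Jm +
  V: volterra "Defs.semigroup lam e Jm J" T "(s + sF) / 2" "\<lambda>x. F (inclusion e J Jp x)" L +
  P: sep_path_space T path_at + prob_space M
  for lam :: "nat \<Rightarrow> real" and e :: "nat \<Rightarrow> 'h::{real_inner,banach,second_countable_topology}"
    and s s0 sF T L :: real
    and J :: "'h \<Rightarrow> 'a::{real_inner,banach,second_countable_topology}"
    and J0 :: "'h \<Rightarrow> 'z::{real_inner,banach}" and Jp :: "'h \<Rightarrow> 'f::{real_inner,banach}"
    and Jm :: "'h \<Rightarrow> 'm::{real_inner,banach}" and F :: "'f \<Rightarrow> 'm"
    and path_at :: "'p::real_normed_vector \<Rightarrow> real \<Rightarrow> 'a" and M :: "'w measure" +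
  fixes Z :: "'w \<Rightarrow> 'p" and u0 :: 'z and \<Phi> :: "'p \<Rightarrow> real"
  assumes s: "0 \<le> s" "s < 1" "0 \<le> sF" "sF < 1" "s \<le> s0"
    and Z_measurable: "\<And>t. t \<in> {0..T} \<Longrightarrow> (\<lambda>\<omega>. path_at (Z \<omega>) t) \<in> borel_measurable M"
    and \<Phi>: "admissible_test_function \<Phi>"
begin

abbreviation w0 :: "real \<Rightarrow> 'a" where "w0 t \<equiv> Defs.semigroup lam e J0 J t u0"

abbreviation proj :: "nat \<Rightarrow> 'a \<Rightarrow> 'a" where "proj \<equiv> galerkin_proj e J"

abbreviation drift :: "'p \<Rightarrow> real \<Rightarrow> 'a" where
  "drift x \<equiv> V.conv (\<lambda>r. F (inclusion e J Jp (path_at x r)))"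

definition galerkin_path :: "nat \<Rightarrow> 'w \<Rightarrow> 'p \<Rightarrow> bool" where
  "galerkin_path N \<omega> v \<longleftrightarrow> (\<forall>t\<in>{0..T}. path_at v t = proj N (w0 t) + proj N (drift v t) + proj N (path_at (Z \<omega>) t))"

text \<open>The solution map, from forcing terms to elements of the path space. By \<open>solves_unique\<close> it does not depend
on the choices made in its definition.\<close>

definition \<Theta> :: "(real \<Rightarrow> 'a) \<Rightarrow> 'p" where "\<Theta> w = P.mk (V.Sol w)"

definition \<Psi> :: "'p \<Rightarrow> real" where "\<Psi> x = \<Phi> (\<Theta> (\<lambda>t. w0 t + path_at x t))"

definition PZ :: "nat \<Rightarrow> 'w \<Rightarrow> 'p" where "PZ N \<omega> = P.mk (\<lambda>t. proj N (path_at (Z \<omega>) t))"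

lemma continuous_w0: "continuous_on {0..T} w0"
  by (rule initial_continuous[OF J.scale_axioms J0.scale_axioms s(5)])

lemma path_\<Theta>:
  assumes "continuous_on {0..T} w" "t \<in> {0..T}" shows "path_at (\<Theta> w) t = V.Sol w t"
  unfolding \<Theta>_def by (rule P.path_mk) (use V.solves_Sol[OF assms(1)] assms(2) in \<open>auto simp: V.solves_def\<close>)

lemma solves_unique:
  assumes w: "continuous_on {0..T} w" and y: "V.solves w (path_at y)" shows "y = \<Theta> w"
proof (rule P.path_eqI)
  fix t assume t: "t \<in> {0..T}"
  obtain K where K: "V.stability_constant K" using V.solution_estimates by blast
  from V.stability_lipschitz[OF K y V.solves_Sol[OF w], of 0 t] t have "norm (path_at y t - V.Sol w t) \<le> 0" by simp
  then show "path_at y t = path_at (\<Theta> w) t" using path_\<Theta>[OF w t] by simp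
qed

lemma path_PZ: "t \<in> {0..T} \<Longrightarrow> path_at (PZ N \<omega>) t = proj N (path_at (Z \<omega>) t)"
  unfolding PZ_def by (rule P.path_mk)
    (rule continuous_on_compose2[OF linear_continuous_on[OF J.bounded_linear_galerkin] P.path_continuous], auto)

lemma PZ_measurable: "t \<in> {0..T} \<Longrightarrow> (\<lambda>\<omega>. path_at (PZ N \<omega>) t) \<in> borel_measurable M"
  using borel_measurable_continuous_on[OF linear_continuous_on[OF J.bounded_linear_galerkin] Z_measurable]
  by (simp add: path_PZ)

lemma \<Phi>_bounded: obtains B where "\<And>x. \<bar>\<Phi> x\<bar> \<le> B"
  using \<Phi> unfolding admissible_test_function_def bounded_iff by auto

definition \<Phi>_constant :: "real \<Rightarrow> bool" where
  "\<Phi>_constant K \<longleftrightarrow> 0 \<le> K \<and> (\<forall>x y. \<bar>\<Phi> x - \<Phi> y\<bar> \<le> K * norm (x - y)) \<and>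
    (\<forall>x y z. \<bar>\<Phi> x + \<Phi> y - 2 * \<Phi> z\<bar> \<le> K * (norm (x + y - 2 *\<^sub>R z) + (norm (x - z))\<^sup>2 + (norm (y - z))\<^sup>2))"

lemma \<Phi>_estimates: "\<exists>K. \<Phi>_constant K"
proof -
  have "C2_bounded_derivs \<Phi>" using \<Phi> by (simp add: admissible_test_function_def)
  then obtain K where "K > 0" "\<And>x y. norm (\<Phi> x - \<Phi> y) \<le> K * norm (x - y)"
    "\<And>a b c. norm (\<Phi> a + \<Phi> b - 2 *\<^sub>R \<Phi> c) \<le> K * (norm (a + b - 2 *\<^sub>R c) + (norm (a - c))\<^sup>2 + (norm (b - c))\<^sup>2)"
    by (rule C2_bounded_derivs_estimates) blast
  then show ?thesis unfolding \<Phi>_constant_def by (intro exI[of _ K]) auto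
qed

lemma
  assumes "\<Phi>_constant K"
  shows \<Phi>_constant_nonneg: "0 \<le> K" and \<Phi>_lipschitz: "\<bar>\<Phi> x - \<Phi> y\<bar> \<le> K * norm (x - y)"
    and \<Phi>_second_diff: "\<bar>\<Phi> x + \<Phi> y - 2 * \<Phi> z\<bar> \<le> K * (norm (x + y - 2 *\<^sub>R z) + (norm (x - z))\<^sup>2 + (norm (y - z))\<^sup>2)"
  using assms unfolding \<Phi>_constant_def by (elim conjE, simp)+

lemma \<Phi>_continuous: "continuous_on UNIV \<Phi>"
proof -
  obtain K where "\<Phi>_constant K" using \<Phi>_estimates by blast
  note K = \<Phi>_constant_nonneg[OF this] \<Phi>_lipschitz[OF this] \<Phi>_second_diff[OF this]
  show ?thesis by (rule lipschitz_on_continuous_on[of K]) (use K in \<open>auto simp: lipschitz_on_def dist_norm\<close>)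
qed

lemma \<Theta>_lipschitz:
  assumes K: "V.stability_constant K" and w: "continuous_on {0..T} w1" "continuous_on {0..T} w2"
    and m: "\<And>t. t \<in> {0..T} \<Longrightarrow> norm (w1 t - w2 t) \<le> m"
  shows "norm (\<Theta> w1 - \<Theta> w2) \<le> K * m"
  by (rule P.path_norm_leI)
     (use V.stability_lipschitz[OF K V.solves_Sol[OF w(1)] V.solves_Sol[OF w(2)] m] in \<open>auto simp: P.path_diff path_\<Theta> w\<close>)

lemma \<Theta>_second_diff:
  assumes K: "V.stability_constant K"
    and w: "continuous_on {0..T} wp" "continuous_on {0..T} wm" "continuous_on {0..T} w"
    and sum: "\<And>t. t \<in> {0..T} \<Longrightarrow> wp t + wm t = 2 *\<^sub>R w t"
    and m: "\<And>t. t \<in> {0..T} \<Longrightarrow> norm (wp t - w t) \<le> m"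
  shows "norm (\<Theta> wp + \<Theta> wm - 2 *\<^sub>R \<Theta> w) \<le> K * m\<^sup>2"
  by (rule P.path_norm_leI)
     (use V.stability_second_diff[OF K V.solves_Sol[OF w(1)] V.solves_Sol[OF w(2)] V.solves_Sol[OF w(3)] sum m] in
       \<open>auto simp: P.path_diff P.path_add P.path_scale path_\<Theta> w\<close>)

lemma continuous_forcing: "continuous_on {0..T} (\<lambda>t. w0 t + path_at x t)"
  by (intro continuous_intros continuous_w0 P.path_continuous)

text \<open>The second difference estimates of the solution map and of \<open>\<Phi>\<close> are composed; the squares of first
differences that this produces are controlled by Lipschitz continuity of the solution map.\<close>

lemma
  shows \<Psi>_second_diff: "\<exists>C\<ge>0. \<forall>x y z. x + y = 2 *\<^sub>R z \<longrightarrow> \<bar>\<Psi> x + \<Psi> y - 2 * \<Psi> z\<bar> \<le> C * (norm (x - z))\<^sup>2"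
    and \<Psi>_continuous: "continuous_on UNIV \<Psi>"
proof -
  obtain K where "\<Phi>_constant K" using \<Phi>_estimates by blast
  note K = \<Phi>_constant_nonneg[OF this] \<Phi>_lipschitz[OF this] \<Phi>_second_diff[OF this]
  obtain H where stab: "V.stability_constant H" using V.solution_estimates by blast
  then have H: "0 \<le> H" by (simp add: V.stability_constant_def)
  let ?f = "\<lambda>x t. w0 t + path_at x t"
  have lip: "norm (\<Theta> (?f x) - \<Theta> (?f y)) \<le> H * norm (x - y)" for x y
    by (rule \<Theta>_lipschitz[OF stab continuous_forcing continuous_forcing])
       (use P.norm_path_le[of _ "x - y"] in \<open>auto simp: P.path_diff\<close>)
  have "\<bar>\<Psi> x - \<Psi> y\<bar> \<le> (K * H) * norm (x - y)" for x y
    unfolding \<Psi>_def using K(2)[of "\<Theta> (?f x)" "\<Theta> (?f y)"] mult_left_mono[OF lip[of x y] K(1)] by (simp add: mult.assoc)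
  then show "continuous_on UNIV \<Psi>"
    by (intro lipschitz_on_continuous_on[of "K * H"]) (use K H in \<open>auto simp: lipschitz_on_def dist_norm\<close>)
  show "\<exists>C\<ge>0. \<forall>x y z. x + y = 2 *\<^sub>R z \<longrightarrow> \<bar>\<Psi> x + \<Psi> y - 2 * \<Psi> z\<bar> \<le> C * (norm (x - z))\<^sup>2"
  proof (intro exI[of _ "K * (H + 2 * H\<^sup>2)"] conjI allI impI)
    show "0 \<le> K * (H + 2 * H\<^sup>2)" using K H by simp
    fix x y z :: 'p assume xy: "x + y = 2 *\<^sub>R z"
    have yz: "norm (y - z) = norm (x - z)"
    proof -
      have "y - z = - (x - z)" using xy by (simp add: scaleR_2 algebra_simps)
      then show ?thesis by (simp only: norm_minus_cancel)
    qed
    have 1: "norm (\<Theta> (?f x) + \<Theta> (?f y) - 2 *\<^sub>R \<Theta> (?f z)) \<le> H * (norm (x - z))\<^sup>2"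
    proof (rule \<Theta>_second_diff[OF stab continuous_forcing continuous_forcing continuous_forcing])
      fix t assume t: "t \<in> {0..T}"
      have "path_at x t + path_at y t = 2 *\<^sub>R path_at z t"
        using arg_cong[OF xy, of "\<lambda>p. path_at p t"] t by (simp add: P.path_add P.path_scale)
      then show "w0 t + path_at x t + (w0 t + path_at y t) = 2 *\<^sub>R (w0 t + path_at z t)"
        by (simp add: scaleR_add_right scaleR_2 algebra_simps)
      show "norm (w0 t + path_at x t - (w0 t + path_at z t)) \<le> norm (x - z)"
        using P.norm_path_le[OF t, of "x - z"] t by (simp add: P.path_diff)
    qed
    have 2: "(norm (\<Theta> (?f x) - \<Theta> (?f z)))\<^sup>2 \<le> H\<^sup>2 * (norm (x - z))\<^sup>2"
      "(norm (\<Theta> (?f y) - \<Theta> (?f z)))\<^sup>2 \<le> H\<^sup>2 * (norm (x - z))\<^sup>2"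
      using power_mono[OF lip[of x z], of 2] power_mono[OF lip[of y z], of 2] by (simp_all add: power_mult_distrib yz)
    have "\<bar>\<Psi> x + \<Psi> y - 2 * \<Psi> z\<bar> \<le> K * (H * (norm (x - z))\<^sup>2 + H\<^sup>2 * (norm (x - z))\<^sup>2 + H\<^sup>2 * (norm (x - z))\<^sup>2)"
      unfolding \<Psi>_def by (rule order_trans[OF K(3)]) (intro mult_left_mono add_mono 1 2 K(1))
    then show "\<bar>\<Psi> x + \<Psi> y - 2 * \<Psi> z\<bar> \<le> K * (H + 2 * H\<^sup>2) * (norm (x - z))\<^sup>2"
      by (simp add: algebra_simps)
  qed
qed

lemma drift_conv: "drift_convolution lam e J Jp Jm F y t = V.conv (\<lambda>r. F (inclusion e J Jp (y r))) t"
  by (simp add: drift_convolution_def V.conv_def)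

lemma continuous_drift: "continuous_on {0..T} (drift x)"
  by (rule V.continuous_conv[OF V.continuous_B[OF P.path_continuous]])

text \<open>The mild equation holds almost surely at each time, hence almost surely at all rational times, and then at
all times by continuity of both sides.\<close>

lemma mild_solution_eq:
  assumes "is_mild_solution lam e M T J0 J Jp Jm path_at F Z u0 u"
  shows "AE \<omega> in M. \<Phi> (u \<omega>) = \<Psi> (Z \<omega>)"
proof -
  have "AE \<omega> in M. \<forall>t\<in>{0..T} \<inter> \<rat>. path_at (u \<omega>) t = w0 t + drift (u \<omega>) t + path_at (Z \<omega>) t"
  proof (subst AE_ball_countable)
    show "countable ({0..T} \<inter> \<rat>)" by (intro countable_Int2 countable_rat)
    show "\<forall>t\<in>{0..T} \<inter> \<rat>. AE \<omega> in M. path_at (u \<omega>) t = w0 t + drift (u \<omega>) t + path_at (Z \<omega>) t"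
      using assms unfolding is_mild_solution_def drift_conv by auto
  qed
  then show ?thesis
  proof eventually_elim
    fix \<omega>
    assume eq: "\<forall>t\<in>{0..T} \<inter> \<rat>. path_at (u \<omega>) t = w0 t + drift (u \<omega>) t + path_at (Z \<omega>) t"
    have "path_at (u \<omega>) t = w0 t + drift (u \<omega>) t + path_at (Z \<omega>) t" if "t \<in> {0..T}" for t
      by (rule continuous_eq_on_closure[OF P.T P.path_continuous _ _ that])
         (use eq in \<open>auto intro!: continuous_intros continuous_w0 continuous_drift P.path_continuous\<close>)
    then have "V.solves (\<lambda>t. w0 t + path_at (Z \<omega>) t) (path_at (u \<omega>))"
      unfolding V.solves_def using P.path_continuous by (auto simp: algebra_simps)
    then have "u \<omega> = \<Theta> (\<lambda>t. w0 t + path_at (Z \<omega>) t)" by (rule solves_unique[OF continuous_forcing])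
    then show "\<Phi> (u \<omega>) = \<Psi> (Z \<omega>)" by (simp add: \<Psi>_def)
  qed
qed

lemma galerkin_solution_eq:
  assumes "is_galerkin_solution lam e M T J0 J Jp Jm path_at F Z u0 N v"
  shows "AE \<omega> in M. galerkin_path N \<omega> (v \<omega>)"
proof -
  let ?r = "\<lambda>\<omega> t. proj N (w0 t)
     + proj N (drift (v \<omega>) t) + proj N (path_at (Z \<omega>) t)"
  have "AE \<omega> in M. \<forall>t\<in>{0..T} \<inter> \<rat>. path_at (v \<omega>) t = ?r \<omega> t"
  proof (subst AE_ball_countable)
    show "countable ({0..T} \<inter> \<rat>)" by (intro countable_Int2 countable_rat)
    show "\<forall>t\<in>{0..T} \<inter> \<rat>. AE \<omega> in M. path_at (v \<omega>) t = ?r \<omega> t"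
    proof
      fix t assume "t \<in> {0..T} \<inter> \<rat>"
      then have "AE \<omega> in M. path_at (v \<omega>) t \<in> J ` galerkin_space e N \<and> path_at (v \<omega>) t = ?r \<omega> t"
        using assms unfolding is_galerkin_solution_def drift_conv by blast
      then show "AE \<omega> in M. path_at (v \<omega>) t = ?r \<omega> t" by eventually_elim simp
    qed
  qed
  then show ?thesis
    unfolding galerkin_path_def
  proof eventually_elim
    fix \<omega> assume eq: "\<forall>t\<in>{0..T} \<inter> \<rat>. path_at (v \<omega>) t = ?r \<omega> t"
    have g: "continuous_on {0..T} (\<lambda>t. proj N (f t))" if "continuous_on {0..T} f" for f
      by (rule continuous_on_compose2[OF linear_continuous_on[OF J.bounded_linear_galerkin] that]) auto
    show "\<forall>t\<in>{0..T}. path_at (v \<omega>) t = ?r \<omega> t"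
    proof
      fix t assume t: "t \<in> {0..T}"
      show "path_at (v \<omega>) t = ?r \<omega> t"
        by (rule continuous_eq_on_closure[OF P.T P.path_continuous _ _ t])
           (use eq in \<open>auto intro!: continuous_on_add g continuous_w0 continuous_drift P.path_continuous\<close>)
    qed
  qed
qed

text \<open>The Galerkin solution solves the unprojected Volterra equation up to the high modes of its drift. Their
size is governed by the supremum of the Galerkin solution, which Gronwall's inequality bounds by that of
the forcing term; this makes the estimate linear in the norm of the noise.\<close>

lemma galerkin_drift_error:
  assumes \<theta>: "(s + sF) / 2 \<le> \<theta>" "\<theta> < 1"
  shows "\<exists>A\<ge>0. \<forall>N v \<omega>. galerkin_path N \<omega> v \<longrightarrow>
     norm (\<Theta> (\<lambda>t. proj N (w0 t) + path_at (PZ N \<omega>) t) - v)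
       \<le> lam (N + 1) powr (- (\<theta> - (s + sF) / 2)) * (A * (1 + norm (Z \<omega>)))"
proof -
  let ?B = "\<lambda>x. F (inclusion e J Jp x)"
  obtain K where gK: "V.gronwall_constant L K" using V.volterra_gronwall[OF V.L] by blast
  then have K: "1 \<le> K" by (simp add: V.gronwall_constant_def)
  define c0 where "c0 = lam 1 powr ((s - s0) / 2) * norm u0"
  define g where "g = norm (?B 0)"
  define b where "b z = L * (K * (c0 + z + g)) + g" for z
  define h where "h = T powr (1 - \<theta>) / (1 - \<theta>)"
  define A where "A = K * h * (L * K * (c0 + g + 1) + g)"
  have nn: "0 \<le> c0" "0 \<le> g" "0 \<le> h" "0 \<le> L" "0 \<le> K" using \<theta> K V.L by (auto simp: c0_def g_def h_def)
  have B_le: "norm (?B x) \<le> L * norm x + g" for x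
    using V.B_lipschitz[of x 0] norm_triangle_ineq2[of "?B x" "?B 0"] unfolding g_def by simp
  show ?thesis
  proof (intro exI[of _ A] conjI allI impI)
    show "0 \<le> A" using nn by (simp add: A_def)
    fix N v \<omega>
    assume "galerkin_path N \<omega> v"
    note v = this[unfolded galerkin_path_def]
    let ?c = "drift v"
    let ?P = "proj N"
    have cB: "continuous_on {0..T} (\<lambda>r. ?B (path_at v r))" by (rule V.continuous_B[OF P.path_continuous])
    have v_le: "norm (path_at v t) \<le> K * (c0 + norm (Z \<omega>) + g)" if t: "t \<in> {0..T}" for t
    proof (rule V.gronwallD[OF gK P.path_continuous nn(2) _ t, where f = "\<lambda>r. ?B (path_at v r)"])
      fix t assume t: "t \<in> {0..T}"
      show "norm (?B (path_at v t)) \<le> L * norm (path_at v t) + g" by (rule B_le)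
      have "norm (path_at v t) \<le> norm (?P (w0 t)) + norm (?P (?c t)) + norm (?P (path_at (Z \<omega>) t))"
        unfolding v[rule_format, OF t] by (intro norm_triangle_mono norm_triangle_le order_refl)
      moreover have "norm (?P (w0 t)) \<le> c0"
        unfolding c0_def
        by (rule order_trans[OF J.norm_galerkin_le initial_bound[OF J.scale_axioms J0.scale_axioms s(5)]]) (use t in simp)
      moreover have "norm (?P (path_at (Z \<omega>) t)) \<le> norm (Z \<omega>)"
        by (rule order_trans[OF J.norm_galerkin_le P.norm_path_le[OF t]])
      moreover have "norm (?P (?c t)) \<le> norm (?c t)" by (rule J.norm_galerkin_le)
      ultimately show "norm (path_at v t) \<le> (c0 + norm (Z \<omega>)) + norm (?c t)" by linarith
    qed (use nn in simp)
    have Bv: "norm (?B (path_at v t)) \<le> b (norm (Z \<omega>))" if t: "t \<in> {0..T}" for t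
      unfolding b_def using B_le[of "path_at v t"] mult_left_mono[OF v_le[OF t] nn(4)] by linarith
    have b0: "0 \<le> b (norm (Z \<omega>))" using nn by (simp add: b_def)
    define m where "m = lam (N + 1) powr (- (\<theta> - (s + sF) / 2)) * b (norm (Z \<omega>)) * h"
    have defect: "norm (?c t - ?P (?c t)) \<le> m" if t: "t \<in> {0..T}" for t
      unfolding m_def h_def
      by (rule galerkin_conv_bound[OF J.scale_axioms Jm.scale_axioms P.T s(1-4) \<theta> cB Bv t])
    let ?w = "\<lambda>t. ?P (w0 t) + path_at (PZ N \<omega>) t"
    have cw: "continuous_on {0..T} ?w"
      by (intro continuous_on_add P.path_continuous
          continuous_on_compose2[OF linear_continuous_on[OF J.bounded_linear_galerkin] continuous_w0]) auto
    have sol: "V.solves ?w (V.Sol ?w)" by (rule V.solves_Sol[OF cw])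
    then have cS: "continuous_on {0..T} (V.Sol ?w)" by (simp add: V.solves_def)
    have "norm (V.Sol ?w t - path_at v t) \<le> K * (m + 0)" if t: "t \<in> {0..T}" for t
    proof (rule V.gronwallD[OF gK, where f = "\<lambda>r. ?B (V.Sol ?w r) - ?B (path_at v r)" and y = "\<lambda>t. V.Sol ?w t - path_at v t"])
      fix t assume t: "t \<in> {0..T}"
      show "norm (?B (V.Sol ?w t) - ?B (path_at v t)) \<le> L * norm (V.Sol ?w t - path_at v t) + 0"
        using V.B_lipschitz by simp
      have "V.Sol ?w t - path_at v t = (?c t - ?P (?c t)) + V.conv (\<lambda>r. ?B (V.Sol ?w r) - ?B (path_at v r)) t"
        using sol v t V.conv_diff[OF V.continuous_B[OF cS] cB t] by (simp add: V.solves_def path_PZ)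
      then show "norm (V.Sol ?w t - path_at v t) \<le> m + norm (V.conv (\<lambda>r. ?B (V.Sol ?w r) - ?B (path_at v r)) t)"
        using norm_triangle_ineq[of "?c t - ?P (?c t)"] defect[OF t] by (smt (verit))
    next
      show "continuous_on {0..T} (\<lambda>t. V.Sol ?w t - path_at v t)" by (intro continuous_on_diff cS P.path_continuous)
      show "0 \<le> m" using b0 nn by (simp add: m_def)
    qed (use t in simp_all)
    then have "norm (\<Theta> ?w - v) \<le> K * m"
      by (intro P.path_norm_leI) (simp add: P.path_diff path_\<Theta>[OF cw])
    also have "\<dots> \<le> lam (N + 1) powr (- (\<theta> - (s + sF) / 2)) * (A * (1 + norm (Z \<omega>)))"
    proof -
      let ?z = "norm (Z \<omega>)"
      have "b ?z \<le> (L * K * (c0 + g + 1) + g) * (1 + ?z)"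
      proof -
        have "c0 + ?z + g \<le> (c0 + g + 1) * (1 + ?z)"
          using nn mult_nonneg_nonneg[of c0 ?z] mult_nonneg_nonneg[of g ?z] by (simp add: algebra_simps)
        then have "(L * K) * (c0 + ?z + g) \<le> (L * K) * ((c0 + g + 1) * (1 + ?z))"
          using nn by (intro mult_left_mono) auto
        moreover have "g \<le> g * (1 + ?z)" using nn by (simp add: algebra_simps)
        ultimately show ?thesis by (simp add: b_def algebra_simps)
      qed
      then have "K * h * b ?z \<le> K * h * ((L * K * (c0 + g + 1) + g) * (1 + ?z))"
        using nn by (intro mult_left_mono) auto
      then have "K * h * b ?z \<le> A * (1 + ?z)" by (simp only: A_def mult.assoc)
      then have "lam (N + 1) powr (- (\<theta> - (s + sF) / 2)) * (K * h * b ?z)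
         \<le> lam (N + 1) powr (- (\<theta> - (s + sF) / 2)) * (A * (1 + ?z))" by (intro mult_left_mono) auto
      then show ?thesis by (simp only: m_def ac_simps)
    qed
    finally show "norm (\<Theta> ?w - v) \<le> lam (N + 1) powr (- (\<theta> - (s + sF) / 2)) * (A * (1 + norm (Z \<omega>)))" .
  qed
qed

lemma \<Psi>_PZ_galerkin:
  obtains K where "0 \<le> K"
    "\<And>N \<omega>. \<bar>\<Psi> (PZ N \<omega>) - \<Phi> (\<Theta> (\<lambda>t. proj N (w0 t) + path_at (PZ N \<omega>) t))\<bar>
       \<le> K * (lam (N + 1) powr (- ((s0 - s) / 2)) * norm u0)"
proof -
  obtain K where "\<Phi>_constant K" using \<Phi>_estimates by blast
  note K = \<Phi>_constant_nonneg[OF this] \<Phi>_lipschitz[OF this] \<Phi>_second_diff[OF this]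
  obtain H where stab: "V.stability_constant H" using V.solution_estimates by blast
  then have H: "0 \<le> H" by (simp add: V.stability_constant_def)
  show ?thesis
  proof (rule that[of "K * H"])
    show "0 \<le> K * H" using K H by simp
    fix N \<omega>
    have "norm (\<Theta> (\<lambda>t. w0 t + path_at (PZ N \<omega>) t) - \<Theta> (\<lambda>t. proj N (w0 t) + path_at (PZ N \<omega>) t))
      \<le> H * (lam (N + 1) powr (- ((s0 - s) / 2)) * norm u0)"
    proof (rule \<Theta>_lipschitz[OF stab continuous_forcing])
      show "continuous_on {0..T} (\<lambda>t. proj N (w0 t) + path_at (PZ N \<omega>) t)"
        by (intro continuous_on_add P.path_continuous
          continuous_on_compose2[OF linear_continuous_on[OF J.bounded_linear_galerkin] continuous_w0]) auto
      fix t assume "t \<in> {0..T}"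
      then show "norm (w0 t + path_at (PZ N \<omega>) t - (proj N (w0 t) + path_at (PZ N \<omega>) t))
          \<le> lam (N + 1) powr (- ((s0 - s) / 2)) * norm u0"
        using initial_galerkin[OF J.scale_axioms J0.scale_axioms s(5), of t u0 N] by simp
    qed
    then show "\<bar>\<Psi> (PZ N \<omega>) - \<Phi> (\<Theta> (\<lambda>t. proj N (w0 t) + path_at (PZ N \<omega>) t))\<bar>
       \<le> K * H * (lam (N + 1) powr (- ((s0 - s) / 2)) * norm u0)"
      unfolding \<Psi>_def mult.assoc by (intro order_trans[OF K(2)] mult_left_mono K(1))
  qed
qed

end

section \<open>The weak error\<close>

lemma half_abs_triangle:
  fixes a b c p r :: real
  assumes "\<bar>2 * (a - b)\<bar> \<le> p" "\<bar>b - c\<bar> \<le> r"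
  shows "\<bar>a - c\<bar> \<le> p + r"
  using assms by (simp add: abs_le_iff)

context additive_spde begin

text \<open>Assembles the three contributions: the reflection identity with the second difference of \<open>\<Psi>\<close>, the
projection of the initial value, and the projection of the drift.\<close>

lemma weak_error:
  fixes \<epsilon> :: real
  assumes W: "assumption_W M G \<beta>" and Q: "assumption_Q Q q e"
    and tr: "finite_trace e (neg_A_power lam e (-1) \<circ> Q)"
    and Z: "is_stochastic_convolution lam e q M \<beta> T J path_at Z"
    and u: "is_mild_solution lam e M T J0 J Jp Jm path_at F Z u0 u"
    and uN: "\<And>N. N \<ge> 1 \<Longrightarrow> is_galerkin_solution lam e M T J0 J Jp Jm path_at F Z u0 N (uN N)"
    and \<epsilon>: "0 < \<epsilon>" "\<epsilon> < s_Q lam e Q - s"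
  shows "\<exists>C>0. \<forall>N\<ge>1. \<bar>expectation (\<lambda>\<omega>. \<Phi> (u \<omega>)) - expectation (\<lambda>\<omega>. \<Phi> (uN N \<omega>))\<bar>
     \<le> C * (lam (N + 1) powr (- ((s0 - s) / 2)) * norm u0 + lam (N + 1) powr (- (1 - (sF + s + \<epsilon>) / 2))
          + lam (N + 1) powr (- (s_Q lam e Q - s - \<epsilon>)))"
proof -
  have "s_Q lam e Q \<le> 1"
    by (rule trace_summable(2)[OF J.spectral_axioms Q tr, of "s_Q lam e Q - 1"]) simp
  define \<theta> where "\<theta> = 1 - \<epsilon> / 2"
  have \<theta>: "(s + sF) / 2 \<le> \<theta>" "\<theta> < 1" "- (\<theta> - (s + sF) / 2) = - (1 - (sF + s + \<epsilon>) / 2)"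
    using \<epsilon> \<open>s_Q lam e Q \<le> 1\<close> s by (auto simp: \<theta>_def field_simps)
  obtain B where B: "\<And>x. \<bar>\<Phi> x\<bar> \<le> B" using \<Phi>_bounded by blast
  have \<Psi>B: "\<bar>\<Psi> x\<bar> \<le> B" for x unfolding \<Psi>_def by (rule B)
  obtain C\<Psi> where C\<Psi>: "0 \<le> C\<Psi>" "\<And>x y z. x + y = 2 *\<^sub>R z \<Longrightarrow> \<bar>\<Psi> x + \<Psi> y - 2 * \<Psi> z\<bar> \<le> C\<Psi> * (norm (x - z))\<^sup>2"
    using \<Psi>_second_diff by blast
  obtain K1 where K1: "0 \<le> K1" "\<And>N \<omega>. \<bar>\<Psi> (PZ N \<omega>) - \<Phi> (\<Theta> (\<lambda>t. proj N (w0 t) + path_at (PZ N \<omega>) t))\<bar>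
       \<le> K1 * (lam (N + 1) powr (- ((s0 - s) / 2)) * norm u0)"
    using \<Psi>_PZ_galerkin by blast
  obtain K where "\<Phi>_constant K" using \<Phi>_estimates by blast
  note K = \<Phi>_constant_nonneg[OF this] \<Phi>_lipschitz[OF this]
  obtain A where A: "0 \<le> A" "\<forall>N v \<omega>. galerkin_path N \<omega> v \<longrightarrow>
     norm (\<Theta> (\<lambda>t. proj N (w0 t) + path_at (PZ N \<omega>) t) - v)
       \<le> lam (N + 1) powr (- (\<theta> - (s + sF) / 2)) * (A * (1 + norm (Z \<omega>)))"
    using galerkin_drift_error[OF \<theta>(1,2)] by blast
  obtain C1 where C1: "0 < C1" and tail: "\<forall>N Y. (\<forall>\<omega>. \<forall>t\<in>{0..T}. path_at (Y \<omega>) t = path_at (Z \<omega>) t - proj N (path_at (Z \<omega>) t)) \<longrightarrow>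
     integrable M (\<lambda>\<omega>. (norm (Y \<omega>))\<^sup>2) \<and> (\<integral>\<omega>. (norm (Y \<omega>))\<^sup>2 \<partial>M) \<le> C1 * lam (N + 1) powr (- (s_Q lam e Q - s - \<epsilon>))"
    using noise_tail[OF J.scale_axioms s(1) P.T P.ps W Q tr Z \<epsilon>] by blast
  \<comment> \<open>For \<open>N = 0\<close> the projection vanishes, so the tail estimate covers the whole noise.\<close>
  have Z2: "integrable M (\<lambda>\<omega>. (norm (Z \<omega>))\<^sup>2)"
    using tail[rule_format, of Z 0] by (simp add: galerkin_proj_def)
  define m2 where "m2 = expectation (\<lambda>\<omega>. (norm (Z \<omega>))\<^sup>2)"
  have m2: "0 \<le> m2" unfolding m2_def by (intro integral_nonneg_AE AE_I2) simp
  have QZ: "integrable M (\<lambda>\<omega>. (norm (Z \<omega> - PZ N \<omega>))\<^sup>2)"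
    "expectation (\<lambda>\<omega>. (norm (Z \<omega> - PZ N \<omega>))\<^sup>2) \<le> C1 * lam (N + 1) powr (- (s_Q lam e Q - s - \<epsilon>))" for N
    using tail[rule_format, of "\<lambda>\<omega>. Z \<omega> - PZ N \<omega>" N] by (auto simp: P.path_diff path_PZ)
  have int: "integrable M (\<lambda>\<omega>. f (X \<omega>))"
    if "continuous_on UNIV f" "\<And>x. \<bar>f x\<bar> \<le> B" "\<And>t. t \<in> {0..T} \<Longrightarrow> (\<lambda>\<omega>. path_at (X \<omega>) t) \<in> borel_measurable M"
    for f :: "'p \<Rightarrow> real" and X
    by (rule integrable_const_bound[OF _ P.functional_measurable[OF that(1,3)], of B]) (use that(2) in auto)
  have um: "(\<lambda>\<omega>. path_at (u \<omega>) t) \<in> borel_measurable M" if "t \<in> {0..T}" for t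
    using u that by (simp add: is_mild_solution_def)
  note int_u = int[OF \<Phi>_continuous B um] and int_Z = int[OF \<Psi>_continuous \<Psi>B Z_measurable]
    and int_PZ = int[OF \<Psi>_continuous \<Psi>B PZ_measurable]
  have Eu: "expectation (\<lambda>\<omega>. \<Phi> (u \<omega>)) = expectation (\<lambda>\<omega>. \<Psi> (Z \<omega>))"
    by (rule integral_cong_AE[OF _ _ mild_solution_eq[OF u]])
       (use int_u int_Z in \<open>auto intro: borel_measurable_integrable\<close>)
  define D where "D = C\<Psi> * C1 + K1 + K * A * (2 + m2) + 1"
  have D: "0 < D" "C\<Psi> * C1 \<le> D" "K1 \<le> D" "K * A * (2 + m2) \<le> D"
    using C\<Psi> C1 K1 K A m2 by (auto simp: D_def add_nonneg_pos intro!: add_nonneg_pos add_nonneg_nonneg)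
  show ?thesis
  proof (intro exI[of _ D] conjI allI impI D(1))
    fix N :: nat assume N: "1 \<le> N"
    let ?l1 = "lam (N + 1) powr (- ((s0 - s) / 2)) * norm u0"
    let ?l2 = "lam (N + 1) powr (- (1 - (sF + s + \<epsilon>) / 2))"
    let ?l3 = "lam (N + 1) powr (- (s_Q lam e Q - s - \<epsilon>))"
    have vm: "(\<lambda>\<omega>. path_at (uN N \<omega>) t) \<in> borel_measurable M" if "t \<in> {0..T}" for t
      using uN[OF N] that by (simp add: is_galerkin_solution_def)
    note int_v = int[OF \<Phi>_continuous B vm]
    \<comment> \<open>The noise with the sign of its high modes changed; \<open>PZ N \<omega>\<close> is the midpoint of \<open>Z \<omega>\<close> and \<open>R \<omega>\<close>.\<close>
    define R where "R \<omega> = 2 *\<^sub>R PZ N \<omega> - Z \<omega>" for \<omega>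
    have R: "path_at (R \<omega>) t = 2 *\<^sub>R proj N (path_at (Z \<omega>) t) - path_at (Z \<omega>) t" if "t \<in> {0..T}" for \<omega> t
      using that by (simp add: R_def P.path_diff P.path_scale path_PZ)
    have Rm: "(\<lambda>\<omega>. path_at (R \<omega>) t) \<in> borel_measurable M" if "t \<in> {0..T}" for t
    proof -
      have "(\<lambda>\<omega>. 2 *\<^sub>R path_at (PZ N \<omega>) t - path_at (Z \<omega>) t) \<in> borel_measurable M"
        using PZ_measurable[OF that, of N] Z_measurable[OF that] by measurable
      then show ?thesis by (simp add: R[OF that] path_PZ[OF that])
    qed
    note int_R = int[OF \<Psi>_continuous \<Psi>B Rm]
    have mirror: "expectation (\<lambda>\<omega>. \<Psi> (Z \<omega>)) = expectation (\<lambda>\<omega>. \<Psi> (R \<omega>))"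
      by (rule reflection[OF J.scale_axioms s(1) P.T P.ps W Z \<Psi>_continuous \<Psi>B R])
    have eq: "2 * (expectation (\<lambda>\<omega>. \<Psi> (Z \<omega>)) - expectation (\<lambda>\<omega>. \<Psi> (PZ N \<omega>)))
       = expectation (\<lambda>\<omega>. \<Psi> (Z \<omega>) + \<Psi> (R \<omega>) - 2 * \<Psi> (PZ N \<omega>))"
      using mirror int_Z int_R int_PZ by simp
    have "\<bar>expectation (\<lambda>\<omega>. \<Psi> (Z \<omega>) + \<Psi> (R \<omega>) - 2 * \<Psi> (PZ N \<omega>))\<bar>
       \<le> expectation (\<lambda>\<omega>. \<bar>\<Psi> (Z \<omega>) + \<Psi> (R \<omega>) - 2 * \<Psi> (PZ N \<omega>)\<bar>)"
      by (rule integral_abs_bound)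
    also have "\<dots> \<le> expectation (\<lambda>\<omega>. C\<Psi> * (norm (Z \<omega> - PZ N \<omega>))\<^sup>2)"
    proof (rule integral_mono)
      show "integrable M (\<lambda>\<omega>. \<bar>\<Psi> (Z \<omega>) + \<Psi> (R \<omega>) - 2 * \<Psi> (PZ N \<omega>)\<bar>)"
        using int_Z int_R int_PZ by (intro integrable_abs Bochner_Integration.integrable_diff
            Bochner_Integration.integrable_add integrable_mult_right) auto
      show "integrable M (\<lambda>\<omega>. C\<Psi> * (norm (Z \<omega> - PZ N \<omega>))\<^sup>2)" using QZ(1) by simp
      show "\<bar>\<Psi> (Z \<omega>) + \<Psi> (R \<omega>) - 2 * \<Psi> (PZ N \<omega>)\<bar> \<le> C\<Psi> * (norm (Z \<omega> - PZ N \<omega>))\<^sup>2" for \<omega>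
        by (rule C\<Psi>(2)) (simp add: R_def)
    qed
    also have "\<dots> \<le> C\<Psi> * (C1 * ?l3)"
      using mult_left_mono[OF QZ(2)[of N] C\<Psi>(1)] by simp
    finally have step1: "\<bar>2 * (expectation (\<lambda>\<omega>. \<Psi> (Z \<omega>)) - expectation (\<lambda>\<omega>. \<Psi> (PZ N \<omega>)))\<bar> \<le> C\<Psi> * C1 * ?l3"
      unfolding eq by (simp only: mult.assoc)
    have "\<bar>expectation (\<lambda>\<omega>. \<Psi> (PZ N \<omega>)) - expectation (\<lambda>\<omega>. \<Phi> (uN N \<omega>))\<bar>
       = \<bar>expectation (\<lambda>\<omega>. \<Psi> (PZ N \<omega>) - \<Phi> (uN N \<omega>))\<bar>"
      using int_PZ int_v by simp
    also have "\<dots> \<le> expectation (\<lambda>\<omega>. \<bar>\<Psi> (PZ N \<omega>) - \<Phi> (uN N \<omega>)\<bar>)" by (rule integral_abs_bound)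
    also have "\<dots> \<le> expectation (\<lambda>\<omega>. K1 * ?l1 + K * (?l2 * (A * (2 + (norm (Z \<omega>))\<^sup>2))))"
    proof (rule integral_mono_AE)
      show "integrable M (\<lambda>\<omega>. \<bar>\<Psi> (PZ N \<omega>) - \<Phi> (uN N \<omega>)\<bar>)"
        using int_PZ int_v by (intro integrable_abs Bochner_Integration.integrable_diff) auto
      show "integrable M (\<lambda>\<omega>. K1 * ?l1 + K * (?l2 * (A * (2 + (norm (Z \<omega>))\<^sup>2))))"
        using Z2 by simp
      show "AE \<omega> in M. \<bar>\<Psi> (PZ N \<omega>) - \<Phi> (uN N \<omega>)\<bar> \<le> K1 * ?l1 + K * (?l2 * (A * (2 + (norm (Z \<omega>))\<^sup>2)))"
        using galerkin_solution_eq[OF uN[OF N]]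
      proof eventually_elim
        fix \<omega>
        let ?v = "\<Theta> (\<lambda>t. proj N (w0 t) + path_at (PZ N \<omega>) t)"
        assume "galerkin_path N \<omega> (uN N \<omega>)"
        then have "norm (?v - uN N \<omega>) \<le> ?l2 * (A * (1 + norm (Z \<omega>)))"
          using A(2) unfolding \<theta>(3) by blast
        also have "\<dots> \<le> ?l2 * (A * (2 + (norm (Z \<omega>))\<^sup>2))"
        proof (intro mult_left_mono A(1))
          show "1 + norm (Z \<omega>) \<le> 2 + (norm (Z \<omega>))\<^sup>2"
            using zero_le_power2[of "norm (Z \<omega>) - 1"] by (simp add: power2_diff) (smt (verit) norm_ge_zero)
        qed simp
        finally have "\<bar>\<Phi> ?v - \<Phi> (uN N \<omega>)\<bar> \<le> K * (?l2 * (A * (2 + (norm (Z \<omega>))\<^sup>2)))"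
          by (intro order_trans[OF K(2)] mult_left_mono K(1))
        then show "\<bar>\<Psi> (PZ N \<omega>) - \<Phi> (uN N \<omega>)\<bar> \<le> K1 * ?l1 + K * (?l2 * (A * (2 + (norm (Z \<omega>))\<^sup>2)))"
          using K1(2)[of N \<omega>] by linarith
      qed
    qed
    also have "\<dots> = K1 * ?l1 + K * A * (2 + m2) * ?l2"
      using Z2 by (simp add: m2_def prob_space algebra_simps)
    finally have step2: "\<bar>expectation (\<lambda>\<omega>. \<Psi> (PZ N \<omega>)) - expectation (\<lambda>\<omega>. \<Phi> (uN N \<omega>))\<bar> \<le> K1 * ?l1 + K * A * (2 + m2) * ?l2" .
    have "\<bar>expectation (\<lambda>\<omega>. \<Phi> (u \<omega>)) - expectation (\<lambda>\<omega>. \<Phi> (uN N \<omega>))\<bar> \<le> C\<Psi> * C1 * ?l3 + (K1 * ?l1 + K * A * (2 + m2) * ?l2)"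
    proof -
      from half_abs_triangle[OF step1 step2] show ?thesis unfolding Eu .
    qed
    also have "\<dots> \<le> D * ?l3 + (D * ?l1 + D * ?l2)"
      by (intro add_mono mult_right_mono D) auto
    finally show "\<bar>expectation (\<lambda>\<omega>. \<Phi> (u \<omega>)) - expectation (\<lambda>\<omega>. \<Phi> (uN N \<omega>))\<bar> \<le> D * (?l1 + ?l2 + ?l3)"
      by (simp add: algebra_simps)
  qed
qed

end

theorem theorem4p6:
  fixes A Q :: "'h::{real_inner,banach,second_countable_topology} \<Rightarrow> 'h"
    and D :: "'h set"
    and lam q :: "nat \<Rightarrow> real"
    and e :: "nat \<Rightarrow> 'h"
    and T s s0 sF :: real
    and J0 :: "'h \<Rightarrow> 'z::{real_inner,banach}"
    and J :: "'h \<Rightarrow> 'a::{real_inner,banach,second_countable_topology}"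
    and Jp :: "'h \<Rightarrow> 'f::{real_inner,banach}"
    and Jm :: "'h \<Rightarrow> 'm::{real_inner,banach}"
    and F :: "'f \<Rightarrow> 'm"
    and path_at :: "'p::real_normed_vector \<Rightarrow> real \<Rightarrow> 'a"
    and \<Phi> :: "'p \<Rightarrow> real"
    and M :: "'w measure"
    and G :: "real \<Rightarrow> 'w measure"
    and \<beta> :: "nat \<Rightarrow> real \<Rightarrow> 'w \<Rightarrow> real"
    and Z u :: "'w \<Rightarrow> 'p"
    and uN :: "nat \<Rightarrow> 'w \<Rightarrow> 'p"
    and u0 :: 'z
  assumes "0 < T"
    and "assumption_A D A lam e"
    and "assumption_Q Q q e"
    and "assumption_W M G \<beta>"
    and "finite_trace e (neg_A_power lam e (-1) \<circ> Q)"
    and "0 \<le> sF" and "sF < 1" and "sF < s_Q lam e Q"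
    and "0 \<le> s" and "sF \<le> s" and "s < 1" and "s < s_Q lam e Q"
    and "s \<le> s0"
    and "is_scale_space lam e s0 J0"
    and "is_scale_space lam e s J"
    and "is_scale_space lam e sF Jp"
    and "is_scale_space lam e (- sF) Jm"
    and "C2_bounded_derivs F"
    and "is_path_space T path_at"
    and "admissible_test_function \<Phi>"
    and "is_stochastic_convolution lam e q M \<beta> T J path_at Z"
    and "is_mild_solution lam e M T J0 J Jp Jm path_at F Z u0 u"
    and "\<forall>N\<ge>1. is_galerkin_solution lam e M T J0 J Jp Jm path_at F Z u0 N (uN N)"
  shows "\<forall>\<epsilon>. 0 < \<epsilon> \<and> \<epsilon> < s_Q lam e Q - s \<longrightarrow>
           (\<exists>C>0. \<forall>N\<ge>1.
              \<bar>prob_space.expectation M (\<lambda>\<omega>. \<Phi> (u \<omega>))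
                 - prob_space.expectation M (\<lambda>\<omega>. \<Phi> (uN N \<omega>))\<bar>
              \<le> C * (1 / lam (N + 1) powr ((s0 - s) / 2) * norm u0
                     + 1 / lam (N + 1) powr (1 - (sF + s + \<epsilon>) / 2)
                     + 1 / lam (N + 1) powr (s_Q lam e Q - s - \<epsilon>)))"
proof -
  interpret prob_space M using assms(4) by (simp add: assumption_W_def)
  have onb: "orthonormal_basis e" and pos: "\<And>k. k \<ge> 1 \<Longrightarrow> 0 < lam k" and mono: "mono_on {1..} lam"
    using assms(2) by (simp_all add: assumption_A_def)
  have spec: "spectral lam e"
    by (rule spectral.intro[OF onb pos]) (use mono in \<open>auto simp: mono_on_def\<close>)
  have sc: "scale lam e s0 J0" "scale lam e s J" "scale lam e sF Jp" "scale lam e (- sF) Jm"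
    using spec assms(14-17) by (auto intro!: scale.intro scale_axioms.intro)
  obtain L where V: "volterra (Defs.semigroup lam e Jm J) T ((s + sF) / 2) (\<lambda>x. F (inclusion e J Jp x)) L"
    using nemytskii_volterra[OF sc(2-4) assms(1,9,11,6,7,10,18)] by blast
  have "sep_path_space T path_at" using assms(1,19) by (simp add: sep_path_space_def path_space_def)
  then interpret additive_spde lam e s s0 sF T L J J0 Jp Jm F path_at M Z u0 \<Phi>
    using sc(1,2,4) V assms(1,6,7,9,11,13,20,21) prob_space_axioms
    by (intro additive_spde.intro additive_spde_axioms.intro) (auto simp: is_stochastic_convolution_def)
  show ?thesis
  proof (intro allI impI)
    fix \<epsilon> :: real assume \<epsilon>: "0 < \<epsilon> \<and> \<epsilon> < s_Q lam e Q - s"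
    obtain C where C: "C > 0" "\<And>N. N \<ge> 1 \<Longrightarrow> \<bar>expectation (\<lambda>\<omega>. \<Phi> (u \<omega>)) - expectation (\<lambda>\<omega>. \<Phi> (uN N \<omega>))\<bar>
      \<le> C * (lam (N + 1) powr (- ((s0 - s) / 2)) * norm u0 + lam (N + 1) powr (- (1 - (sF + s + \<epsilon>) / 2))
          + lam (N + 1) powr (- (s_Q lam e Q - s - \<epsilon>)))"
      using weak_error[OF assms(4,3,5,21,22) assms(23)[rule_format] \<epsilon>[THEN conjunct1] \<epsilon>[THEN conjunct2]] by blast
    have "1 / lam (N + 1) powr x = lam (N + 1) powr (- x)" for N x by (rule powr_minus_divide[symmetric])
    then show "\<exists>C>0. \<forall>N\<ge>1.
              \<bar>prob_space.expectation M (\<lambda>\<omega>. \<Phi> (u \<omega>))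
                 - prob_space.expectation M (\<lambda>\<omega>. \<Phi> (uN N \<omega>))\<bar>
              \<le> C * (1 / lam (N + 1) powr ((s0 - s) / 2) * norm u0
                     + 1 / lam (N + 1) powr (1 - (sF + s + \<epsilon>) / 2)
                     + 1 / lam (N + 1) powr (s_Q lam e Q - s - \<epsilon>))"
      using C by (intro exI[of _ C]) (simp only: simp_thms, blast)
  qed
qed

end
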